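(* For $n\ge 3$, let $r=r(n)\ge 3$ and $k=k(n)\ge 2$ be integers, and assume that for infinitely many values of $n$, $r$ divides $kn$ and $r-1$ divides $n$; let $n\to\infty$ along these values. Let $\mathcal{H}$ be chosen uniformly at random from $\mathcal{H}_r(k,n)$ and let $Y$ be the number of loose Hamilton cycles in $\mathcal{H}$. If $r^4k^2=o(n)$ then \[ \mathbb{E}(Y)=\sqrt{\frac{\pi}{2n}}\,(r-1)\left((k-1)(r-1)\left(\frac{rk-k-r}{rk-k}\right)^{(r-1)(rk-r-k)/r}\right)^{n/(r-1)}\exp\left(\frac{(r-1)(rk-r-2)}{2(rk-r-k)}+O\left(\frac{r^4k^2}{n}\right)\right). \]
   Context: A simple $r$-uniform hypergraph on a vertex set $V$ with $|V|=n$ is a set of $r$-element subsets of $V$ (its edges); no loops and no repeated edges are allowed. $\mathcal{H}_r(k,n)$ is the set of all simple $r$-uniform hypergraphs on $V$ in which every vertex has degree $k$. When $r-1$ divides $n$, a loose Hamilton cycle is a set of $t=n/(r-1)$ edges which can be labelled $e_0,\ldots,e_{t-1}$ such that, for some ordering $v_0,\ldots,v_{n-1}$ of the vertices, $e_i=\{v_{i(r-1)},v_{i(r-1)+1},\ldots,v_{i(r-1)+(r-1)}\}$ for $i=0,\ldots,t-1$, where vertex indices are taken modulo $n$. (So $t$ vertices have degree 2 in the cycle and the remaining vertices have degree 1.) Loose Hamilton cycles are counted as edge sets. All asymptotics are as $n\to\infty$ along values of $n$ for which $r\mid kn$ and $(r-1)\mid n$. *)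

theory Defs
  imports "HOL-Probability.Probability" "HOL-Library.Landau_Symbols"
begin

definition hdegree :: "'a set set \<Rightarrow> 'a \<Rightarrow> nat" where
  "hdegree H x = card {e \<in> H. x \<in> e}"

definition regular_uniform_hypergraphs :: "'a set \<Rightarrow> nat \<Rightarrow> nat \<Rightarrow> 'a set set set" where
  "regular_uniform_hypergraphs V r k =
     {H. (\<forall>e\<in>H. e \<subseteq> V \<and> card e = r) \<and> (\<forall>x\<in>V. hdegree H x = k)}"

text \<open>
  A cycle is its edge set. The cardinality condition says that the edges
  \<open>e\<^sub>0, \<dots>, e\<^sub>t\<^sub>-\<^sub>1\<close> are distinct; it only matters for degenerate small \<open>t\<close>.
\<close>

definition loose_Hamilton_cycle :: "'a set \<Rightarrow> nat \<Rightarrow> 'a set set \<Rightarrow> bool" where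
  "loose_Hamilton_cycle V r C \<longleftrightarrow>
     (r - 1) dvd card V \<and> card C = card V div (r - 1) \<and>
     (\<exists>v. bij_betw v {..<card V} V \<and>
          C = (\<lambda>i. (\<lambda>j. v ((i * (r - 1) + j) mod card V)) ` {0..r - 1}) ` {..<card V div (r - 1)})"

definition num_loose_Hamilton_cycles :: "'a set \<Rightarrow> nat \<Rightarrow> 'a set set \<Rightarrow> nat" where
  "num_loose_Hamilton_cycles V r H = card {C. C \<subseteq> H \<and> loose_Hamilton_cycle V r C}"

text \<open>
  The vertex set is \<open>{..<n}\<close>. \<open>pmf_of_set\<close> is the uniform distribution only on a nonempty
  finite set, so a statement about this value for large \<open>n\<close> includes the claim that
  regular hypergraphs exist for those \<open>n\<close>.
\<close>

definition expected_loose_Hamilton_cycles :: "nat \<Rightarrow> nat \<Rightarrow> nat \<Rightarrow> real" where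
  "expected_loose_Hamilton_cycles r k n =
     measure_pmf.expectation (pmf_of_set (regular_uniform_hypergraphs {..<n} r k))
       (\<lambda>H. real (num_loose_Hamilton_cycles {..<n} r H))"

definition admissible :: "(nat \<Rightarrow> nat) \<Rightarrow> (nat \<Rightarrow> nat) \<Rightarrow> nat set" where
  "admissible r k = {n. n \<ge> 3 \<and> r n dvd k n * n \<and> (r n - 1) dvd n}"

text \<open>The filter for \<open>n \<longrightarrow> \<infinity>\<close> along the admissible values of \<open>n\<close>.\<close>

definition along_admissible :: "(nat \<Rightarrow> nat) \<Rightarrow> (nat \<Rightarrow> nat) \<Rightarrow> nat filter" where
  "along_admissible r k = inf at_top (principal (admissible r k))"

end

theory Submission imports Defs begin

text \<open>
  A regular hypergraph with \<open>m\<close> edges is encoded by a word: a map from the slots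
  \<open>(j, i)\<close>, position \<open>i\<close> of edge \<open>j\<close>, to the vertices, in which every vertex \<open>v\<close>
  occurs \<open>d v\<close> times. The hypergraph is loopless if two slots of the same edge never carry
  the same vertex. These conditions are imposed one pair of slots at a time. Exchanging the
  letters of two slots shows that, whatever conditions have been imposed so far, the next pair
  coincides with probability \<open>q = (\<Sum>v. d v (d v - 1)) / (M (M - 1))\<close> up to an error
  \<open>O(r k\<^sup>2 / M\<^sup>2)\<close>, where \<open>M\<close> is the number of slots; multiplying the factors \<open>1 - q\<close>
  counts the loopless words. Repeated or forbidden edges force three
  coincidences at once, so they are negligible among loopless words.

  The expectation is the sum over all loose Hamilton cycles \<open>C\<close> of the probability that
  \<open>C\<close> is contained in \<open>H\<close>. The hypergraphs containing \<open>C\<close> are counted by the same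
  enumeration, with degrees \<open>k - 2\<close> and \<open>k - 1\<close> and with the edges of \<open>C\<close> forbidden. A cycle
  arises from \<open>2 t ((r - 2)!)\<^sup>t\<close> orderings of the vertices (dihedral symmetry, and
  permutations inside the edges), and Stirling's formula gives the final form.
\<close>

section \<open>Words avoiding coincidences\<close>

text \<open>Coincidences inside one edge are not independent, so loopless words are reached by
  conditioning on one pair at a time: the logarithm of the final ratio is a sum of about
  \<open>M r / 2\<close> terms, and errors \<open>O(r k^2 / M^2)\<close> add up to
  \<open>O(r^2 k^2 / M)\<close>. This works because a set of conditions enters a switching only
  through being contained in \<open>conflicts\<close>: an exchange is spoiled by at most
  \<open>2 k r\<close> slots, however many conditions there are. The upper bound for a coincidence
  comes straight from a switching. The lower bound needs the reverse exchange, which starts from the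
  distribution of a single letter; that is controlled because the letter counts add up to the total.
  A repeated edge is recorded by three common vertices, not by all \<open>r\<close>: two would give
  a bound of order \<open>k^2\<close>, three give \<open>O(k^3 / m)\<close> for \<open>m\<close>
  edges. As \<open>m r\<close> is of order \<open>k n\<close>, all errors are
  \<open>O(r^2 k^2 / n)\<close>. They are uniform in the forbidden edge set, so every cycle
  contributes the same main term up to a factor \<open>exp \<theta>\<close> with a common bound on
  \<open>\<theta>\<close>.\<close>

definition words :: "'s set \<Rightarrow> 'v set \<Rightarrow> ('v \<Rightarrow> nat) \<Rightarrow> ('s \<Rightarrow> 'v) set" where
  "words A V d = {w \<in> A \<rightarrow>\<^sub>E V. \<forall>v\<in>V. card {x\<in>A. w x = v} = d v}"

lemma finite_words: "finite A \<Longrightarrow> finite V \<Longrightarrow> finite (words A V d)"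
  unfolding words_def by (rule finite_subset[of _ "A \<rightarrow>\<^sub>E V"]) (auto intro: finite_PiE)

lemma words_swap:
  assumes "w \<in> words A V d" "x \<in> A" "y \<in> A"
  shows "w \<circ> Transposition.transpose x y \<in> words A V d"
proof -
  have 1: "w \<circ> Transposition.transpose x y \<in> A \<rightarrow>\<^sub>E V"
    using assms unfolding words_def by (auto simp: PiE_def extensional_def Transposition.transpose_def)
  have 2: "card {z\<in>A. (w \<circ> Transposition.transpose x y) z = v} = card {z\<in>A. w z = v}" for v
  proof (rule bij_betw_same_card[of "Transposition.transpose x y"])
    show "bij_betw (Transposition.transpose x y) {z \<in> A. (w \<circ> Transposition.transpose x y) z = v} {z \<in> A. w z = v}"
      using assms(2,3) 
      by (intro bij_betw_byWitness[where f'="Transposition.transpose x y"]) (auto simp: Transposition.transpose_def)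
  qed
  show ?thesis using 1 2 assms(1) unfolding words_def by auto
qed

text \<open>The multinomial coefficient in division-free form. The induction chooses the set
  \<open>B\<close> of positions of the new letter \<open>u\<close>; what remains is a word over the
  other letters on \<open>A - B\<close>.\<close>

lemma card_words_mult_fact:
  assumes "finite V" "finite A" "(\<Sum>v\<in>V. d v) = card A"
  shows "card (words A V d) * (\<Prod>v\<in>V. fact (d v)) = fact (card A)"
  using assms
proof (induction V arbitrary: A rule: finite_induct)
  case empty
  then have "A = {}" by simp
  then show ?case by (simp add: words_def)
next
  case (insert u V A)
  define T where "T = {B. B \<subseteq> A \<and> card B = d u}"
  have finT: "finite T" using insert.prems unfolding T_def by simp
  have le: "d u \<le> card A" using insert by simp
  define W where "W B = {w \<in> words A (insert u V) d. {x\<in>A. w x = u} = B}" for B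
  have un: "words A (insert u V) d = (\<Union>B\<in>T. W B)"
    unfolding W_def T_def words_def by auto
  have cardW: "card (W B) * (\<Prod>v\<in>V. fact (d v)) = fact (card A - d u)" if B: "B \<in> T" for B
  proof -
    have fB: "finite B" "B \<subseteq> A" "card B = d u" using B insert.prems finite_subset unfolding T_def by auto
    have cAB: "card (A - B) = card A - d u" using fB insert.prems by (simp add: card_Diff_subset)
    have sm: "(\<Sum>v\<in>V. d v) = card (A - B)" using insert cAB by simp
    have "bij_betw (\<lambda>w. restrict w (A - B)) (W B) (words (A - B) V d)"
    proof (rule bij_betw_byWitness[where f' = "\<lambda>w x. if x \<in> B then u else w x"])
      show "\<forall>w\<in>W B. (\<lambda>x. if x \<in> B then u else restrict w (A - B) x) = w"
        unfolding W_def words_def by (auto simp: fun_eq_iff restrict_def PiE_def extensional_def)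
      show "\<forall>w\<in>words (A - B) V d. restrict (\<lambda>x. if x \<in> B then u else w x) (A - B) = w"
        unfolding words_def by (auto simp: fun_eq_iff restrict_def PiE_def extensional_def)
      show "(\<lambda>w. restrict w (A - B)) ` W B \<subseteq> words (A - B) V d"
      proof clarify
        fix w assume w: "w \<in> W B"
        have "{x \<in> A - B. restrict w (A - B) x = v} = {x \<in> A. w x = v}" if "v \<in> V" for v
          using w that insert.hyps unfolding W_def by (auto simp: restrict_def)
        moreover have "w x \<in> V" if "x \<in> A - B" for x
          using w that unfolding W_def words_def by auto
        ultimately show "restrict w (A - B) \<in> words (A - B) V d"
          using w unfolding W_def words_def by auto
      qed
      show "(\<lambda>w x. if x \<in> B then u else w x) ` words (A - B) V d \<subseteq> W B"
      proof clarify
        fix w assume w: "w \<in> words (A - B) V d"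
        let ?w = "\<lambda>x. if x \<in> B then u else w x"
        have wV: "w x \<in> V" if "x \<in> A - B" for x using w that unfolding words_def by auto
        have e1: "{x\<in>A. ?w x = u} = B" using fB wV insert.hyps by auto
        have e2: "{x\<in>A. ?w x = v} = {x\<in>A-B. w x = v}" if "v \<in> V" for v
          using that insert.hyps by auto
        have e3: "?w \<in> A \<rightarrow>\<^sub>E insert u V"
          using w fB wV unfolding words_def by (auto simp: PiE_def extensional_def)
        have "card {x\<in>A. ?w x = v} = d v" if "v \<in> insert u V" for v
        proof (cases "v = u")
          case True
          then show ?thesis using e1 fB(3) by simp
        next
          case False
          then have "v \<in> V" using that by simp
          then show ?thesis using e2[of v] w unfolding words_def by simp
        qed
        then have "?w \<in> words A (insert u V) d" using e3 unfolding words_def by blast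
        then show "?w \<in> W B" using e1 unfolding W_def by blast
      qed
    qed
    then have "card (W B) = card (words (A - B) V d)" by (rule bij_betw_same_card)
    with insert.IH[OF _ sm] insert.prems cAB show ?thesis by simp
  qed
  have "card (words A (insert u V) d) = (\<Sum>B\<in>T. card (W B))"
    unfolding un
  proof (rule card_UN_disjoint[OF finT])
    show "\<forall>B\<in>T. finite (W B)"
      using finite_words[of A "insert u V" d] insert unfolding W_def by auto
  qed (auto simp: W_def)
  then have "card (words A (insert u V) d) * (\<Prod>v\<in>V. fact (d v)) = (\<Sum>B\<in>T. fact (card A - d u))"
    using cardW by (simp add: sum_distrib_right)
  also have "\<dots> = (card A choose d u) * fact (card A - d u)"
    using insert.prems by (simp add: T_def n_subsets)
  finally show ?case
    using insert.hyps binomial_fact_lemma[OF le] by (simp add: algebra_simps)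
qed

section \<open>Switching inequalities for words with forbidden coincidences\<close>

lemma card_pairs_le:
  assumes "finite B" "\<And>z. z \<in> B \<Longrightarrow> finite (f z)" "\<And>z. z \<in> B \<Longrightarrow> card (f z) \<le> c"
  shows "card (\<Union>z\<in>B. f z) \<le> card B * c"
proof -
  have "card (\<Union>z\<in>B. f z) \<le> (\<Sum>z\<in>B. card (f z))" using assms by (intro card_UN_le)
  also have "\<dots> \<le> card B * c" using sum_bounded_above[of B "\<lambda>z. card (f z)" c] assms by simp
  finally show ?thesis .
qed

text \<open>\<open>p\<close> sends a slot to its edge; the switchings see only the partition into
  classes of at most \<open>r\<close> slots. \<open>k\<close> is an upper bound for the degrees, so
  one locale serves both the degrees \<open>k\<close> and the smaller ones left after a cycle has
  been removed.\<close>

locale word_model =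
  fixes A :: "'s set" and V :: "'v set" and d :: "'v \<Rightarrow> nat" and p :: "'s \<Rightarrow> 'p" and r k :: nat
  assumes finite_A: "finite A" and finite_V: "finite V"
    and d_le: "\<And>v. v \<in> V \<Longrightarrow> d v \<le> k"
    and sum_d: "(\<Sum>v\<in>V. d v) = card A"
    and part_le: "\<And>x. x \<in> A \<Longrightarrow> card {y\<in>A. p y = p x} \<le> r"
begin

abbreviation "M \<equiv> card A"

definition conflicts :: "('s \<times> 's) set" where
  "conflicts = {(x, y). x \<in> A \<and> y \<in> A \<and> x \<noteq> y \<and> p x = p y}"

definition avoiding :: "('s \<times> 's) set \<Rightarrow> ('s \<Rightarrow> 'v) set" where
  "avoiding F = {w \<in> words A V d. \<forall>(x, y)\<in>F. w x \<noteq> w y}"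

text \<open>An event of this kind survives an exchange at two slots outside \<open>Q\<close>. This
  allows several coincidences to be imposed one after another, each time with a fresh slot.\<close>

definition determined_on :: "'s set \<Rightarrow> (('s \<Rightarrow> 'v) \<Rightarrow> bool) \<Rightarrow> bool" where
  "determined_on Q P \<longleftrightarrow> (\<forall>w w'. (\<forall>q\<in>Q. w q = w' q) \<longrightarrow> P w \<longrightarrow> P w')"

lemma finite_avoiding: "finite (avoiding F)"
  unfolding avoiding_def using finite_words[OF finite_A finite_V] by simp

lemma avoiding_in_V: "w \<in> avoiding F \<Longrightarrow> x \<in> A \<Longrightarrow> w x \<in> V"
  unfolding avoiding_def words_def by auto

lemma avoiding_fibre: "w \<in> avoiding F \<Longrightarrow> v \<in> V \<Longrightarrow> card {x\<in>A. w x = v} = d v"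
  unfolding avoiding_def words_def by auto

lemma avoiding_fibre_le: "w \<in> avoiding F \<Longrightarrow> x \<in> A \<Longrightarrow> card {y\<in>A. w y = w x} \<le> k"
  using avoiding_fibre[of w F "w x"] avoiding_in_V d_le by metis

text \<open>Only pairs of \<open>F\<close> that meet \<open>x\<close> or \<open>y\<close> can be
  violated by the exchange. The pair formed by \<open>x\<close> and \<open>y\<close> themselves is
  harmless, since its two letters trade places; hence the exclusions \<open>z \<noteq> x\<close> and
  \<open>z \<noteq> y\<close>.\<close>

lemma avoiding_swap:
  assumes w: "w \<in> avoiding F" and F: "F \<subseteq> conflicts" and "x \<in> A" "y \<in> A"
    and 1: "\<And>z. z \<in> A \<Longrightarrow> z \<noteq> y \<Longrightarrow> p z = p y \<Longrightarrow> (y, z) \<in> F \<or> (z, y) \<in> F \<Longrightarrow> z \<noteq> x \<Longrightarrow> w z \<noteq> w x"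
    and 2: "\<And>z. z \<in> A \<Longrightarrow> z \<noteq> x \<Longrightarrow> p z = p x \<Longrightarrow> (x, z) \<in> F \<or> (z, x) \<in> F \<Longrightarrow> z \<noteq> y \<Longrightarrow> w z \<noteq> w y"
  shows "w \<circ> Transposition.transpose x y \<in> avoiding F"
proof -
  have "(w \<circ> Transposition.transpose x y) u \<noteq> (w \<circ> Transposition.transpose x y) v" if uv: "(u, v) \<in> F" for u v
  proof -
    have c: "u \<in> A" "v \<in> A" "u \<noteq> v" "p u = p v" using uv F unfolding conflicts_def by auto
    have wn: "w u \<noteq> w v" using w uv unfolding avoiding_def by auto
    show ?thesis
      using c wn uv 1[of u] 1[of v] 2[of u] 2[of v] by (auto simp: Transposition.transpose_def)
  qed
  then show ?thesis
    using w words_swap[of w A V d x y] assms(3,4) unfolding avoiding_def by auto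
qed

text \<open>
  Double counting of the exchanges of the letters at \<open>x\<close> and \<open>y\<close>, over all \<open>y\<close> for which
  the exchange creates no forbidden coincidence; all but \<open>card Q + 2 k r\<close> slots qualify.
\<close>

lemma switch_le:
  assumes F: "F \<subseteq> conflicts" and Q: "Q \<subseteq> A" and x: "x \<in> A" "x \<notin> Q"
    and P: "determined_on Q P" and i: "i \<in> V"
    and D: "\<And>w. w \<in> avoiding F \<Longrightarrow> P w \<Longrightarrow> card {y\<in>A - Q. w y = i} \<le> D"
  shows "real (card {w\<in>avoiding F. P w \<and> w x = i}) * (real M - real (card Q) - 2 * real k * real r)
    \<le> real (card {w\<in>avoiding F. P w}) * real D"
proof -
  let ?S = "{w\<in>avoiding F. P w \<and> w x = i}" and ?T = "{w\<in>avoiding F. P w}"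
  \<comment> \<open>The slots \<open>y\<close> for which the exchange may fail: those in a part that
    already contains the letter \<open>i\<close>, which would move to \<open>y\<close>, and those
    whose letter already occurs in the part of \<open>x\<close>, to which it would move. Either
    union has at most \<open>k r\<close> elements, and both contain \<open>x\<close> itself.\<close>
  define bad where "bad w = (\<Union>z\<in>{z\<in>A. w z = i}. {y\<in>A. p y = p z})
     \<union> (\<Union>z\<in>{z\<in>A. p z = p x}. {y\<in>A. w y = w z})" for w
  \<comment> \<open>The exchange turns a pair with \<open>i\<close> at \<open>x\<close> into a pair
    with \<open>i\<close> at \<open>y\<close>. It is undone by the same transposition, so it embeds
    \<open>L\<close> in \<open>R\<close>, where each word has at most \<open>D\<close> choices of
    \<open>y\<close>.\<close>
  define L where "L = (SIGMA w:?S. A - Q - bad w)"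
  define R where "R = (SIGMA w:?T. {y\<in>A - Q. w y = i})"
  have finS: "finite ?S" "finite ?T" using finite_avoiding by auto
  have finR: "finite R" unfolding R_def using finS finite_A by (intro finite_SigmaI) auto
  have badle: "card (bad w) \<le> 2 * k * r" if w: "w \<in> ?S" for w
  proof -
    have "card (\<Union>z\<in>{z\<in>A. w z = i}. {y\<in>A. p y = p z}) \<le> card {z\<in>A. w z = i} * r"
      using finite_A part_le by (intro card_pairs_le) auto
    also have "\<dots> \<le> k * r" using avoiding_fibre_le[of w F x] w x by (intro mult_right_mono) auto
    finally have 1: "card (\<Union>z\<in>{z\<in>A. w z = i}. {y\<in>A. p y = p z}) \<le> k * r" .
    have "card (\<Union>z\<in>{z\<in>A. p z = p x}. {y\<in>A. w y = w z}) \<le> card {z\<in>A. p z = p x} * k"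
      using finite_A avoiding_fibre_le[of w F] w by (intro card_pairs_le) auto
    also have "\<dots> \<le> r * k" using part_le[of x] x by (intro mult_right_mono) auto
    finally show ?thesis using 1 card_Un_le[of "(\<Union>z\<in>{z\<in>A. w z = i}. {y\<in>A. p y = p z})" "(\<Union>z\<in>{z\<in>A. p z = p x}. {y\<in>A. w y = w z})"] 
      unfolding bad_def by (simp add: mult.commute[of r k] mult.assoc[of k] mult.left_commute[of _ k])
  qed
  have gd: "real M - real (card Q) - 2 * real k * real r \<le> real (card (A - Q - bad w))" if w: "w \<in> ?S" for w
  proof -
    have "M \<le> card (A - Q - bad w) + card (Q \<union> bad w)"
      using finite_A Q by (intro order_trans[OF card_mono card_Un_le]) (auto simp: bad_def finite_subset)
    moreover have "card (Q \<union> bad w) \<le> card Q + 2 * k * r" using card_Un_le[of Q "bad w"] badle[OF w] by linarith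
    ultimately have "M \<le> card (A - Q - bad w) + card Q + 2 * k * r" by linarith
    then have "real M \<le> real (card (A - Q - bad w) + card Q + 2 * k * r)" by linarith
    then show ?thesis by simp
  qed
  have inj: "inj_on (\<lambda>(w, y). (w \<circ> Transposition.transpose x y, y)) L"
  proof (rule inj_onI)
    fix a b assume ab: "(\<lambda>(w, y). (w \<circ> Transposition.transpose x y, y)) a = (\<lambda>(w, y). (w \<circ> Transposition.transpose x y, y)) b"
    obtain w y w' y' where e: "a = (w, y)" "b = (w', y')" by fastforce
    have "y = y'" "w \<circ> Transposition.transpose x y = w' \<circ> Transposition.transpose x y" using ab e by auto
    then have "(w \<circ> Transposition.transpose x y) \<circ> Transposition.transpose x y = (w' \<circ> Transposition.transpose x y) \<circ> Transposition.transpose x y" by simp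
    then show "a = b" using e \<open>y = y'\<close> by (simp add: o_assoc[symmetric])
  qed
  have img: "(\<lambda>(w, y). (w \<circ> Transposition.transpose x y, y)) ` L \<subseteq> R"
  proof clarify
    fix w y assume "(w, y) \<in> L"
    then have w: "w \<in> avoiding F" "P w" "w x = i" and y: "y \<in> A" "y \<notin> Q" "y \<notin> bad w"
      unfolding L_def by auto
    have "w \<circ> Transposition.transpose x y \<in> avoiding F"
      using y w x unfolding bad_def by (intro avoiding_swap[OF w(1) F]) auto
    moreover have "P (w \<circ> Transposition.transpose x y)"
      using P w(2) x(2) y(2) unfolding determined_on_def
      by (elim allE[of _ w] allE[of _ "w \<circ> Transposition.transpose x y"]) (auto simp: Transposition.transpose_def)
    ultimately show "(w \<circ> Transposition.transpose x y, y) \<in> R"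
      using w y unfolding R_def by auto
  qed
  have "real (card ?S) * (real M - real (card Q) - 2 * real k * real r)
      \<le> (\<Sum>w\<in>?S. real (card (A - Q - bad w)))"
    using sum_bounded_below[of ?S "real M - real (card Q) - 2 * real k * real r"] gd by simp
  also have "\<dots> = real (card L)"
    unfolding L_def using finS finite_A by (subst card_SigmaI) auto
  also have "\<dots> \<le> real (card R)"
    using card_inj_on_le[OF inj img finR] by simp
  also have "\<dots> = (\<Sum>w\<in>?T. real (card {y\<in>A - Q. w y = i}))"
    unfolding R_def using finS finite_A by (subst card_SigmaI) auto
  also have "\<dots> \<le> real (card ?T) * real D"
    using sum_bounded_above[of ?T _ "real D"] D by simp
  finally show ?thesis .
qed

lemma card_partition_by_value:
  assumes "q \<in> A"
  shows "card {w\<in>avoiding F. P w} = (\<Sum>i\<in>V. card {w\<in>avoiding F. P w \<and> w q = i})"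
proof -
  have "{w\<in>avoiding F. P w} = (\<Union>i\<in>V. {w\<in>avoiding F. P w \<and> w q = i})"
    using avoiding_in_V assms by auto
  then show ?thesis
    using finite_V finite_avoiding by (simp, subst card_UN_disjoint) auto
qed

text \<open>Fixing the letter \<open>i\<close> at \<open>q\<close> uses up one of its
  \<open>d i\<close> occurrences, so only \<open>d i - 1\<close> slots can receive the letter of
  \<open>x\<close>. This is the origin of the falling factorials \<open>d (d - 1)\<close>.\<close>

lemma switch_eq_le:
  assumes F: "F \<subseteq> conflicts" and Q: "Q \<subseteq> A" and x: "x \<in> A" "x \<notin> Q" and q: "q \<in> Q"
    and P: "determined_on Q P"
  shows "real (card {w\<in>avoiding F. P w \<and> w x = w q}) * (real M - real (card Q) - 2 * real k * real r)
    \<le> (\<Sum>i\<in>V. real (card {w\<in>avoiding F. P w \<and> w q = i}) * (real (d i) - 1))"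
proof -
  have qA: "q \<in> A" using q Q by auto
  have "real (card {w\<in>avoiding F. P w \<and> w x = w q})
    = (\<Sum>i\<in>V. real (card {w\<in>avoiding F. (P w \<and> w x = w q) \<and> w q = i}))"
    by (subst card_partition_by_value[OF qA]) simp
  also have "\<dots> = (\<Sum>i\<in>V. real (card {w\<in>avoiding F. (P w \<and> w q = i) \<and> w x = i}))"
    by (intro sum.cong refl arg_cong[where f="\<lambda>B. real (card B)"]) auto
  finally have "real (card {w\<in>avoiding F. P w \<and> w x = w q})
    = (\<Sum>i\<in>V. real (card {w\<in>avoiding F. (P w \<and> w q = i) \<and> w x = i}))" .
  then have "real (card {w\<in>avoiding F. P w \<and> w x = w q}) * (real M - real (card Q) - 2 * real k * real r)
    = (\<Sum>i\<in>V. real (card {w\<in>avoiding F. (P w \<and> w q = i) \<and> w x = i}) * (real M - real (card Q) - 2 * real k * real r))"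
    by (simp add: sum_distrib_right)
  also have "\<dots> \<le> (\<Sum>i\<in>V. real (card {w\<in>avoiding F. P w \<and> w q = i}) * (real (d i) - 1))"
  proof (rule sum_mono)
    fix i assume i: "i \<in> V"
    have D: "card {y\<in>A - Q. w y = i} \<le> d i - 1" if "w \<in> avoiding F" "P w \<and> w q = i" for w
    proof -
      have "card {y\<in>A - Q. w y = i} \<le> card ({y\<in>A. w y = i} - {q})"
        using finite_A q by (intro card_mono) auto
      also have "\<dots> = d i - 1" using avoiding_fibre[OF that(1) i] qA that by (subst card_Diff_singleton) auto
      finally show ?thesis .
    qed
    have *: "real (card {w\<in>avoiding F. (P w \<and> w q = i) \<and> w x = i}) * (real M - real (card Q) - 2 * real k * real r)
      \<le> real (card {w\<in>avoiding F. P w \<and> w q = i}) * real (d i - 1)"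
    proof (rule switch_le[OF F Q x _ i D])
      show "determined_on Q (\<lambda>w. P w \<and> w q = i)" using P q unfolding determined_on_def by metis
    qed
    show "real (card {w\<in>avoiding F. (P w \<and> w q = i) \<and> w x = i}) * (real M - real (card Q) - 2 * real k * real r)
      \<le> real (card {w\<in>avoiding F. P w \<and> w q = i}) * (real (d i) - 1)"
    \<comment> \<open>For \<open>d i = 0\<close> the truncated and the real \<open>d i - 1\<close>
      differ, but then no word has the letter \<open>i\<close> at \<open>q\<close> and both sides
      vanish.\<close>
    proof (cases "d i = 0")
      case True
      then have "w q \<noteq> i" if "w \<in> avoiding F" for w
        using avoiding_fibre[OF that i] finite_A qA by auto
      then have "{w\<in>avoiding F. P w \<and> w q = i} = {}" "{w\<in>avoiding F. (P w \<and> w q = i) \<and> w x = i} = {}"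
        by auto
      then show ?thesis by (simp only: card.empty)
    next
      case False
      then show ?thesis using * by (simp add: of_nat_diff)
    qed
  qed
  finally show ?thesis .
qed

end

section \<open>Coincidence probabilities when there are many slots\<close>

lemma real_card_UN_le:
  assumes "finite B" "real (card B) \<le> b" "0 \<le> c" "\<And>z. z \<in> B \<Longrightarrow> real (card (f z)) \<le> c"
  shows "real (card (\<Union>z\<in>B. f z)) \<le> b * c"
proof -
  have "real (card (\<Union>z\<in>B. f z)) \<le> real (\<Sum>z\<in>B. card (f z))"
    using assms(1) by (intro of_nat_mono card_UN_le)
  also have "\<dots> \<le> real (card B) * c"
    using sum_bounded_above[of B "\<lambda>z. real (card (f z))" c] assms(4) by simp
  also have "\<dots> \<le> b * c" using assms by (intro mult_right_mono) auto
  finally show ?thesis .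
qed

lemma card_Times_singleton: "card (X \<times> {y}) = card X"
  by (simp add: card_cartesian_product)

text \<open>The bound is twice \<open>6 + 2 k r\<close>, so at least half of all slots remain usable
  in a switching while up to six of them are held fixed; the largest such set has five, in
  \<open>triple_collision\<close>.\<close>

locale large_word_model = word_model +
  assumes k_pos: "1 \<le> k" and r_pos: "1 \<le> r" and large: "12 + 4 * k * r \<le> card A"
begin

lemma M_large: "12 + 4 * real k * real r \<le> real M"
  using large by (metis of_nat_add of_nat_le_iff of_nat_mult of_nat_numeral)

lemma kr_ge: "1 \<le> real k * real r" "real k \<le> real k * real r" 
  using k_pos r_pos mult_mono[of 1 "real k" 1 "real r"] by auto

lemma M_pos: "0 < real M" using M_large kr_ge by linarith

lemma half_M:
  assumes "card Q \<le> 6"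
  shows "real M / 2 \<le> real M - real (card Q) - 2 * real k * real r"
proof -
  have "real (card Q) \<le> 6" using assms by (metis of_nat_le_iff of_nat_numeral)
  then show ?thesis using M_large by linarith
qed

lemma le_of_half_M:
  assumes "card Q \<le> 6" "0 \<le> X" "X * (real M - real (card Q) - 2 * real k * real r) \<le> Y"
  shows "X \<le> 2 * Y / real M"
proof -
  have "X * (real M / 2) \<le> X * (real M - real (card Q) - 2 * real k * real r)"
    using half_M[OF assms(1)] assms(2) by (intro mult_left_mono)
  with assms(3) show ?thesis using M_pos by (simp add: field_simps)
qed

text \<open>Prescribing one more letter costs a factor \<open>2 k / M\<close>, whatever
  \<open>P\<close> says about at most six other slots. This and its companion
  \<open>switch_eq_half\<close> are crude by a constant factor and serve for error terms.\<close>

lemma switch_half: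
  assumes "F \<subseteq> conflicts" "Q \<subseteq> A" "x \<in> A" "x \<notin> Q" "determined_on Q P" "i \<in> V" "card Q \<le> 6"
  shows "real (card {w\<in>avoiding F. P w \<and> w x = i}) \<le> 2 * real k / real M * real (card {w\<in>avoiding F. P w})"
proof -
  have "card {y\<in>A - Q. w y = i} \<le> k" if "w \<in> avoiding F" for w
  proof -
    have "card {y\<in>A - Q. w y = i} \<le> card {y\<in>A. w y = i}" using finite_A by (intro card_mono) auto
    then show ?thesis using avoiding_fibre[OF that assms(6)] d_le[OF assms(6)] by simp
  qed
  from le_of_half_M[OF assms(7) _ switch_le[OF assms(1-6) this]] show ?thesis
    by (simp add: mult.commute mult.left_commute)
qed

lemma switch_eq_half:
  assumes "F \<subseteq> conflicts" "Q \<subseteq> A" "x \<in> A" "x \<notin> Q" "q \<in> Q" "determined_on Q P" "card Q \<le> 6"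
  shows "real (card {w\<in>avoiding F. P w \<and> w x = w q}) \<le> 2 * real k / real M * real (card {w\<in>avoiding F. P w})"
proof -
  have "(\<Sum>i\<in>V. real (card {w\<in>avoiding F. P w \<and> w q = i}) * (real (d i) - 1))
    \<le> (\<Sum>i\<in>V. real (card {w\<in>avoiding F. P w \<and> w q = i}) * real k)"
  proof (rule sum_mono, rule mult_left_mono)
    fix i assume "i \<in> V"
    then show "real (d i) - 1 \<le> real k" using d_le[of i] by linarith
  qed simp
  also have "\<dots> = real (card {w\<in>avoiding F. P w}) * real k"
    using card_partition_by_value[of q F P] assms(2,5) by (simp add: sum_distrib_right subset_iff)
  finally have "real (card {w\<in>avoiding F. P w \<and> w x = w q}) * (real M - real (card Q) - 2 * real k * real r)
    \<le> real (card {w\<in>avoiding F. P w}) * real k"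
    using switch_eq_le[OF assms(1-6)] by linarith
  from le_of_half_M[OF assms(7) _ this] show ?thesis
    by (simp add: mult.commute mult.left_commute)
qed

text \<open>\<open>M2 / (M (M - 1))\<close> is the probability that two given slots of a uniformly
  random word carry the same letter.\<close>

definition M2 :: real where "M2 = (\<Sum>i\<in>V. real (d i) * (real (d i) - 1))"

lemma sum_d_real: "(\<Sum>i\<in>V. real (d i)) = real M"
  using sum_d by (metis of_nat_sum)

lemma M2_nonneg: "0 \<le> M2"
  unfolding M2_def
proof (rule sum_nonneg)
  fix i show "0 \<le> real (d i) * (real (d i) - 1)" by (cases "d i = 0") auto
qed

lemma M2_le: "M2 \<le> real k * real M"
proof -
  have "M2 \<le> (\<Sum>i\<in>V. real (d i) * real k)"
    unfolding M2_def
  proof (intro sum_mono mult_left_mono)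
    fix i assume "i \<in> V"
    then show "real (d i) - 1 \<le> real k" using d_le[of i] by linarith
  qed simp
  then show ?thesis by (simp only: sum_distrib_right[symmetric] sum_d_real) (simp add: mult.commute)
qed

lemma value_count_le:
  assumes "F \<subseteq> conflicts" "a \<in> A" "i \<in> V"
  shows "real (card {w\<in>avoiding F. w a = i}) * (real M - 2 * real k * real r) \<le> real (card (avoiding F)) * real (d i)"
proof -
  have "card {y\<in>A - {}. w y = i} \<le> d i" if "w \<in> avoiding F" for w
    using avoiding_fibre[OF that assms(3)] by simp
  from switch_le[OF assms(1) empty_subsetI assms(2) _ _ assms(3) this, of "\<lambda>_. True"]
  show ?thesis by (simp add: determined_on_def)
qed

text \<open>Two switchings: one moves the letter of \<open>b\<close> away while the letter of
  \<open>a\<close> is held fixed, the other bounds how often each letter stands at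
  \<open>a\<close>.\<close>

lemma collision_upper:
  assumes F: "F \<subseteq> conflicts" and ab: "a \<in> A" "b \<in> A" "a \<noteq> b"
  shows "real (card {w\<in>avoiding F. w b = w a}) * (real M - 1 - 2 * real k * real r) * (real M - 2 * real k * real r)
    \<le> real (card (avoiding F)) * M2"
proof -
  let ?n = "\<lambda>i. real (card {w\<in>avoiding F. w a = i})"
  have "real (card {w\<in>avoiding F. w b = w a}) * (real M - 1 - 2 * real k * real r) \<le> (\<Sum>i\<in>V. ?n i * (real (d i) - 1))"
    using switch_eq_le[OF F, of "{a}" b a "\<lambda>_. True"] ab by (simp add: determined_on_def)
  then have "real (card {w\<in>avoiding F. w b = w a}) * (real M - 1 - 2 * real k * real r) * (real M - 2 * real k * real r)
    \<le> (\<Sum>i\<in>V. ?n i * (real (d i) - 1)) * (real M - 2 * real k * real r)"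
    using half_M[of "{}"] M_pos by (intro mult_right_mono) auto
  also have "\<dots> = (\<Sum>i\<in>V. (?n i * (real M - 2 * real k * real r)) * (real (d i) - 1))"
    unfolding sum_distrib_right by (intro sum.cong refl) (simp only: mult.assoc mult.commute mult.left_commute)
  also have "\<dots> \<le> (\<Sum>i\<in>V. (real (card (avoiding F)) * real (d i)) * (real (d i) - 1))"
  proof (rule sum_mono)
    fix i assume i: "i \<in> V"
    show "?n i * (real M - 2 * real k * real r) * (real (d i) - 1)
      \<le> (real (card (avoiding F)) * real (d i)) * (real (d i) - 1)"
    \<comment> \<open>A letter of degree 0 has the negative weight \<open>d i - 1 = -1\<close>, by
      which an inequality cannot be multiplied; its count is zero.\<close>
    proof (cases "d i = 0")
      case True
      then have "{w\<in>avoiding F. w a = i} = {}" using avoiding_fibre[OF _ i] finite_A ab by auto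
      then show ?thesis by (simp only: True) simp
    next
      case False
      then show ?thesis using value_count_le[OF F ab(1) i] by (intro mult_right_mono) auto
    qed
  qed
  also have "\<dots> = real (card (avoiding F)) * M2"
    unfolding M2_def by (simp add: sum_distrib_left mult.assoc)
  finally show ?thesis .
qed

text \<open>
  The upper bounds on the counts of the individual values exceed the total only slightly, so
  none of them is far from being attained.
\<close>

lemma sum_value_lower:
  assumes F: "F \<subseteq> conflicts" and a: "a \<in> A"
  shows "(\<Sum>i\<in>V. real (card {w\<in>avoiding F. w a = i}) * (real (d i) - 1))
    \<ge> real (card (avoiding F)) * (M2 - 4 * real k ^ 2 * real r) / real M"
proof -
  define n where "n i = real (card {w\<in>avoiding F. w a = i})" for i
  define N where "N = real (card (avoiding F))"
  define s where "s = 2 * real k * real r"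
  \<comment> \<open>\<open>u i\<close> is the slack in \<open>value_count_le\<close>. As the counts
    sum to \<open>N\<close> and the degrees to \<open>M\<close>, the total slack is only
    \<open>N s / (M - s)\<close>; the weights \<open>d i - 1\<close> raise its effect by at most a
    factor \<open>k\<close>.\<close>
  define u where "u i = N * real (d i) / (real M - s) - n i" for i
  have Ms: "real M - s \<ge> real M / 2" using half_M[of "{}"] by (simp add: s_def)
  then have Ms0: "real M - s > 0" using M_pos by linarith
  have s0: "s \<ge> 0" unfolding s_def by simp
  have N0: "N \<ge> 0" by (simp add: N_def)
  have u0: "u i \<ge> 0" if "i \<in> V" for i
    using value_count_le[OF F a that] Ms0 unfolding u_def n_def N_def s_def by (simp add: field_simps)
  have sn: "(\<Sum>i\<in>V. n i) = N"
    using card_partition_by_value[OF a, of F "\<lambda>_. True"] unfolding n_def N_def by simp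
  have su: "(\<Sum>i\<in>V. u i) = N * s / (real M - s)"
  proof -
    have "(\<Sum>i\<in>V. u i) = N * real M / (real M - s) - N"
      unfolding u_def sum_subtractf sn by (simp add: sum_divide_distrib[symmetric] sum_distrib_left[symmetric] sum_d_real)
    also have "\<dots> = N * s / (real M - s)" using Ms0 by (simp add: field_simps)
    finally show ?thesis .
  qed
  have "(\<Sum>i\<in>V. n i * (real (d i) - 1)) = (\<Sum>i\<in>V. N / (real M - s) * (real (d i) * (real (d i) - 1))) - (\<Sum>i\<in>V. u i * (real (d i) - 1))"
    unfolding sum_subtractf[symmetric] u_def
    by (intro sum.cong refl) (simp add: diff_divide_distrib algebra_simps)
  also have "\<dots> = N * M2 / (real M - s) - (\<Sum>i\<in>V. u i * (real (d i) - 1))"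
    unfolding M2_def by (simp add: sum_distrib_left sum_divide_distrib)
  finally have eq: "(\<Sum>i\<in>V. n i * (real (d i) - 1)) = N * M2 / (real M - s) - (\<Sum>i\<in>V. u i * (real (d i) - 1))" .
  have "(\<Sum>i\<in>V. u i * (real (d i) - 1)) \<le> (\<Sum>i\<in>V. u i * real k)"
  proof (intro sum_mono mult_left_mono u0)
    fix i assume "i \<in> V"
    then show "real (d i) - 1 \<le> real k" using d_le[of i] by linarith
  qed
  also have "(\<Sum>i\<in>V. u i * real k) = N * s / (real M - s) * real k"
    by (simp add: su sum_distrib_right[symmetric])
  also have "N * s / (real M - s) * real k \<le> N * s / (real M / 2) * real k"
    using Ms M_pos N0 s0 by (intro mult_right_mono divide_left_mono mult_nonneg_nonneg) auto
  also have "N * s / (real M / 2) * real k = N * (4 * real k ^ 2 * real r) / real M"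
    by (simp add: s_def power2_eq_square)
  finally have "(\<Sum>i\<in>V. n i * (real (d i) - 1)) \<ge> N * M2 / (real M - s) - N * (4 * real k ^ 2 * real r) / real M"
    using eq by linarith
  moreover have "N * M2 / (real M - s) \<ge> N * M2 / real M"
    using Ms0 s0 M_pos N0 M2_nonneg by (intro divide_left_mono mult_nonneg_nonneg) auto
  ultimately show ?thesis unfolding n_def N_def by (simp add: right_diff_distrib diff_divide_distrib)
qed

text \<open>The reverse switching: from a slot \<open>y\<close> that shares the letter of
  \<open>a\<close>, this letter is brought to \<open>b\<close>. Ending with equal letters at
  \<open>a\<close> and \<open>b\<close> is legitimate because this pair is not yet in
  \<open>F\<close>. The constant 14 adds the loss 4 of \<open>sum_value_lower\<close> and a loss of
  10 from exchanges that may create a forbidden coincidence.\<close>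

lemma collision_lower:
  assumes F: "F \<subseteq> conflicts" and ab: "a \<in> A" "b \<in> A" "a \<noteq> b" "p a = p b"
    and nF: "(a, b) \<notin> F" "(b, a) \<notin> F"
  shows "real (card {w\<in>avoiding F. w b = w a}) * (real M - 1)
    \<ge> real (card (avoiding F)) * (M2 - 14 * real k ^ 2 * real r) / real M"
proof -
  define S where "S = avoiding F"
  define N where "N = real (card S)"
  have N0: "N \<ge> 0" by (simp add: N_def)
  have finS: "finite S" unfolding S_def by (rule finite_avoiding)
  define L where "L = (SIGMA w:S. {y\<in>A-{a}. w y = w a})"
  define G where "G = {(w, y) \<in> L. w \<circ> Transposition.transpose b y \<in> S}"
  have finL: "finite L" unfolding L_def using finS finite_A by (intro finite_SigmaI) auto
  have GL: "G \<subseteq> L" unfolding G_def by auto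
  define \<epsilon> where "\<epsilon> = 2 * real k / real M"
  have e0: "\<epsilon> \<ge> 0" unfolding \<epsilon>_def by simp
  have cardL: "real (card L) = (\<Sum>i\<in>V. real (card {w\<in>avoiding F. w a = i}) * (real (d i) - 1))"
  proof -
    have c: "real (card {y\<in>A-{a}. w y = w a}) = (\<Sum>i\<in>V. if w a = i then real (d i) - 1 else 0)" if w: "w \<in> S" for w
    proof -
      have wa: "w a \<in> V" using w ab avoiding_in_V unfolding S_def by auto
      have f: "card {y\<in>A. w y = w a} = d (w a)" using w wa avoiding_fibre unfolding S_def by auto
      have "{y\<in>A-{a}. w y = w a} = {y\<in>A. w y = w a} - {a}" by auto
      then have "card {y\<in>A-{a}. w y = w a} = d (w a) - 1" using f ab by simp
      moreover have "d (w a) \<ge> 1"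
      proof -
        have "card {a} \<le> card {y\<in>A. w y = w a}" using ab finite_A by (intro card_mono) auto
        then show ?thesis using f by simp
      qed
      ultimately show ?thesis using wa finite_V by simp
    qed
    have "real (card L) = (\<Sum>w\<in>S. real (card {y\<in>A-{a}. w y = w a}))"
      unfolding L_def using finS finite_A by (subst card_SigmaI) auto
    also have "\<dots> = (\<Sum>w\<in>S. \<Sum>i\<in>V. if w a = i then real (d i) - 1 else 0)" using c by simp
    also have "\<dots> = (\<Sum>i\<in>V. \<Sum>w\<in>S. if w a = i then real (d i) - 1 else 0)" by (rule sum.swap)
    also have "\<dots> = (\<Sum>i\<in>V. real (card {w\<in>S. w a = i}) * (real (d i) - 1))"
      using finS by (simp add: sum.If_cases Int_def)
    finally show ?thesis unfolding S_def .
  qed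
  have GR: "real (card G) \<le> real (card {w\<in>avoiding F. w b = w a}) * (real M - 1)"
  proof -
    have "inj_on (\<lambda>(w, y). (w \<circ> Transposition.transpose b y, y)) G"
    proof (rule inj_onI)
      fix g g' assume ab: "(\<lambda>(w, y). (w \<circ> Transposition.transpose b y, y)) g = (\<lambda>(w, y). (w \<circ> Transposition.transpose b y, y)) g'"
      obtain w y w' y' where e: "g = (w, y)" "g' = (w', y')" by fastforce
      have "y = y'" "w \<circ> Transposition.transpose b y = w' \<circ> Transposition.transpose b y" using ab e by auto
      then have "(w \<circ> Transposition.transpose b y) \<circ> Transposition.transpose b y = (w' \<circ> Transposition.transpose b y) \<circ> Transposition.transpose b y" by simp
      then show "g = g'" using e \<open>y = y'\<close> by (simp add: o_assoc[symmetric])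
    qed
    moreover have "(\<lambda>(w, y). (w \<circ> Transposition.transpose b y, y)) ` G \<subseteq> {w\<in>S. w b = w a} \<times> (A - {a})"
      using ab unfolding G_def L_def by (auto simp: Transposition.transpose_def)
    moreover have "finite ({w\<in>S. w b = w a} \<times> (A - {a}))" using finS finite_A by auto
    ultimately have "card G \<le> card ({w\<in>S. w b = w a} \<times> (A - {a}))" by (rule card_inj_on_le)
    then have "card G \<le> card {w\<in>S. w b = w a} * (M - 1)" using ab by (simp add: card_cartesian_product)
    then have "real (card G) \<le> real (card {w\<in>S. w b = w a} * (M - 1))" by linarith
    moreover have "M \<ge> 1" using large by simp
    ultimately show ?thesis by (simp add: S_def of_nat_diff)
  qed
  let ?pa = "{y\<in>A. p y = p a}"
  \<comment> \<open>The exchanges given up: in \<open>B1\<close> the slot \<open>y\<close> lies in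
    the part of \<open>a\<close> and \<open>b\<close>; in \<open>B2\<close> a third slot
    \<open>v\<close> of that part already carries the letter that arrives at \<open>b\<close>; in
    \<open>B3\<close> the letter leaving \<open>b\<close> already occurs in the part of
    \<open>y\<close>.\<close>
  define B1 where "B1 = (\<Union>y\<in>?pa - {a, b}. {w\<in>S. w y = w a} \<times> {y})"
  define B2 where "B2 = (\<Union>v\<in>?pa - {a, b}. \<Union>y\<in>A - {a, b, v}. {w\<in>S. w v = w a \<and> w y = w a} \<times> {y})"
  define B3 where "B3 = (\<Union>y\<in>A - {a, b}. \<Union>v\<in>{v\<in>A. p v = p y} - {a, b, y}. {w\<in>S. w y = w a \<and> w v = w b} \<times> {y})"
  have bad: "L - G \<subseteq> B1 \<union> B2 \<union> B3"
  proof clarify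
    fix w y assume 1: "(w, y) \<in> L" "(w, y) \<notin> G" "(w, y) \<notin> B3" "(w, y) \<notin> B2"
    then have w: "w \<in> S" and y: "y \<in> A" "y \<noteq> a" "w y = w a" and ns: "w \<circ> Transposition.transpose b y \<notin> S"
      unfolding L_def G_def by auto
    \<comment> \<open>For \<open>y = b\<close> the exchange is the identity, so the pair belongs to
      \<open>G\<close>.\<close>
    have yb: "y \<noteq> b" using ns w by auto
    show "(w, y) \<in> B1"
    proof (rule ccontr)
      assume n1: "(w, y) \<notin> B1"
      then have py: "p y \<noteq> p a" using w y yb unfolding B1_def by auto
      have "w \<circ> Transposition.transpose b y \<in> avoiding F"
      proof (rule avoiding_swap[OF w[unfolded S_def] F ab(2) y(1)])
        fix z assume z: "z \<in> A" "z \<noteq> y" "p z = p y" "z \<noteq> b"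
        then have "z \<noteq> a" using py by auto
        then show "w z \<noteq> w b" using 1(3) w y yb z unfolding B3_def by auto
      next
        fix z assume z: "z \<in> A" "z \<noteq> b" "p z = p b" "(b, z) \<in> F \<or> (z, b) \<in> F" "z \<noteq> y"
        then have "z \<noteq> a" using nF by auto
        then show "w z \<noteq> w y" using 1(4) w y yb z ab unfolding B2_def by auto
      qed
      then show False using ns by (simp add: S_def)
    qed
  qed
  have par: "real (card ({v\<in>A. p v = p y} - X)) \<le> real r" if "y \<in> A" for X y
    using part_le[OF that] finite_A by (intro of_nat_mono order_trans[OF card_mono part_le[OF that]]) auto
  have eq1: "real (card {w\<in>S. w y = w a}) \<le> \<epsilon> * N" if "y \<in> A" "y \<noteq> a" for y
    using switch_eq_half[OF F, of "{a}" y a "\<lambda>_. True"] that ab unfolding \<epsilon>_def N_def S_def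
    by (simp add: determined_on_def)
  have eq2: "real (card {w\<in>S. w v = w a \<and> w y = w a}) \<le> \<epsilon> * (\<epsilon> * N)" if "v \<in> A" "v \<noteq> a" "y \<in> A" "y \<noteq> a" "y \<noteq> v" for v y
  proof -
    have "card {a, v} \<le> 6" by (simp add: card_insert_if)
    then have "real (card {w\<in>S. w v = w a \<and> w y = w a}) \<le> \<epsilon> * real (card {w\<in>S. w v = w a})"
      using switch_eq_half[OF F, of "{a, v}" y a "\<lambda>w. w v = w a"] that ab unfolding \<epsilon>_def S_def
      by (simp add: determined_on_def)
    also have "\<dots> \<le> \<epsilon> * (\<epsilon> * N)" using eq1[of v] that e0 by (intro mult_left_mono) auto
    finally show ?thesis .
  qed
  have eq3: "real (card {w\<in>S. w y = w a \<and> w v = w b}) \<le> \<epsilon> * (\<epsilon> * N)" if "y \<in> A - {a, b}" "v \<in> A - {a, b, y}" for v y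
  proof -
    have "card {a, b, y} \<le> 6" by (simp add: card_insert_if)
    then have "real (card {w\<in>S. w y = w a \<and> w v = w b}) \<le> \<epsilon> * real (card {w\<in>S. w y = w a})"
      using switch_eq_half[OF F, of "{a, b, y}" v b "\<lambda>w. w y = w a"] that ab unfolding \<epsilon>_def S_def
      by (simp add: determined_on_def)
    also have "\<dots> \<le> \<epsilon> * (\<epsilon> * N)" using eq1[of y] that e0 by (intro mult_left_mono) auto
    finally show ?thesis .
  qed
  have c1: "real (card B1) \<le> real r * (\<epsilon> * N)"
    unfolding B1_def using finite_A eq1 par[OF ab(1)] e0 N0
    by (intro real_card_UN_le) (auto simp: card_Times_singleton)
  have c2: "real (card B2) \<le> real r * (real M * (\<epsilon> * (\<epsilon> * N)))"
    unfolding B2_def using finite_A eq2 par[OF ab(1)] e0 N0 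
    by (intro real_card_UN_le) (auto simp: card_Times_singleton intro: card_mono)
  have c3: "real (card B3) \<le> real M * (real r * (\<epsilon> * (\<epsilon> * N)))"
    unfolding B3_def using finite_A eq3 par e0 N0 
    by (intro real_card_UN_le) (auto simp: card_Times_singleton intro: card_mono)
  have finB: "finite (B1 \<union> B2 \<union> B3)"
    unfolding B1_def B2_def B3_def using finite_A finS by auto
  have "card L \<le> card G + card (L - G)"
    using finL GL by (metis card_Un_le Un_Diff_cancel sup.absorb_iff2)
  also have "card (L - G) \<le> card (B1 \<union> B2 \<union> B3)" using bad finB by (rule card_mono[rotated])
  also have "\<dots> \<le> card B1 + card B2 + card B3"
    using card_Un_le[of "B1 \<union> B2" B3] card_Un_le[of B1 B2] by linarith
  finally have "real (card L) \<le> real (card G) + real (card B1) + real (card B2) + real (card B3)" by linarith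
  also have "\<dots> \<le> real (card {w\<in>avoiding F. w b = w a}) * (real M - 1) + 
     (real r * (\<epsilon> * N) + real r * (real M * (\<epsilon> * (\<epsilon> * N))) + real M * (real r * (\<epsilon> * (\<epsilon> * N))))"
    using GR c1 c2 c3 by linarith
  \<comment> \<open>With \<open>\<epsilon> = 2 k / M\<close>, \<open>B1\<close> contributes
    \<open>2 k r N / M\<close>, and \<open>B2\<close> and \<open>B3\<close> contribute
    \<open>4 k^2 r N / M\<close> each.\<close>
  also have "real r * (\<epsilon> * N) + real r * (real M * (\<epsilon> * (\<epsilon> * N))) + real M * (real r * (\<epsilon> * (\<epsilon> * N)))
     = (2 * real k + 8 * real k ^ 2) * real r * N / real M"
    unfolding \<epsilon>_def using M_pos by (simp add: field_simps power2_eq_square)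
  also have "\<dots> \<le> 10 * real k ^ 2 * real r * N / real M"
    using k_pos N0 M_pos by (intro divide_right_mono mult_right_mono) (auto simp: power2_eq_square)
  finally have "real (card {w\<in>avoiding F. w b = w a}) * (real M - 1) \<ge> real (card L) - 10 * real k ^ 2 * real r * N / real M"
    by linarith
  with sum_value_lower[OF F ab(1)] cardL show ?thesis
    unfolding N_def S_def using M_pos by (simp add: field_simps)
qed

lemma collision_probability:
  assumes F: "F \<subseteq> conflicts" and ab: "a \<in> A" "b \<in> A" "a \<noteq> b" "p a = p b"
    and nF: "(a, b) \<notin> F" "(b, a) \<notin> F"
  shows "\<bar>real (card {w\<in>avoiding F. w b = w a}) - real (card (avoiding F)) * (M2 / (real M * (real M - 1)))\<bar>
    \<le> real (card (avoiding F)) * (32 * real k ^ 2 * real r / real M ^ 2)"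
proof -
  define N where "N = real (card (avoiding F))"
  define Nf where "Nf = real (card {w\<in>avoiding F. w b = w a})"
  define m where "m = real M"
  define s where "s = 2 * real k * real r"
  have N0: "N \<ge> 0" by (simp add: N_def)
  have m12: "m \<ge> 12 + 2 * s" "s \<ge> 2" using M_large kr_ge by (auto simp: m_def s_def)
  have up: "Nf * ((m - 1 - s) * (m - s)) \<le> N * M2"
    using collision_upper[OF F ab(1-3)] by (simp add: Nf_def m_def s_def N_def mult.assoc)
  have lo: "Nf * (m - 1) \<ge> N * (M2 - 14 * real k ^ 2 * real r) / m"
    using collision_lower[OF F ab nF] by (simp add: Nf_def m_def N_def)
  have h: "m - 1 - s \<ge> m / 2" "m - s \<ge> m / 2" "m - 1 \<ge> m / 2" "m > 0" using m12 by auto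
  have M2: "0 \<le> M2" "M2 \<le> real k * m" using M2_nonneg M2_le by (auto simp: m_def)
  have pos: "(m - 1 - s) * (m - s) > 0" "m * (m - 1) > 0" using h by (intro mult_pos_pos; linarith)+
  have "M2 / ((m - 1 - s) * (m - s)) - M2 / (m * (m - 1)) 
    = M2 * s * (2 * m - 1 - s) / (((m - 1 - s) * (m - s)) * (m * (m - 1)))"
  proof -
    have "(m - 1 - s) * (m - s) \<noteq> 0" "m * (m - 1) \<noteq> 0" using pos by linarith+
    then have "M2 / ((m - 1 - s) * (m - s)) - M2 / (m * (m - 1)) 
      = (M2 * (m * (m - 1)) - M2 * ((m - 1 - s) * (m - s))) / (((m - 1 - s) * (m - s)) * (m * (m - 1)))"
      by (rule diff_frac_eq)
    also have "M2 * (m * (m - 1)) - M2 * ((m - 1 - s) * (m - s)) = M2 * s * (2 * m - 1 - s)"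
      by (simp add: algebra_simps)
    finally show ?thesis .
  qed
  \<comment> \<open>The factors \<open>m - 1 - s\<close>, \<open>m - s\<close> and
    \<open>m - 1\<close> are all at least \<open>m / 2\<close>, and \<open>M2 \<le> k m\<close>;
    this yields \<open>16 k s / m^2\<close>, and \<open>s = 2 k r\<close> turns it into the constant
    32.\<close>
  also have "\<dots> \<le> (real k * m) * s * (2 * m) / (((m / 2) * (m / 2)) * (m * (m / 2)))"
    using h m12 M2 by (intro frac_le mult_mono mult_pos_pos mult_nonneg_nonneg) auto
  also have "\<dots> = 32 * real k ^ 2 * real r / m ^ 2"
    using h by (simp add: s_def field_simps power2_eq_square)
  finally have u: "M2 / ((m - 1 - s) * (m - s)) \<le> M2 / (m * (m - 1)) + 32 * real k ^ 2 * real r / m ^ 2" by linarith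
  have "Nf \<le> N * (M2 / ((m - 1 - s) * (m - s)))" using up pos by (simp add: field_simps)
  also have "\<dots> \<le> N * (M2 / (m * (m - 1)) + 32 * real k ^ 2 * real r / m ^ 2)" using u N0 by (intro mult_left_mono)
  finally have upper: "Nf \<le> N * (M2 / (m * (m - 1))) + N * (32 * real k ^ 2 * real r / m ^ 2)" by (simp add: distrib_left)
  have "14 * real k ^ 2 * real r / (m * (m - 1)) \<le> 14 * real k ^ 2 * real r / (m * (m / 2))"
    using h by (intro divide_left_mono mult_left_mono mult_pos_pos) auto
  also have "\<dots> \<le> 32 * real k ^ 2 * real r / m ^ 2" using h by (simp add: field_simps power2_eq_square)
  finally have l: "14 * real k ^ 2 * real r / (m * (m - 1)) \<le> 32 * real k ^ 2 * real r / m ^ 2" .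
  have "Nf \<ge> N * (M2 / (m * (m - 1)) - 14 * real k ^ 2 * real r / (m * (m - 1)))"
  proof -
    have "N * (M2 / (m * (m - 1)) - 14 * real k ^ 2 * real r / (m * (m - 1))) = N * (M2 - 14 * real k ^ 2 * real r) / m / (m - 1)"
      by (simp add: diff_divide_distrib right_diff_distrib)
    also have "\<dots> \<le> Nf" using lo h by (subst pos_divide_le_eq) auto
    finally show ?thesis .
  qed
  also have "N * (M2 / (m * (m - 1)) - 14 * real k ^ 2 * real r / (m * (m - 1)))
    \<ge> N * (M2 / (m * (m - 1)) - 32 * real k ^ 2 * real r / m ^ 2)" using l N0 by (intro mult_left_mono) auto
  finally have lower: "Nf \<ge> N * (M2 / (m * (m - 1))) - N * (32 * real k ^ 2 * real r / m ^ 2)" by (simp add: right_diff_distrib)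
  show ?thesis using upper lower unfolding N_def Nf_def m_def by (simp add: abs_le_iff)
qed

lemma avoiding_empty: "avoiding {} = words A V d"
  unfolding avoiding_def by simp

lemma card_words_pos: "0 < card (words A V d)"
  using card_words_mult_fact[OF finite_V finite_A sum_d]
  by (metis fact_nonzero gr0I mult_zero_left)

text \<open>Each new pair multiplies the count by \<open>1 - x\<close>, where \<open>x\<close> is
  its conditional coincidence probability. In units of \<open>k^2 r / M^2\<close>, replacing
  \<open>x\<close> by \<open>M2 / (M (M - 1))\<close> costs 32 and replacing
  \<open>ln (1 - x)\<close> by \<open>- x\<close> costs 8, which gives the 40. A pair may not occur
  in both orders, because the second copy would impose nothing new.\<close>

lemma avoiding_probability:
  assumes "F \<subseteq> conflicts" "\<And>x y. (x, y) \<in> F \<Longrightarrow> (y, x) \<notin> F"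
  shows "0 < card (avoiding F) \<and>
    \<bar>ln (real (card (avoiding F)) / real (card (words A V d))) + real (card F) * (M2 / (real M * (real M - 1)))\<bar>
      \<le> real (card F) * (40 * real k ^ 2 * real r / real M ^ 2)"
proof -
  have "finite F" using assms(1) finite_subset[of F "A \<times> A"] finite_A unfolding conflicts_def by auto
  then show ?thesis using assms
  proof (induction F rule: finite_induct)
    case empty
    then show ?case using card_words_pos by (simp add: avoiding_empty)
  next
    case (insert f F)
    obtain a b where f: "f = (a, b)" by fastforce
    have F: "F \<subseteq> conflicts" using insert.prems(1) by blast
    have "(a, b) \<in> conflicts" using insert.prems(1) f by blast
    then have ab: "a \<in> A" "b \<in> A" "a \<noteq> b" "p a = p b"
      unfolding conflicts_def by auto
    have nF: "(a, b) \<notin> F" "(b, a) \<notin> F" using insert.hyps(2) insert.prems(2)[of a b] f by blast+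
    define q where "q = M2 / (real M * (real M - 1))"
    define \<delta> where "\<delta> = 32 * real k ^ 2 * real r / real M ^ 2"
    define N where "N = real (card (avoiding F))"
    define W where "W = real (card (words A V d))"
    define Nf where "Nf = real (card {w\<in>avoiding F. w b = w a})"
    define N' where "N' = real (card (avoiding (insert f F)))"
    have IH: "0 < N" "\<bar>ln (N / W) + real (card F) * q\<bar> \<le> real (card F) * (40 * real k ^ 2 * real r / real M ^ 2)"
      proof -
      have "(y, x) \<notin> F" if "(x, y) \<in> F" for x y using insert.prems(2)[of x y] that by blast
      from insert.IH[OF F this] show "0 < N" "\<bar>ln (N / W) + real (card F) * q\<bar> \<le> real (card F) * (40 * real k ^ 2 * real r / real M ^ 2)"
        unfolding N_def q_def W_def by simp_all
    qed
    have W0: "W > 0" using card_words_pos by (simp add: W_def)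
    have "avoiding (insert f F) = avoiding F - {w\<in>avoiding F. w b = w a}"
      unfolding avoiding_def f by auto
    then have N': "N' = N - Nf"
      unfolding N'_def N_def Nf_def using finite_avoiding[of F]
      by (simp add: card_Diff_subset card_mono of_nat_diff)
    define x where "x = Nf / N"
    have x1: "\<bar>x - q\<bar> \<le> \<delta>"
    proof -
      have "\<bar>Nf - N * q\<bar> \<le> N * \<delta>"
        using collision_probability[OF F ab nF] unfolding N_def Nf_def q_def \<delta>_def .
      moreover have "x - q = (Nf - N * q) / N" using IH by (simp add: x_def field_simps)
      ultimately show ?thesis using IH by (simp add: abs_divide divide_le_eq mult.commute)
    qed
    have x2: "x \<le> 2 * real k / real M"
      using switch_eq_half[OF F, of "{a}" b a "\<lambda>_. True"] ab IH(1)
      by (simp add: x_def N_def Nf_def determined_on_def divide_le_eq)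
    have x0: "x \<ge> 0" unfolding x_def Nf_def N_def by simp
    have "2 * real k / real M \<le> 1 / 2"
      using M_large kr_ge M_pos by (simp add: divide_le_eq)
    then have xh: "x \<le> 1 / 2" using x2 by linarith
    have "\<bar>ln (1 + - x) - (- x)\<bar> \<le> 2 * (- x)\<^sup>2"
      using x0 xh by (intro abs_ln_one_plus_x_minus_x_bound) auto
    moreover have "x\<^sup>2 \<le> (2 * real k / real M)\<^sup>2" using x2 x0 by (intro power_mono)
    moreover have "2 * (2 * real k / real M)\<^sup>2 \<le> 8 * real k ^ 2 * real r / real M ^ 2"
      using r_pos by (simp add: power_divide power_mult_distrib divide_right_mono mult_le_cancel_left1)
    ultimately have l: "\<bar>ln (1 - x) + x\<bar> \<le> 8 * real k ^ 2 * real r / real M ^ 2" by simp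
    have N'x: "N' = N * (1 - x)" using IH by (simp add: N' x_def field_simps)
    have lnN': "ln (N' / W) = ln (N / W) + ln (1 - x)"
      unfolding N'x using IH(1) xh W0 by (simp add: ln_mult ln_div)
    have cf: "real (card (insert f F)) = real (card F) + 1" using insert.hyps by simp
    have "ln (N' / W) + real (card (insert f F)) * q = (ln (N / W) + real (card F) * q) + (ln (1 - x) + x) - (x - q)"
      unfolding lnN' cf by (simp add: algebra_simps)
    then have "\<bar>ln (N' / W) + real (card (insert f F)) * q\<bar> \<le>
      real (card F) * (40 * real k ^ 2 * real r / real M ^ 2) + 8 * real k ^ 2 * real r / real M ^ 2 + \<delta>"
      using IH(2) l x1 by linarith
    also have "\<dots> = real (card (insert f F)) * (40 * real k ^ 2 * real r / real M ^ 2)"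
      unfolding cf \<delta>_def by (simp add: add_divide_distrib algebra_simps)
    finally have "\<bar>ln (N' / W) + real (card (insert f F)) * q\<bar> \<le> real (card (insert f F)) * (40 * real k ^ 2 * real r / real M ^ 2)" .
    moreover have "N' > 0" unfolding N'x using IH xh by (intro mult_pos_pos) auto
    ultimately show ?case unfolding N'_def W_def q_def by simp
  qed
qed

text \<open>The slots \<open>x0\<close>, \<open>x1\<close>, \<open>x2\<close> are held fixed from
  the beginning and each \<open>y\<close>-slot is fresh when its turn comes, so each coincidence
  costs a further factor \<open>2 k / M\<close>. With the \<open>x\<close>-slots in one edge and the
  \<open>y\<close>-slots in another, this is the event behind a repeated edge.\<close>

lemma triple_collision:
  assumes F: "F \<subseteq> conflicts" and A: "{x0, x1, x2, y0, y1, y2} \<subseteq> A" and dist: "distinct [x0, x1, x2, y0, y1, y2]"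
  shows "real (card {w\<in>avoiding F. (w y0 = w x0 \<and> w y1 = w x1) \<and> w y2 = w x2})
    \<le> (2 * real k / real M) ^ 3 * real (card (avoiding F))"
proof -
  let ?e = "2 * real k / real M"
  have e0: "?e \<ge> 0" by simp
  have c: "card {x0, x1, x2, y0} \<le> 6" "card {x0, x1, x2, y0, y1} \<le> 6" "card {x0, x1, x2} \<le> 6"
    by (simp_all add: card_insert_if)
  have 1: "real (card {w\<in>avoiding F. w y0 = w x0}) \<le> ?e * real (card (avoiding F))"
    using switch_eq_half[OF F, of "{x0, x1, x2}" y0 x0 "\<lambda>_. True"] A dist c by (auto simp: determined_on_def)
  have 2: "real (card {w\<in>avoiding F. w y0 = w x0 \<and> w y1 = w x1}) \<le> ?e * real (card {w\<in>avoiding F. w y0 = w x0})"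
    using switch_eq_half[OF F, of "{x0, x1, x2, y0}" y1 x1 "\<lambda>w. w y0 = w x0"] A dist c by (auto simp: determined_on_def)
  have 3: "real (card {w\<in>avoiding F. (w y0 = w x0 \<and> w y1 = w x1) \<and> w y2 = w x2})
     \<le> ?e * real (card {w\<in>avoiding F. w y0 = w x0 \<and> w y1 = w x1})"
    using switch_eq_half[OF F, of "{x0, x1, x2, y0, y1}" y2 x2 "\<lambda>w. w y0 = w x0 \<and> w y1 = w x1"] A dist c 
    by (auto simp: determined_on_def)
  have "real (card {w\<in>avoiding F. (w y0 = w x0 \<and> w y1 = w x1) \<and> w y2 = w x2})
      \<le> ?e * (?e * (?e * real (card (avoiding F))))"
    using 3 mult_left_mono[OF order_trans[OF 2 mult_left_mono[OF 1 e0]] e0] by linarith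
  then show ?thesis by (simp add: power3_eq_cube mult.assoc)
qed

text \<open>The counterpart of \<open>triple_collision\<close> for a forbidden edge, whose vertices
  are prescribed instead of being read off from another edge of the word.\<close>

lemma triple_value:
  assumes F: "F \<subseteq> conflicts" and A: "{x0, x1, x2} \<subseteq> A" and dist: "distinct [x0, x1, x2]" and V: "{v0, v1, v2} \<subseteq> V"
  shows "real (card {w\<in>avoiding F. (w x0 = v0 \<and> w x1 = v1) \<and> w x2 = v2})
    \<le> (2 * real k / real M) ^ 3 * real (card (avoiding F))"
proof -
  let ?e = "2 * real k / real M"
  have e0: "?e \<ge> 0" by simp
  have c: "card {x0, x1} \<le> 6" by (simp add: card_insert_if)
  have 1: "real (card {w\<in>avoiding F. w x0 = v0}) \<le> ?e * real (card (avoiding F))"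
    using switch_half[OF F, of "{}" x0 "\<lambda>_. True" v0] A dist V by (auto simp: determined_on_def)
  have 2: "real (card {w\<in>avoiding F. w x0 = v0 \<and> w x1 = v1}) \<le> ?e * real (card {w\<in>avoiding F. w x0 = v0})"
    using switch_half[OF F, of "{x0}" x1 "\<lambda>w. w x0 = v0" v1] A dist V by (auto simp: determined_on_def)
  have 3: "real (card {w\<in>avoiding F. (w x0 = v0 \<and> w x1 = v1) \<and> w x2 = v2})
     \<le> ?e * real (card {w\<in>avoiding F. w x0 = v0 \<and> w x1 = v1})"
    using switch_half[OF F, of "{x0, x1}" x2 "\<lambda>w. w x0 = v0 \<and> w x1 = v1" v2] A dist V c by (auto simp: determined_on_def)
  have "real (card {w\<in>avoiding F. (w x0 = v0 \<and> w x1 = v1) \<and> w x2 = v2})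
      \<le> ?e * (?e * (?e * real (card (avoiding F))))"
    using 3 mult_left_mono[OF order_trans[OF 2 mult_left_mono[OF 1 e0]] e0] by linarith
  then show ?thesis by (simp add: power3_eq_cube mult.assoc)
qed

end

section \<open>Enumeration of hypergraphs with given degrees\<close>

text \<open>Deleting a cycle from a hypergraph leaves one that must not use the edges of the cycle
  again; these edges form \<open>X\<close>. With \<open>X = {}\<close> and constant degrees the
  regular hypergraphs are obtained.\<close>

definition hypergraphs_avoiding :: "'v set \<Rightarrow> ('v \<Rightarrow> nat) \<Rightarrow> nat \<Rightarrow> 'v set set \<Rightarrow> 'v set set set" where
  "hypergraphs_avoiding V d r X =
     {H. (\<forall>e\<in>H. e \<subseteq> V \<and> card e = r) \<and> (\<forall>x\<in>V. hdegree H x = d x) \<and> H \<inter> X = {}}"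

definition slots :: "nat \<Rightarrow> nat \<Rightarrow> (nat \<times> nat) set" where
  "slots m r = {..<m} \<times> {..<r}"

definition word_edge :: "nat \<Rightarrow> (nat \<times> nat \<Rightarrow> 'v) \<Rightarrow> nat \<Rightarrow> 'v set" where
  "word_edge r w j = (\<lambda>i. w (j, i)) ` {..<r}"

definition loopless_words :: "'v set \<Rightarrow> ('v \<Rightarrow> nat) \<Rightarrow> nat \<Rightarrow> nat \<Rightarrow> (nat \<times> nat \<Rightarrow> 'v) set" where
  "loopless_words V d r m = {w \<in> words (slots m r) V d. \<forall>j<m. inj_on (\<lambda>i. w (j, i)) {..<r}}"

definition simple_words :: "'v set \<Rightarrow> ('v \<Rightarrow> nat) \<Rightarrow> nat \<Rightarrow> nat \<Rightarrow> 'v set set \<Rightarrow> (nat \<times> nat \<Rightarrow> 'v) set" where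
  "simple_words V d r m X = {w \<in> loopless_words V d r m.
     inj_on (word_edge r w) {..<m} \<and> word_edge r w ` {..<m} \<inter> X = {}}"

text \<open>Bijections are the words in which every letter occurs once, so the multinomial count
  also counts orderings.\<close>

lemma words_one: "finite A \<Longrightarrow> words A B (\<lambda>_. 1) = {w \<in> A \<rightarrow>\<^sub>E B. bij_betw w A B}"
proof (intro set_eqI iffI)
  fix w assume w: "w \<in> words A B (\<lambda>_. 1)"
  then have 1: "\<exists>x. {x\<in>A. w x = v} = {x}" if "v \<in> B" for v 
    using that unfolding words_def by (auto simp: card_1_singleton_iff)
  have 2: "w \<in> A \<rightarrow>\<^sub>E B" using w unfolding words_def by auto
  have "inj_on w A"
  proof (rule inj_onI)
    fix x y assume xy: "x \<in> A" "y \<in> A" "w x = w y"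
    obtain z where "{u\<in>A. w u = w x} = {z}" using 1[of "w x"] 2 xy by auto
    then have "x \<in> {z}" "y \<in> {z}" using xy by auto
    then show "x = y" by simp
  qed
  moreover have "w ` A = B"
  proof
    show "w ` A \<subseteq> B" using 2 by auto
    show "B \<subseteq> w ` A"
    proof
      fix v assume "v \<in> B"
      then obtain x where "{x\<in>A. w x = v} = {x}" using 1 by blast
      then have "x \<in> {x\<in>A. w x = v}" by simp
      then show "v \<in> w ` A" by auto
    qed
  qed
  ultimately show "w \<in> {w \<in> A \<rightarrow>\<^sub>E B. bij_betw w A B}" using 2 by (simp add: bij_betw_def)
next
  fix w assume w: "w \<in> {w \<in> A \<rightarrow>\<^sub>E B. bij_betw w A B}"
  have "card {x\<in>A. w x = v} = 1" if v: "v \<in> B" for v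
  proof -
    obtain x where "x \<in> A" "w x = v" using w v by (auto simp: bij_betw_def)
    then have "{x\<in>A. w x = v} = {x}" using w by (auto simp: bij_betw_def inj_on_def)
    then show ?thesis by simp
  qed
  then show "w \<in> words A B (\<lambda>_. 1)" using w unfolding words_def by auto
qed

lemma card_bijections:
  assumes "finite A" "finite B" "card A = card B"
  shows "card {w \<in> A \<rightarrow>\<^sub>E B. bij_betw w A B} = fact (card B)"
  unfolding words_one[OF assms(1), symmetric]
  using card_words_mult_fact[of B A "\<lambda>_. 1"] assms by simp

lemma finite_bijections: "finite A \<Longrightarrow> finite B \<Longrightarrow> finite {w \<in> A \<rightarrow>\<^sub>E B. bij_betw w A B}"
  by (rule finite_subset[of _ "A \<rightarrow>\<^sub>E B"]) (auto intro: finite_PiE)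

lemma card_slots: "card (slots m r) = m * r"
  by (simp add: slots_def)

lemma finite_slots: "finite (slots m r)"
  by (simp add: slots_def)

text \<open>Looplessness makes the position of \<open>v\<close> within an edge unique and
  distinctness of the edges makes the edge index unique, so slots carrying \<open>v\<close>
  correspond to edges containing \<open>v\<close>.\<close>

lemma card_fibre_eq_hdegree:
  assumes "\<And>j. j < m \<Longrightarrow> inj_on (\<lambda>i. w (j, i)) {..<r}" "inj_on (word_edge r w) {..<m}"
  shows "card {s \<in> slots m r. w s = v} = hdegree (word_edge r w ` {..<m}) v"
  unfolding hdegree_def
proof (rule bij_betw_same_card[of "\<lambda>(j, i). word_edge r w j"])
  show "bij_betw (\<lambda>(j, i). word_edge r w j) {s \<in> slots m r. w s = v} {e \<in> word_edge r w ` {..<m}. v \<in> e}"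
    unfolding bij_betw_def
  proof
    show "inj_on (\<lambda>(j, i). word_edge r w j) {s \<in> slots m r. w s = v}"
    proof (rule inj_onI)
      fix s s' assume s: "s \<in> {s \<in> slots m r. w s = v}" "s' \<in> {s \<in> slots m r. w s = v}"
        and e: "(\<lambda>(j, i). word_edge r w j) s = (\<lambda>(j, i). word_edge r w j) s'"
      obtain j i j' i' where p: "s = (j, i)" "s' = (j', i')" by fastforce
      have "j = j'" using s e p assms(2) by (auto simp: slots_def inj_on_def)
      then show "s = s'" using s p assms(1)[of j] by (auto simp: slots_def inj_on_def)
    qed
    show "(\<lambda>(j, i). word_edge r w j) ` {s \<in> slots m r. w s = v} = {e \<in> word_edge r w ` {..<m}. v \<in> e}"
    proof (intro set_eqI iffI)
      fix e assume "e \<in> {e \<in> word_edge r w ` {..<m}. v \<in> e}"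
      then obtain j i where "j < m" "e = word_edge r w j" "i < r" "w (j, i) = v"
        by (auto simp: word_edge_def)
      then show "e \<in> (\<lambda>(j, i). word_edge r w j) ` {s \<in> slots m r. w s = v}"
        by (intro image_eqI[of _ _ "(j, i)"]) (auto simp: slots_def)
    qed (auto simp: slots_def word_edge_def)
  qed
qed

text \<open>The handshake identity, by counting incident pairs of a vertex and an edge.\<close>

lemma sum_hdegree:
  assumes "finite V" "\<And>e. e \<in> H \<Longrightarrow> e \<subseteq> V \<and> card e = r"
  shows "finite H" "(\<Sum>v\<in>V. hdegree H v) = r * card H"
proof -
  show fH: "finite H" using assms by (meson Pow_iff finite_Pow_iff finite_subset subsetI)
  have "(\<Sum>v\<in>V. hdegree H v) = (\<Sum>v\<in>V. \<Sum>e\<in>H. if v \<in> e then 1 else 0)"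
    unfolding hdegree_def using fH by (simp add: sum.If_cases Int_def)
  also have "\<dots> = (\<Sum>e\<in>H. \<Sum>v\<in>V. if v \<in> e then 1 else 0)" by (rule sum.swap)
  also have "\<dots> = (\<Sum>e\<in>H. card e)"
  proof (rule sum.cong[OF refl])
    fix e assume "e \<in> H"
    then have "V \<inter> {v. v \<in> e} = e" using assms by auto
    then show "(\<Sum>v\<in>V. if v \<in> e then 1 else 0) = card e" using assms(1) by (simp add: sum.If_cases)
  qed
  also have "\<dots> = r * card H" using assms by simp
  finally show "(\<Sum>v\<in>V. hdegree H v) = r * card H" .
qed

text \<open>A word for \<open>H\<close> amounts to an enumeration of its \<open>m\<close> edges
  together with an ordering of the \<open>r\<close> vertices of each; the word determines
  both.\<close>

lemma card_simple_words_fibre: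
  assumes V: "finite V" and dm: "(\<Sum>v\<in>V. d v) = m * r" and r: "0 < r"
    and H: "H \<in> hypergraphs_avoiding V d r X"
  shows "card {w \<in> simple_words V d r m X. word_edge r w ` {..<m} = H} = fact m * fact r ^ m"
proof -
  have He: "\<And>e. e \<in> H \<Longrightarrow> e \<subseteq> V \<and> card e = r" and Hd: "\<And>x. x \<in> V \<Longrightarrow> hdegree H x = d x" and HX: "H \<inter> X = {}"
    using H unfolding hypergraphs_avoiding_def by auto
  have fH: "finite H" by (rule sum_hdegree(1)[OF V He])
  have "(\<Sum>v\<in>V. hdegree H v) = m * r" using Hd dm by simp
  then have "r * card H = r * m" using sum_hdegree(2)[OF V He, of H] by (metis mult.commute)
  then have cH: "card H = m" using r by simp
  \<comment> \<open>\<open>b\<close> enumerates the edges; a member of \<open>P b\<close> orders the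
    vertices inside each of them.\<close>
  define B where "B = {b \<in> {..<m} \<rightarrow>\<^sub>E H. bij_betw b {..<m} H}"
  define P where "P b = (\<Pi>\<^sub>E j\<in>{..<m}. {g \<in> {..<r} \<rightarrow>\<^sub>E b j. bij_betw g {..<r} (b j)})" for b :: "nat \<Rightarrow> 'a set"
  let ?F = "{w \<in> simple_words V d r m X. word_edge r w ` {..<m} = H}"
  let ?f = "\<lambda>w. (restrict (word_edge r w) {..<m}, \<lambda>j\<in>{..<m}. \<lambda>i\<in>{..<r}. w (j, i))"
  let ?g = "\<lambda>(b, g). \<lambda>(j, i)\<in>slots m r. g j i"
  have fin: "finite e" "card e = r" if "e \<in> H" for e using He[OF that] finite_subset[of e V] V by simp_all
  have "bij_betw ?f ?F (SIGMA b:B. P b)"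
  proof (rule bij_betw_byWitness[where f' = ?g])
    show "\<forall>w\<in>?F. ?g (?f w) = w"
    proof
      fix w assume "w \<in> ?F"
      then have "w \<in> extensional (slots m r)"
        unfolding simple_words_def loopless_words_def words_def by (simp add: PiE_def)
      then show "?g (?f w) = w" 
        by (intro ext) (auto simp: slots_def extensional_def split: prod.splits)
    qed
    have gP: "bij_betw (g j) {..<r} (b j)" "g j \<in> extensional {..<r}" if "g \<in> P b" "j < m" for b g j
      using PiE_mem[OF that(1)[unfolded P_def], of j] that(2) by (auto simp: PiE_def)
    have im: "word_edge r (?g (b, g)) j = b j" if "g \<in> P b" "j < m" for b g j
      using gP(1)[OF that] that(2) by (simp add: word_edge_def slots_def bij_betw_def)
    show "\<forall>x\<in>(SIGMA b:B. P b). ?f (?g x) = x"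
    proof
      fix x assume "x \<in> (SIGMA b:B. P b)"
      then obtain b g where x: "x = (b, g)" and bg: "b \<in> B" "g \<in> P b" by blast
      have 1: "restrict (word_edge r (?g (b, g))) {..<m} = b"
      proof (rule extensionalityI[of _ "{..<m}"])
        show "b \<in> extensional {..<m}" using bg(1) by (simp add: B_def PiE_def)
      qed (use im[OF bg(2)] in auto)
      have 2: "(\<lambda>j\<in>{..<m}. \<lambda>i\<in>{..<r}. ?g (b, g) (j, i)) = g"
      proof (rule extensionalityI[of _ "{..<m}"])
        show "g \<in> extensional {..<m}" using bg(2) by (simp add: P_def PiE_def)
        fix j assume j: "j \<in> {..<m}"
        have "(\<lambda>i\<in>{..<r}. ?g (b, g) (j, i)) = g j"
          using gP(2)[OF bg(2), of j] j by (intro extensionalityI[of _ "{..<r}"]) (auto simp: slots_def)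
        then show "(\<lambda>j\<in>{..<m}. \<lambda>i\<in>{..<r}. ?g (b, g) (j, i)) j = g j" using j by simp
      qed simp
      show "?f (?g x) = x" using 1 2 unfolding x by simp
    qed
    show "?f ` ?F \<subseteq> (SIGMA b:B. P b)"
    proof (rule image_subsetI, rule SigmaI)
      fix w assume "w \<in> ?F"
      then have w: "w \<in> simple_words V d r m X" and Hw: "word_edge r w ` {..<m} = H" by auto
      show "restrict (word_edge r w) {..<m} \<in> B"
        using w Hw unfolding B_def simple_words_def by (auto simp: bij_betw_def)
      have "restrict (\<lambda>i. w (j, i)) {..<r} \<in> {g \<in> {..<r} \<rightarrow>\<^sub>E word_edge r w j. bij_betw g {..<r} (word_edge r w j)}" if "j < m" for j
        using w that unfolding simple_words_def loopless_words_def
        by (simp add: bij_betw_def word_edge_def)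
      then show "(\<lambda>j\<in>{..<m}. \<lambda>i\<in>{..<r}. w (j, i)) \<in> P (restrict (word_edge r w) {..<m})"
        unfolding P_def by (intro restrict_PiE_iff[THEN iffD2]) simp
    qed
    show "?g ` (SIGMA b:B. P b) \<subseteq> ?F"
    proof
      fix w assume "w \<in> ?g ` (SIGMA b:B. P b)"
      then obtain b g where bg: "(b, g) \<in> (SIGMA b:B. P b)" and w: "w = ?g (b, g)" by auto
      have wj: "w (j, i) = g j i" if "j < m" "i < r" for j i using that by (simp add: w slots_def)
      have bg': "b \<in> B" "g \<in> P b" using bg by blast+
      have e: "word_edge r w j = b j" if "j < m" for j using im[OF bg'(2) that] w by simp
      have b: "inj_on b {..<m}" "b ` {..<m} = H" using bg'(1) by (simp_all add: B_def bij_betw_def)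
      have inj: "inj_on (\<lambda>i. w (j, i)) {..<r}" if "j < m" for j
      proof -
        have "inj_on (g j) {..<r}" using gP(1)[OF bg'(2) that] by (simp add: bij_betw_def)
        then show ?thesis using wj[OF that] by (simp add: inj_on_def)
      qed
      have ie: "inj_on (word_edge r w) {..<m}" using b(1) e by (simp add: inj_on_def)
      have eH: "word_edge r w ` {..<m} = H" using b(2) e by auto
      have "w s \<in> V" if sl: "s \<in> slots m r" for s
      proof -
        obtain j i where s: "s = (j, i)" "j < m" "i < r" using sl by (auto simp: slots_def)
        then have "w s \<in> word_edge r w j" by (auto simp: word_edge_def)
        then show ?thesis using eH He s(2) by blast
      qed
      moreover have "w \<in> extensional (slots m r)" unfolding w by simp
      moreover have "card {s \<in> slots m r. w s = v} = d v" if "v \<in> V" for v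
        using card_fibre_eq_hdegree[OF inj ie] eH Hd[OF that] by simp
      ultimately have "w \<in> words (slots m r) V d" unfolding words_def by (auto simp: PiE_def)
      then show "w \<in> ?F"
        using inj ie eH HX unfolding simple_words_def loopless_words_def by auto
    qed
  qed
  then have "card ?F = card (SIGMA b:B. P b)" by (rule bij_betw_same_card)
  also have "\<dots> = (\<Sum>b\<in>B. card (P b))"
  proof (rule card_SigmaI)
    show "finite B" unfolding B_def by (rule finite_bijections[OF finite_lessThan fH])
    show "\<forall>b\<in>B. finite (P b)"
    proof
      fix b assume b: "b \<in> B"
      show "finite (P b)" unfolding P_def
      proof (intro finite_PiE finite_lessThan)
        fix j assume "j \<in> {..<m}"
        then have "b j \<in> H" using b by (auto simp: B_def)
        then show "finite {g \<in> {..<r} \<rightarrow>\<^sub>E b j. bij_betw g {..<r} (b j)}"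
          by (intro finite_bijections finite_lessThan fin(1))
      qed
    qed
  qed
  also have "\<dots> = (\<Sum>b\<in>B. fact r ^ m)"
  proof (rule sum.cong[OF refl])
    fix b assume b: "b \<in> B"
    have "card (P b) = (\<Prod>j<m. card {g \<in> {..<r} \<rightarrow>\<^sub>E b j. bij_betw g {..<r} (b j)})"
      unfolding P_def by (rule card_PiE) simp
    also have "\<dots> = (\<Prod>j<m. fact r)"
    proof (rule prod.cong[OF refl])
      fix j assume "j \<in> {..<m}"
      then have "b j \<in> H" using b by (auto simp: B_def)
      then show "card {g \<in> {..<r} \<rightarrow>\<^sub>E b j. bij_betw g {..<r} (b j)} = fact r"
        using card_bijections[OF finite_lessThan fin(1), of "b j" r] fin(2)[of "b j"] by simp
    qed
    finally show "card (P b) = fact r ^ m" by simp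
  qed
  also have "\<dots> = card B * fact r ^ m" by simp
  also have "card B = fact m" unfolding B_def using card_bijections[of "{..<m}" H] fH cH by simp
  finally show ?thesis .
qed

lemma card_simple_words:
  assumes V: "finite V" and dm: "(\<Sum>v\<in>V. d v) = m * r" and r: "0 < r"
  shows "card (simple_words V d r m X) = card (hypergraphs_avoiding V d r X) * (fact m * fact r ^ m)"
proof -
  let ?W = "simple_words V d r m X" and ?H = "hypergraphs_avoiding V d r X"
  have "word_edge r w ` {..<m} \<in> ?H" if w: "w \<in> ?W" for w
  proof -
    have inj: "inj_on (\<lambda>i. w (j, i)) {..<r}" if "j < m" for j
      using w that unfolding simple_words_def loopless_words_def by auto
    have "word_edge r w j \<subseteq> V \<and> card (word_edge r w j) = r" if "j < m" for j
      using w inj[OF that] that unfolding simple_words_def loopless_words_def words_def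
      by (auto simp: word_edge_def card_image slots_def)
    moreover have "hdegree (word_edge r w ` {..<m}) x = d x" if "x \<in> V" for x
      using card_fibre_eq_hdegree[OF inj, of m] w that unfolding simple_words_def loopless_words_def words_def
      by auto
    ultimately show ?thesis using w unfolding hypergraphs_avoiding_def simple_words_def by auto
  qed
  then have un: "?W = (\<Union>H\<in>?H. {w \<in> ?W. word_edge r w ` {..<m} = H})" by auto
  have finW: "finite ?W"
    using finite_words[OF finite_slots V] by (rule finite_subset[rotated]) (auto simp: simple_words_def loopless_words_def)
  have finH: "finite ?H"
    by (rule finite_subset[of _ "Pow (Pow V)"]) (auto simp: hypergraphs_avoiding_def V)
  have "card ?W = (\<Sum>H\<in>?H. card {w \<in> ?W. word_edge r w ` {..<m} = H})"
    by (subst un, subst card_UN_disjoint) (use finW finH in auto)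
  also have "\<dots> = (\<Sum>H\<in>?H. fact m * fact r ^ m)"
    using card_simple_words_fibre[OF V dm r] by (intro sum.cong) auto
  finally show ?thesis by simp
qed

lemma slot_part: "{y \<in> slots m r. fst y = fst x} \<subseteq> {fst x} \<times> {..<r}"
  by (auto simp: slots_def)

section \<open>From arbitrary words to loopless and simple ones\<close>

lemma ln_one_minus_bound:
  fixes x :: real
  assumes "0 \<le> x" "x \<le> 1 / 2"
  shows "\<bar>ln (1 - x)\<bar> \<le> 2 * x"
proof -
  have "\<bar>ln (1 + - x) - (- x)\<bar> \<le> 2 * (- x)\<^sup>2"
    using assms by (intro abs_ln_one_plus_x_minus_x_bound) auto
  moreover have "2 * x\<^sup>2 \<le> x" using assms mult_mono[of x x x "1/2"] by (simp add: power2_eq_square)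
  ultimately show ?thesis by simp
qed

text \<open>This is \<open>M2\<close> outside the locale, available to statements about
  hypergraphs.\<close>

definition falling_sum :: "'v set \<Rightarrow> ('v \<Rightarrow> nat) \<Rightarrow> real" where
  "falling_sum V d = (\<Sum>i\<in>V. real (d i) * (real (d i) - 1))"

text \<open>In units of \<open>k^3 r / m\<close> the error is at most 20 from the loops, 1 from
  writing \<open>M\<close> for \<open>M - 1\<close> in the main term, and 32 from repeated and
  forbidden edges; 60 rounds up the sum. The bound on \<open>m\<close> implies the size condition of
  the locale and keeps the fraction of bad loopless words below 1/2.\<close>

lemma simple_words_count:
  assumes V: "finite V" and dk: "\<And>v. v \<in> V \<Longrightarrow> d v \<le> k" and dm: "(\<Sum>v\<in>V. d v) = m * r"
    and r: "3 \<le> r" and k: "1 \<le> k" and m: "64 * k ^ 3 * r \<le> m"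
    and X: "\<And>e. e \<in> X \<Longrightarrow> e \<subseteq> V \<and> card e = r" and cX: "card X \<le> m * r"
  shows "0 < card (simple_words V d r m X) \<and> 0 < card (words (slots m r) V d) \<and>
    \<bar>ln (real (card (simple_words V d r m X)) / real (card (words (slots m r) V d)))
      + (real r - 1) * falling_sum V d / (2 * real (m * r))\<bar> \<le> 60 * real k ^ 3 * real r / real m"
proof -
  have kk: "k \<le> k ^ 3" using k by (simp add: self_le_power)
  have k1: "1 \<le> k ^ 3" using k by simp
  have "12 + 4 * k * r \<le> 64 * k ^ 3 * r"
  proof -
    have "k * r \<le> k ^ 3 * r" using kk by simp
    moreover have "1 * 3 \<le> k ^ 3 * r" using k1 r by (intro mult_mono) auto
    ultimately show ?thesis by linarith
  qed
  then have "12 + 4 * k * r \<le> m * r" using m r mult_le_mono2[of 1 r m] by linarith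
  interpret large_word_model "slots m r" V d fst r k
  proof
    show "finite (slots m r)" by (rule finite_slots)
    show "card {y \<in> slots m r. fst y = fst x} \<le> r" if "x \<in> slots m r" for x :: "nat \<times> nat"
      using card_mono[OF _ slot_part[of m r x]] by (simp add: card_cartesian_product)
    show "12 + 4 * k * r \<le> card (slots m r)" using \<open>12 + 4 * k * r \<le> m * r\<close> by (simp add: card_slots)
  qed (use V dk dm k r card_slots in auto)
  \<comment> \<open>Each pair of positions within an edge is listed once, with \<open>a < b\<close>,
    as \<open>avoiding_probability\<close> demands; there are \<open>m r (r - 1) / 2\<close> of
    them.\<close>
  define F where "F = (SIGMA j:{..<m}. {(a, b). a < b \<and> b < r})"
  define F0 where "F0 = (\<lambda>(j, a, b). ((j, a), (j, b))) ` F"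
  have F0: "F0 \<subseteq> conflicts" "\<And>x y. (x, y) \<in> F0 \<Longrightarrow> (y, x) \<notin> F0"
    unfolding conflicts_def by (auto simp: F0_def F_def slots_def)
  have cF0: "real (card F0) = real m * (real r * (real r - 1) / 2)"
  proof -
    have "card F0 = card F" unfolding F0_def by (rule card_image) (auto simp: inj_on_def)
    also have "\<dots> = m * card {(a, b). a < b \<and> b < r}" unfolding F_def by (simp add: card_cartesian_product)
    also have "{(a, b). a < b \<and> b < r} = prod.swap ` (SIGMA b:{..<r}. {..<b})" by force
    also have "card \<dots> = (\<Sum>b<r. b)" by (simp add: card_image)
    finally have "real (card F0) = real m * (\<Sum>b<r. real b)" by simp
    also have "(\<Sum>b<r. real b) = real r * (real r - 1) / 2"
      by (induction r) (auto simp: field_simps)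
    finally show ?thesis .
  qed
  have L: "loopless_words V d r m = avoiding F0"
  proof -
    have "(\<forall>j<m. inj_on (\<lambda>i. w (j, i)) {..<r}) \<longleftrightarrow> (\<forall>(x, y)\<in>F0. w x \<noteq> w y)" for w :: "nat \<times> nat \<Rightarrow> 'a"
    proof
      assume "\<forall>j<m. inj_on (\<lambda>i. w (j, i)) {..<r}"
      then show "\<forall>(x, y)\<in>F0. w x \<noteq> w y" unfolding F0_def F_def by (fastforce simp: inj_on_def)
    next
      assume a: "\<forall>(x, y)\<in>F0. w x \<noteq> w y"
      show "\<forall>j<m. inj_on (\<lambda>i. w (j, i)) {..<r}"
      proof (intro allI impI linorder_inj_onI)
        fix j a b assume "j < m" "a < b" "a \<in> {..<r}" "b \<in> {..<r}"
        then have "((j, a), (j, b)) \<in> F0" unfolding F0_def F_def by force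
        then show "w (j, a) \<noteq> w (j, b)" using a by blast
      qed auto
    qed
    then show ?thesis unfolding loopless_words_def avoiding_def by auto
  qed
  let ?L = "avoiding F0" and ?W = "words (slots m r) V d"
  define N where "N = real (card ?L)"
  define \<epsilon> where "\<epsilon> = (2 * real k / real M) ^ 3"
  have M: "real M = real m * real r" by (simp add: card_slots)
  have m0: "real m > 0" using M_pos M by (simp add: zero_less_mult_iff)
  have r0: "real r \<ge> 3" using r by simp
  have N0: "N > 0" and lnN: "\<bar>ln (N / real (card ?W)) + real (card F0) * (M2 / (real M * (real M - 1)))\<bar>
      \<le> real (card F0) * (40 * real k ^ 2 * real r / real M ^ 2)"
    using avoiding_probability[OF F0] unfolding N_def by auto
  have e0: "\<epsilon> \<ge> 0" unfolding \<epsilon>_def by simp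
  \<comment> \<open>Equality of the edges \<open>j\<close> and \<open>j'\<close> is witnessed by the
    positions \<open>b0\<close>, \<open>b1\<close>, \<open>b2\<close> in \<open>j'\<close> at which
    the first three vertices of \<open>j\<close> reappear. They are distinct since the word is
    loopless.\<close>
  define T where "T = {(b0, b1, b2). b0 < r \<and> b1 < r \<and> b2 < r \<and> b0 \<noteq> b1 \<and> b0 \<noteq> b2 \<and> b1 \<noteq> b2}"
  have T: "finite T" "real (card T) \<le> real r ^ 3"
  proof -
    have "T \<subseteq> {..<r} \<times> {..<r} \<times> {..<r}" unfolding T_def by auto
    then show "finite T" by (rule finite_subset) auto
    have "card T \<le> card ({..<r} \<times> {..<r} \<times> {..<r})" using \<open>T \<subseteq> _\<close> by (intro card_mono) auto
    also have "\<dots> = r ^ 3" by (simp add: power3_eq_cube)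
    finally show "real (card T) \<le> real r ^ 3" by (metis of_nat_le_iff of_nat_power)
  qed
  define C where "C j j' = (\<lambda>(b0, b1, b2). {w\<in>?L. (w (j', b0) = w (j, 0) \<and> w (j', b1) = w (j, 1)) \<and> w (j', b2) = w (j, 2)})" for j j'
  define R where "R = (\<Union>j\<in>{..<m}. \<Union>j'\<in>{..<m} - {j}. \<Union>t\<in>T. C j j' t)"
  define D where "D j = (\<lambda>(v0, v1, v2). {w\<in>?L. (w (j, 0) = v0 \<and> w (j, 1) = v1) \<and> w (j, 2) = v2})" for j
  define B where "B = (\<Union>j\<in>{..<m}. \<Union>e\<in>X. \<Union>t\<in>e \<times> e \<times> e. D j t)"
  have finX: "finite X" using X V by (meson finite_Pow_iff finite_subset PowI subsetI)
  have cR: "real (card R) \<le> real m * (real m * (real r ^ 3 * (\<epsilon> * N)))"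
    unfolding R_def
  proof (intro real_card_UN_le)
    show "real (card ({..<m} - {j})) \<le> real m" for j :: nat
      using card_mono[of "{..<m}" "{..<m} - {j}"] by simp
    fix j j' t assume j: "j \<in> {..<m}" "j' \<in> {..<m} - {j}" "t \<in> T"
    obtain b0 b1 b2 where t: "t = (b0, b1, b2)" by (cases t)
    show "real (card (C j j' t)) \<le> \<epsilon> * N"
      unfolding C_def t N_def \<epsilon>_def prod.case using j t r
      by (intro triple_collision F0) (auto simp: T_def slots_def)
  qed (use T e0 N0 in auto)
  have cB: "real (card B) \<le> real m * (real (m * r) * (real r ^ 3 * (\<epsilon> * N)))"
    unfolding B_def
  proof (intro real_card_UN_le)
    show "real (card X) \<le> real (m * r)" using cX by (simp only: of_nat_le_iff)
    fix j e assume j: "j \<in> {..<m}" and e: "e \<in> X"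
    have eV: "e \<subseteq> V" "card e = r" "finite e" using X[OF e] V finite_subset by auto
    show "finite (e \<times> e \<times> e)" using eV by auto
    show "real (card (e \<times> e \<times> e)) \<le> real r ^ 3" using eV by (simp add: card_cartesian_product power3_eq_cube)
    fix t assume "t \<in> e \<times> e \<times> e"
    then obtain v0 v1 v2 where t: "t = (v0, v1, v2)" "v0 \<in> e" "v1 \<in> e" "v2 \<in> e" by auto
    show "real (card (D j t)) \<le> \<epsilon> * N"
      unfolding D_def t(1) N_def \<epsilon>_def prod.case using j t eV r
      by (intro triple_value F0) (auto simp: slots_def)
  qed (use finX e0 N0 in auto)
  have bad: "?L - simple_words V d r m X \<subseteq> R \<union> B"
  proof
    fix w assume w: "w \<in> ?L - simple_words V d r m X"
    then have inj: "inj_on (\<lambda>i. w (j, i)) {..<r}" if "j < m" for j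
      using L that unfolding loopless_words_def by auto
    from w L have "\<not> inj_on (word_edge r w) {..<m} \<or> word_edge r w ` {..<m} \<inter> X \<noteq> {}"
      unfolding simple_words_def by auto
    then show "w \<in> R \<union> B"
    proof
      assume "\<not> inj_on (word_edge r w) {..<m}"
      then obtain j j' where j: "j < m" "j' < m" "j \<noteq> j'" "word_edge r w j = word_edge r w j'"
        unfolding inj_on_def by auto
      have "\<exists>b<r. w (j', b) = w (j, i)" if "i < r" for i
      proof -
        have "w (j, i) \<in> word_edge r w j'" using that j(4)[symmetric] by (auto simp: word_edge_def)
        then show ?thesis by (auto simp: word_edge_def)
      qed
      then obtain b where b: "\<And>i. i < r \<Longrightarrow> b i < r \<and> w (j', b i) = w (j, i)" by metis
      have bne: "b i \<noteq> b i'" if "i < r" "i' < r" "i \<noteq> i'" for i i'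
        using b[OF that(1)] b[OF that(2)] inj[OF j(1)] that by (auto simp: inj_on_def)
      have "(b 0, b 1, b 2) \<in> T" using b bne r unfolding T_def by simp
      moreover have "w \<in> C j j' (b 0, b 1, b 2)" using b r w unfolding C_def by simp
      ultimately have "w \<in> R" using j unfolding R_def by blast
      then show ?thesis by simp
    next
      assume "word_edge r w ` {..<m} \<inter> X \<noteq> {}"
      then obtain j where j: "j < m" "word_edge r w j \<in> X" by auto
      have "(w (j, 0), w (j, 1), w (j, 2)) \<in> word_edge r w j \<times> word_edge r w j \<times> word_edge r w j"
        using r by (auto simp: word_edge_def)
      moreover have "w \<in> D j (w (j, 0), w (j, 1), w (j, 2))" using w by (simp add: D_def)
      ultimately have "w \<in> B" using j unfolding B_def by blast
      then show ?thesis by simp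
    qed
  qed
  have finRB: "finite (R \<union> B)"
    using finite_avoiding[of F0] by (rule finite_subset[rotated]) (auto simp: R_def B_def C_def D_def)
  define x where "x = real (card (?L - simple_words V d r m X)) / N"
  have sub: "simple_words V d r m X \<subseteq> ?L" using L unfolding simple_words_def by auto
  have xN: "real (card (simple_words V d r m X)) = N * (1 - x)"
  proof -
    have "card ?L = card (simple_words V d r m X) + card (?L - simple_words V d r m X)"
      using sub finite_avoiding[of F0] by (metis card_Diff_subset finite_subset le_add_diff_inverse card_mono)
    then have "N = real (card (simple_words V d r m X)) + real (card (?L - simple_words V d r m X))"
      unfolding N_def by linarith
    then show ?thesis using N0 by (simp add: x_def field_simps)
  qed
  have "card (?L - simple_words V d r m X) \<le> card R + card B"
    using card_mono[OF finRB bad] card_Un_le[of R B] by linarith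
  then have "real (card (?L - simple_words V d r m X)) \<le> real (card R) + real (card B)" by linarith
  also have "\<dots> \<le> (real m * (real m * (real r ^ 3 * \<epsilon>)) + real m * (real (m * r) * (real r ^ 3 * \<epsilon>))) * N"
    using cR cB by (simp add: distrib_right mult.assoc)
  finally have "x \<le> real m * (real m * (real r ^ 3 * \<epsilon>)) + real m * (real (m * r) * (real r ^ 3 * \<epsilon>))"
    using N0 by (simp add: x_def divide_le_eq)
  \<comment> \<open>Repeated edges contribute \<open>8 k^3 / m\<close> and forbidden ones
    \<open>8 k^3 r / m\<close>: there are at most \<open>m^2 r^3\<close> and \<open>m^2 r^4\<close>
    events, each with the factor \<open>(2 k / M)^3\<close>, and \<open>M = m r\<close>.\<close>
  also have "\<dots> = 8 * real k ^ 3 * (1 + real r) / real m"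
    unfolding \<epsilon>_def M using m0 r0 by (simp add: power_divide power_mult_distrib field_simps power3_eq_cube)
  also have "\<dots> \<le> 8 * real k ^ 3 * (2 * real r) / real m"
    using r0 m0 by (intro divide_right_mono mult_left_mono) auto
  finally have x1: "x \<le> 16 * real k ^ 3 * real r / real m" by simp
  have "real (64 * k ^ 3 * r) \<le> real m" using m by (simp only: of_nat_le_iff)
  then have "16 * real k ^ 3 * real r / real m \<le> 1 / 2" using m0 by (simp add: divide_le_eq)
  then have xh: "x \<le> 1 / 2" using x1 by linarith
  have x0: "x \<ge> 0" using N0 by (simp add: x_def)
  have lnx: "\<bar>ln (1 - x)\<bar> \<le> 32 * real k ^ 3 * real r / real m"
    using ln_one_minus_bound[OF x0 xh] x1 by linarith
  have W0: "0 < card ?W" by (rule card_words_pos)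
  have S0: "0 < card (simple_words V d r m X)"
  proof -
    have "0 < N * (1 - x)" using N0 xh by (intro mult_pos_pos) auto
    then show ?thesis using xN by simp
  qed
  have q: "real (card F0) * (M2 / (real M * (real M - 1))) = (real r - 1) / 2 * (M2 / (real M - 1))"
    unfolding cF0 M using m0 r0 by simp
  have M1: "real M - 1 \<ge> real M / 2" using M_large kr_ge(1) by linarith
  have kr: "real k \<le> real k ^ 3" "1 \<le> real k" using kk k by (metis of_nat_le_iff of_nat_power, simp)
  have k2: "real k ^ 2 \<le> real k ^ 3" using kr(2) by (intro power_increasing) auto
  \<comment> \<open>The product of the factors has \<open>M - 1\<close> where the stated exponent
    has \<open>M\<close>; the difference is at most \<open>k / m\<close>.\<close>
  have "\<bar>(real r - 1) / 2 * (M2 / (real M - 1)) - (real r - 1) * M2 / (2 * real M)\<bar> = (real r - 1) / 2 * (M2 / (real M * (real M - 1)))"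
  proof -
    have "(real r - 1) / 2 * (M2 / (real M - 1)) - (real r - 1) * M2 / (2 * real M) = (real r - 1) / 2 * (M2 / (real M * (real M - 1)))"
      using M1 M_pos by (simp add: divide_simps) (simp add: algebra_simps)
    moreover have "(real r - 1) / 2 * (M2 / (real M * (real M - 1))) \<ge> 0"
      using M1 M_pos M2_nonneg r0 by simp
    ultimately show ?thesis by linarith
  qed
  also have "\<dots> \<le> real r / 2 * ((real k * real M) / (real M * (real M / 2)))"
    using M1 M_pos M2_nonneg M2_le r0 by (intro mult_mono frac_le mult_left_mono) auto
  also have "\<dots> = real k / real m"
    unfolding M using m0 r0 by (simp add: field_simps)
  also have "\<dots> \<le> real k ^ 3 * real r / real m"
    using kr r0 m0 mult_mono[of "real k" "real k ^ 3" 1 "real r"] by (intro divide_right_mono) auto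
  finally have d1: "\<bar>real (card F0) * (M2 / (real M * (real M - 1))) - (real r - 1) * M2 / (2 * real M)\<bar> \<le> real k ^ 3 * real r / real m"
    unfolding q .
  have "real (card F0) * (40 * real k ^ 2 * real r / real M ^ 2) = 20 * real k ^ 2 * (real r - 1) / real m"
    unfolding cF0 M using m0 r0 by (simp add: field_simps power2_eq_square)
  also have "\<dots> \<le> 20 * real k ^ 3 * real r / real m"
    using k2 r0 m0 by (intro divide_right_mono mult_mono) auto
  finally have d2: "\<bar>ln (N / real (card ?W)) + real (card F0) * (M2 / (real M * (real M - 1)))\<bar> \<le> 20 * real k ^ 3 * real r / real m"
    using lnN by linarith
  have tri: "\<bar>a + b + q\<bar> \<le> e2 + e1 + e3" if "\<bar>a + c\<bar> \<le> e2" "\<bar>c - q\<bar> \<le> e1" "\<bar>b\<bar> \<le> e3" for a b c q e1 e2 e3 :: real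
    using that by linarith
  have "ln (real (card (simple_words V d r m X)) / real (card ?W)) = ln (N / real (card ?W)) + ln (1 - x)"
    unfolding xN using N0 xh W0 by (simp add: ln_mult ln_div)
  then have "\<bar>ln (real (card (simple_words V d r m X)) / real (card ?W)) + (real r - 1) * M2 / (2 * real M)\<bar>
    \<le> 20 * real k ^ 3 * real r / real m + real k ^ 3 * real r / real m + 32 * real k ^ 3 * real r / real m"
    using tri[OF d2 d1 lnx] by (simp only:)
  also have "\<dots> \<le> 60 * real k ^ 3 * real r / real m" using m0 by (simp add: field_simps)
  finally show ?thesis using S0 W0 by (simp add: M2_def falling_sum_def card_slots)
qed

text \<open>The fraction is the number of words divided by the \<open>m! (r!)^m\<close> labellings
  of a hypergraph. The exponent is, to leading order, minus the expected number of coincident pairs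
  inside edges: \<open>m r (r - 1) / 2\<close> pairs at rate
  \<open>falling_sum V d / (m r)^2\<close>. The bound on \<open>\<theta>\<close> does not depend on
  \<open>X\<close>, which allows one estimate for all cycles.\<close>

theorem hypergraph_count:
  assumes V: "finite V" and dk: "\<And>v. v \<in> V \<Longrightarrow> d v \<le> k" and dm: "(\<Sum>v\<in>V. d v) = m * r"
    and r: "3 \<le> r" and k: "1 \<le> k" and m: "64 * k ^ 3 * r \<le> m"
    and X: "\<And>e. e \<in> X \<Longrightarrow> e \<subseteq> V \<and> card e = r" and cX: "card X \<le> m * r"
  obtains \<theta> where "\<bar>\<theta>\<bar> \<le> 60 * real k ^ 3 * real r / real m"
    "real (card (hypergraphs_avoiding V d r X)) =
      fact (m * r) / (fact m * fact r ^ m * (\<Prod>v\<in>V. fact (d v)))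
        * exp (- (real r - 1) * falling_sum V d / (2 * real (m * r)) + \<theta>)"
proof -
  let ?S = "real (card (simple_words V d r m X))" and ?W = "real (card (words (slots m r) V d))"
  define \<theta> where "\<theta> = ln (?S / ?W) + (real r - 1) * falling_sum V d / (2 * real (m * r))"
  have *: "?S > 0" "?W > 0" "\<bar>\<theta>\<bar> \<le> 60 * real k ^ 3 * real r / real m"
    using simple_words_count[OF assms] unfolding \<theta>_def by auto
  have r0: "0 < r" using r by simp
  have "?S = ?W * exp (ln (?S / ?W))" using * by simp
  also have "ln (?S / ?W) = - (real r - 1) * falling_sum V d / (2 * real (m * r)) + \<theta>"
    unfolding \<theta>_def by (simp only: mult_minus_left minus_divide_left[symmetric])
  finally have S: "?S = ?W * exp (- (real r - 1) * falling_sum V d / (2 * real (m * r)) + \<theta>)" .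
  have "card (words (slots m r) V d) * (\<Prod>v\<in>V. fact (d v)) = fact (m * r)"
    using card_words_mult_fact[OF V finite_slots[of m r], of d] dm by (simp add: card_slots)
  then have "real (card (words (slots m r) V d) * (\<Prod>v\<in>V. fact (d v))) = real (fact (m * r))"
    by (simp only:)
  then have "?W * (\<Prod>v\<in>V. fact (d v)) = fact (m * r)" by simp
  moreover have "(\<Prod>v\<in>V. fact (d v) :: real) \<noteq> 0" by (simp add: V)
  ultimately have W: "?W = fact (m * r) / (\<Prod>v\<in>V. fact (d v))" by (simp add: field_simps)
  have "?S = real (card (hypergraphs_avoiding V d r X)) * (fact m * fact r ^ m)"
    unfolding card_simple_words[OF V dm r0] by simp
  then have "real (card (hypergraphs_avoiding V d r X)) = ?S / (fact m * fact r ^ m)"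
    by (simp add: field_simps)
  also have "\<dots> = fact (m * r) / (fact m * fact r ^ m * (\<Prod>v\<in>V. fact (d v)))
        * exp (- (real r - 1) * falling_sum V d / (2 * real (m * r)) + \<theta>)"
    unfolding S W by simp
  finally show ?thesis using that *(3) by blast
qed

section \<open>Loose Hamilton cycles\<close>

text \<open>Here \<open>l = r - 1\<close>. The position \<open>i * l + j\<close> is place
  \<open>j\<close> of block \<open>i\<close>: place 0 is the vertex shared by two consecutive edges,
  called a hub, and the other places lie in one edge only. For \<open>t = 2\<close> the pairs of
  consecutive indices would coincide and the symmetry count below would fail.\<close>

locale cyclic_blocks =
  fixes t l n :: nat
  assumes t_ge: "3 \<le> t" and l_ge: "2 \<le> l" and n_eq: "n = t * l"
begin

text \<open>The cyclic successor on \<open>{..<t}\<close>, by cases instead of \<open>mod\<close>,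
  so that case splits and linear arithmetic can handle it.\<close>

definition nx :: "nat \<Rightarrow> nat" where
  "nx i = (if Suc i = t then 0 else Suc i)"

lemma nx_less: "i < t \<Longrightarrow> nx i < t"
  unfolding nx_def by auto

lemma nx_inj: "i < t \<Longrightarrow> j < t \<Longrightarrow> nx i = nx j \<Longrightarrow> i = j"
  unfolding nx_def by (auto split: if_splits)

lemma nx_neq: "i < t \<Longrightarrow> nx i \<noteq> i"
  unfolding nx_def using t_ge by auto

lemma nx_nx_neq: "i < t \<Longrightarrow> nx (nx i) \<noteq> i"
  unfolding nx_def using t_ge by (auto split: if_splits)

lemma nx_surj: "i < t \<Longrightarrow> \<exists>j<t. nx j = i"
  unfolding nx_def using t_ge
  by (cases i) (auto intro: exI[of _ "t - 1"])

lemma nx_pair_eq: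
  assumes "i < t" "j < t" "{i, nx i} = {j, nx j}"
  shows "i = j"
  using assms nx_nx_neq by (metis doubleton_eq_iff)

text \<open>The automorphisms of the cycle graph on \<open>{..<t}\<close>: permutations that send
  neighbours to neighbours, with the direction left open. In this form they arise from two orderings
  of one loose cycle.\<close>

definition dihedral :: "(nat \<Rightarrow> nat) set" where
  "dihedral = {\<rho> \<in> {..<t} \<rightarrow>\<^sub>E {..<t}. inj_on \<rho> {..<t} \<and> (\<forall>i<t. \<exists>s<t. {\<rho> i, \<rho> (nx i)} = {s, nx s})}"

lemma dihedralD: "\<rho> \<in> dihedral \<Longrightarrow> i < t \<Longrightarrow> \<exists>s<t. {\<rho> i, \<rho> (nx i)} = {s, nx s}"
  unfolding dihedral_def by blast

text \<open>The map \<open>i\<close> to \<open>c + i\<close> or, if \<open>b\<close> is false, to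
  \<open>c - i\<close>, modulo \<open>t\<close>: a rotation or a reflection that sends 0 to
  \<open>c\<close>.\<close>

definition rot :: "nat \<Rightarrow> bool \<Rightarrow> nat \<Rightarrow> nat" where
  "rot c b = (\<lambda>i\<in>{..<t}. if b then (if c + i < t then c + i else c + i - t)
                          else (if i \<le> c then c - i else c + t - i))"

lemma rot_dihedral: "c < t \<Longrightarrow> rot c b \<in> dihedral"
proof -
  assume c: "c < t"
  have "rot c b \<in> {..<t} \<rightarrow>\<^sub>E {..<t}" using c unfolding rot_def by auto
  moreover have "inj_on (rot c b) {..<t}" using c unfolding rot_def inj_on_def by auto
  moreover have "\<exists>s<t. {rot c b i, rot c b (nx i)} = {s, nx s}" if i: "i < t" for i
  proof (cases b)
    case True
    have "rot c b (nx i) = nx (rot c b i)" "rot c b i < t"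
      using True c i nx_less[OF i] t_ge unfolding rot_def nx_def by auto
    then show ?thesis by (intro exI[of _ "rot c b i"]) auto
  next
    case False
    have "nx (rot c b (nx i)) = rot c b i" "rot c b (nx i) < t"
      using False c i nx_less[OF i] t_ge unfolding rot_def nx_def by auto
    then show ?thesis by (intro exI[of _ "rot c b (nx i)"]) auto
  qed
  ultimately show ?thesis unfolding dihedral_def by auto
qed

text \<open>Walking along the cycle, the image of the next index is the neighbour of the current
  image that was not visited just before, so two consecutive images determine everything.\<close>

lemma dihedral_eqI:
  assumes "\<rho> \<in> dihedral" "\<sigma> \<in> dihedral" "\<rho> 0 = \<sigma> 0" "\<rho> 1 = \<sigma> 1"
  shows "\<rho> = \<sigma>"
proof -
  \<comment> \<open>Two neighbours \<open>z\<close> and \<open>z'\<close> of \<open>a\<close> that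
    both differ from its neighbour \<open>x\<close> agree, as \<open>a\<close> has only two
    neighbours.\<close>
  have step: "z = z'" if "a < t" "x < t" "z < t" "z' < t" "s < t" "s' < t" "s'' < t"
    "{x, a} = {s, nx s}" "{a, z} = {s', nx s'}" "{a, z'} = {s'', nx s''}" "z \<noteq> x" "z' \<noteq> x" for a x z z' s s' s''
    using that nx_inj[of s s'] nx_inj[of s s''] nx_inj[of s' s''] unfolding doubleton_eq_iff by auto
  have "Suc i < t \<longrightarrow> \<rho> i = \<sigma> i \<and> \<rho> (Suc i) = \<sigma> (Suc i)" for i
  proof (induction i)
    case 0
    then show ?case using assms by simp
  next
    case (Suc i)
    show ?case
    proof
      assume i: "Suc (Suc i) < t"
      have nx: "nx i = Suc i" "nx (Suc i) = Suc (Suc i)" using i by (auto simp: nx_def)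
      have IH: "\<rho> i = \<sigma> i" "\<rho> (Suc i) = \<sigma> (Suc i)" using Suc i by auto
      obtain s where s: "s < t" "{\<rho> i, \<rho> (Suc i)} = {s, nx s}"
        using dihedralD[OF assms(1), of i] i nx by auto
      obtain s' where s': "s' < t" "{\<rho> (Suc i), \<rho> (Suc (Suc i))} = {s', nx s'}"
        using dihedralD[OF assms(1), of "Suc i"] i nx by auto
      obtain s'' where s'': "s'' < t" "{\<rho> (Suc i), \<sigma> (Suc (Suc i))} = {s'', nx s''}"
        using dihedralD[OF assms(2), of "Suc i"] i nx IH by auto
      have "\<rho> (Suc (Suc i)) = \<sigma> (Suc (Suc i))"
      proof (rule step[OF _ _ _ _ s(1) s'(1) s''(1) s(2) s'(2) s''(2)])
        show "\<rho> (Suc i) < t" "\<rho> i < t" "\<rho> (Suc (Suc i)) < t" "\<sigma> (Suc (Suc i)) < t"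
          using assms(1,2) i unfolding dihedral_def by auto
        show "\<rho> (Suc (Suc i)) \<noteq> \<rho> i"
          using assms(1) i unfolding dihedral_def by (auto dest: inj_onD)
        have "\<sigma> (Suc (Suc i)) \<noteq> \<sigma> i"
          using assms(2) i unfolding dihedral_def by (auto dest: inj_onD)
        then show "\<sigma> (Suc (Suc i)) \<noteq> \<rho> i" using IH by simp
      qed
      then show "\<rho> (Suc i) = \<sigma> (Suc i) \<and> \<rho> (Suc (Suc i)) = \<sigma> (Suc (Suc i))" using IH by simp
    qed
  qed
  then have "\<rho> i = \<sigma> i" if "i < t" for i
    using that t_ge assms(3) by (cases i) auto
  then show ?thesis
    using assms(1,2) unfolding dihedral_def by (intro extensionalityI[of _ "{..<t}"]) (auto simp: PiE_def)
qed

text \<open>There are \<open>t\<close> choices for the image of 0 and two neighbours of it for the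
  image of 1; these two differ because \<open>t \<ge> 3\<close>.\<close>

lemma card_dihedral: "card dihedral = 2 * t"
proof -
  have r0: "rot c b 0 = c" if "c < t" for c b using that unfolding rot_def by auto
  have r1: "rot c True 1 = nx c" "nx (rot c False 1) = c" "rot c False 1 < t" if "c < t" for c 
    using that t_ge unfolding rot_def nx_def by auto
  have "dihedral = (\<lambda>(c, b). rot c b) ` ({..<t} \<times> UNIV)"
  proof
    show "dihedral \<subseteq> (\<lambda>(c, b). rot c b) ` ({..<t} \<times> UNIV)"
    proof
      fix \<rho> assume \<rho>: "\<rho> \<in> dihedral"
      have c: "\<rho> 0 < t" "\<rho> 1 < t" using \<rho> t_ge unfolding dihedral_def by auto
      have "0 < t" "nx 0 = 1" using t_ge by (auto simp: nx_def)
      then obtain s where "s < t" "{\<rho> 0, \<rho> 1} = {s, nx s}" using \<rho> unfolding dihedral_def by force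
      then have "\<rho> 1 = nx (\<rho> 0) \<or> nx (\<rho> 1) = \<rho> 0" by (auto simp: doubleton_eq_iff)
      then have "\<exists>b. \<rho> 1 = rot (\<rho> 0) b 1" using r1[OF c(1)] nx_inj c by metis
      then obtain b where "\<rho> 1 = rot (\<rho> 0) b 1" by blast
      then have "\<rho> = rot (\<rho> 0) b" using \<rho> rot_dihedral[OF c(1)] r0[OF c(1)] by (intro dihedral_eqI) auto
      then show "\<rho> \<in> (\<lambda>(c, b). rot c b) ` ({..<t} \<times> UNIV)" using c by (intro image_eqI[of _ _ "(\<rho> 0, b)"]) auto
    qed
  qed (use rot_dihedral in auto)
  moreover have "inj_on (\<lambda>(c, b). rot c b) ({..<t} \<times> UNIV)"
  proof (rule inj_onI, clarify)
    fix c b c' b' assume c: "c < t" "c' < t" and e: "rot c b = rot c' b'"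
    have cc: "c = c'" using r0[OF c(1), of b] r0[OF c(2), of b'] e by simp
    have "rot c True 1 \<noteq> rot c False 1" using r1[OF c(1)] nx_nx_neq[OF c(1)] by metis
    then have "b = b'" using e cc by (cases b; cases b') auto
    then show "c = c' \<and> b = b'" using cc by simp
  qed
  ultimately show ?thesis by (simp add: card_image card_cartesian_product)
qed

lemma pos_less: "i < t \<Longrightarrow> j < l \<Longrightarrow> i * l + j < n"
proof -
  assume "i < t" "j < l"
  then have "Suc i * l \<le> t * l" by (intro mult_right_mono) auto
  then show ?thesis using \<open>j < l\<close> by (simp add: n_eq)
qed

lemma pos_eq_iff: "j < l \<Longrightarrow> j' < l \<Longrightarrow> i * l + j = i' * l + j' \<longleftrightarrow> i = i' \<and> j = j'"
  by (metis add.commute div_mult_self1 div_less mod_mult_self1 mod_less add_cancel_right_left less_nat_zero_code)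

lemma pos_cases:
  assumes "x < n"
  obtains i j where "i < t" "j < l" "x = i * l + j"
proof
  show "x div l < t" using assms by (simp add: n_eq less_mult_imp_div_less)
  show "x mod l < l" using l_ge by simp
qed simp

definition hedge :: "(nat \<Rightarrow> 'a) \<Rightarrow> nat \<Rightarrow> 'a set" where
  "hedge v i = (\<lambda>j. v ((i * l + j) mod n)) ` {0..l}"

definition inner :: "(nat \<Rightarrow> 'a) \<Rightarrow> nat \<Rightarrow> 'a set" where
  "inner v i = (\<lambda>j. v (i * l + j)) ` {1..<l}"

lemma hedge_eq:
  assumes i: "i < t"
  shows "hedge v i = insert (v (i * l)) (insert (v (nx i * l)) (inner v i))"
proof -
  have "{0..l} = insert 0 (insert l {1..<l})" using l_ge by auto
  \<comment> \<open>Among the offsets \<open>0..l\<close> only \<open>l\<close> leaves the block,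
    and the reduction modulo \<open>n\<close> brings the last block back to hub 0.\<close>
  moreover have "(i * l + l) mod n = nx i * l"
  proof (cases "Suc i = t")
    case True
    then have "i * l + l = n" by (metis add.commute mult_Suc n_eq)
    then show ?thesis using True by (simp add: nx_def)
  next
    case False
    then have "Suc i * l + 0 < n" using i l_ge by (intro pos_less) auto
    then show ?thesis using False by (simp add: nx_def add.commute)
  qed
  moreover have "(i * l + j) mod n = i * l + j" if "j < l" for j using pos_less[OF i that] by simp
  moreover from this[of 0] have "i * l mod n = i * l" using l_ge by simp
  ultimately show ?thesis unfolding hedge_def inner_def using l_ge by auto
qed

end

section \<open>Edges and hubs of the cycle given by an ordering\<close>

locale loose_cycle_count = cyclic_blocks +
  fixes V :: "'a set"
  assumes finite_V: "finite V" and card_V: "card V = n"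
begin

definition orderings :: "(nat \<Rightarrow> 'a) set" where
  "orderings = {v \<in> {..<n} \<rightarrow>\<^sub>E V. bij_betw v {..<n} V}"

definition cyc :: "(nat \<Rightarrow> 'a) \<Rightarrow> 'a set set" where
  "cyc v = hedge v ` {..<t}"

lemma card_orderings: "card orderings = fact n"
  unfolding orderings_def using card_bijections[of "{..<n}" V] finite_V card_V by simp

lemma ordering_eq_iff: "bij_betw v {..<n} V \<Longrightarrow> x < n \<Longrightarrow> y < n \<Longrightarrow> v x = v y \<longleftrightarrow> x = y"
  by (auto simp: bij_betw_def inj_on_def)

lemma ordering_pos_eq_iff:
  assumes "bij_betw v {..<n} V" "i < t" "i' < t" "j < l" "j' < l"
  shows "v (i * l + j) = v (i' * l + j') \<longleftrightarrow> i = i' \<and> j = j'"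
  using ordering_eq_iff[OF assms(1)] pos_less assms pos_eq_iff by simp

lemma ordering_mem_V: "bij_betw v {..<n} V \<Longrightarrow> i < t \<Longrightarrow> j < l \<Longrightarrow> v (i * l + j) \<in> V"
  using pos_less by (auto simp: bij_betw_def)

lemma mem_inner_iff:
  assumes "bij_betw v {..<n} V" "a < t" "i < t" "b < l"
  shows "v (a * l + b) \<in> inner v i \<longleftrightarrow> a = i \<and> b \<noteq> 0"
proof -
  have "v (a * l + b) \<in> inner v i \<longleftrightarrow> (\<exists>j\<in>{1..<l}. v (a * l + b) = v (i * l + j))"
    unfolding inner_def by auto
  also have "\<dots> \<longleftrightarrow> (\<exists>j\<in>{1..<l}. a = i \<and> b = j)"
    using ordering_pos_eq_iff[OF assms(1-3)] assms(4) by auto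
  finally show ?thesis using assms(4) by auto
qed

lemma mem_hedge_iff:
  assumes "bij_betw v {..<n} V" "a < t" "i < t" "b < l"
  shows "v (a * l + b) \<in> hedge v i \<longleftrightarrow> a = i \<or> b = 0 \<and> a = nx i"
proof -
  have l0: "0 < l" using l_ge by simp
  have "v (a * l + b) = v (c * l) \<longleftrightarrow> a = c \<and> b = 0" if "c < t" for c
    using ordering_pos_eq_iff[OF assms(1,2) that assms(4) l0] by simp
  then show ?thesis
    unfolding hedge_eq[OF assms(3)] using mem_inner_iff[OF assms] nx_less[OF assms(3)] assms(3) by auto
qed

text \<open>Since \<open>l \<ge> 2\<close>, place 1 of a block holds a vertex that lies in one edge
  only and so identifies this edge.\<close>

lemma inj_on_hedge:
  assumes "bij_betw v {..<n} V"
  shows "inj_on (hedge v) {..<t}"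
proof (rule inj_onI)
  fix i i' assume i: "i \<in> {..<t}" "i' \<in> {..<t}" "hedge v i = hedge v i'"
  have "v (i * l + 1) \<in> hedge v i" using mem_hedge_iff[OF assms, of i i 1] i l_ge by simp
  then show "i = i'" using mem_hedge_iff[OF assms, of i i' 1] i l_ge by simp
qed

lemma card_cyc: "bij_betw v {..<n} V \<Longrightarrow> card (cyc v) = t"
  unfolding cyc_def by (simp add: card_image inj_on_hedge)

lemma card_hedge:
  assumes v: "bij_betw v {..<n} V" and i: "i < t"
  shows "hedge v i \<subseteq> V" "card (hedge v i) = Suc l"
proof -
  have l0: "0 < l" using l_ge by simp
  have inV: "inner v i \<subseteq> V" unfolding inner_def using ordering_mem_V[OF v i] by auto
  show "hedge v i \<subseteq> V"
    unfolding hedge_eq[OF i] using inV ordering_mem_V[OF v i l0] ordering_mem_V[OF v nx_less[OF i] l0] by simp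
  have "inj_on (\<lambda>j. v (i * l + j)) {1..<l}"
    using ordering_pos_eq_iff[OF v i i] by (auto simp: inj_on_def)
  then have "card (inner v i) = l - 1" unfolding inner_def by (simp add: card_image)
  moreover have "v (i * l) \<notin> insert (v (nx i * l)) (inner v i)" "v (nx i * l) \<notin> inner v i"
    using mem_inner_iff[OF v i i l0] mem_inner_iff[OF v nx_less[OF i] i l0] 
      ordering_pos_eq_iff[OF v i nx_less[OF i] l0 l0] nx_neq[OF i] by auto
  moreover have "finite (inner v i)" unfolding inner_def by simp
  ultimately show "card (hedge v i) = Suc l" unfolding hedge_eq[OF i] using l_ge by simp
qed

lemma hdegree_cyc:
  assumes v: "bij_betw v {..<n} V" and a: "a < t" "b < l"
  shows "hdegree (cyc v) (v (a * l + b)) = (if b = 0 then 2 else 1)"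
proof -
  have "{e \<in> cyc v. v (a * l + b) \<in> e} = hedge v ` {i\<in>{..<t}. v (a * l + b) \<in> hedge v i}"
    unfolding cyc_def by auto
  also have "{i\<in>{..<t}. v (a * l + b) \<in> hedge v i} = {i\<in>{..<t}. a = i \<or> b = 0 \<and> a = nx i}"
    using mem_hedge_iff[OF v a(1) _ a(2)] by auto
  finally have "hdegree (cyc v) (v (a * l + b)) = card (hedge v ` {i\<in>{..<t}. a = i \<or> b = 0 \<and> a = nx i})"
    unfolding hdegree_def by simp
  also have "\<dots> = card {i\<in>{..<t}. a = i \<or> b = 0 \<and> a = nx i}"
    using inj_on_hedge[OF v] by (intro card_image) (auto simp: inj_on_def)
  also have "\<dots> = (if b = 0 then 2 else 1)"
  proof (cases "b = 0")
    case True
    obtain c where c: "c < t" "nx c = a" using nx_surj[OF a(1)] by blast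
    have "{i\<in>{..<t}. a = i \<or> b = 0 \<and> a = nx i} = {a, c}" using True c a nx_inj by auto
    moreover have "a \<noteq> c" using nx_neq c by auto
    ultimately show ?thesis using True by simp
  next
    case False
    then have "{i\<in>{..<t}. a = i \<or> b = 0 \<and> a = nx i} = {a}" using a by auto
    then show ?thesis using False by simp
  qed
  finally show ?thesis .
qed

text \<open>Read off from the edge set and not from an ordering, so that two orderings of one cycle
  have the same hubs.\<close>

definition hubs :: "'a set set \<Rightarrow> 'a set" where
  "hubs C = {x\<in>V. hdegree C x = 2}"

lemma hubs_cyc:
  assumes v: "bij_betw v {..<n} V"
  shows "hubs (cyc v) = (\<lambda>i. v (i * l)) ` {..<t}"
proof
  have l0: "0 < l" using l_ge by simp
  show "(\<lambda>i. v (i * l)) ` {..<t} \<subseteq> hubs (cyc v)"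
    using hdegree_cyc[OF v _ l0] ordering_mem_V[OF v _ l0] unfolding hubs_def by auto
  show "hubs (cyc v) \<subseteq> (\<lambda>i. v (i * l)) ` {..<t}"
  proof
    fix x assume x: "x \<in> hubs (cyc v)"
    then obtain y where y: "y < n" "x = v y" using v unfolding hubs_def bij_betw_def by auto
    obtain i j where "i < t" "j < l" "y = i * l + j" using pos_cases[OF y(1)] .
    moreover then have "j = 0" using x y(2) hdegree_cyc[OF v] unfolding hubs_def by (auto split: if_splits)
    ultimately show "x \<in> (\<lambda>i. v (i * l)) ` {..<t}" using y by auto
  qed
qed

section \<open>The number of orderings that give one cycle\<close>

lemma hub_mem: "bij_betw v {..<n} V \<Longrightarrow> i < t \<Longrightarrow> v (i * l) \<in> hubs (cyc v)"
  using hubs_cyc by auto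

lemma inner_disjoint_hubs:
  assumes v: "bij_betw v {..<n} V" and i: "i < t"
  shows "inner v i \<inter> hubs (cyc v) = {}"
proof -
  have l0: "0 < l" using l_ge by simp
  show ?thesis unfolding hubs_cyc[OF v] using mem_inner_iff[OF v _ i l0] by auto
qed

text \<open>The hub number \<open>i\<close> of \<open>v\<close> is the hub number \<open>\<rho> i\<close> of \<open>u\<close>.\<close>

definition block_fibre :: "(nat \<Rightarrow> 'a) \<Rightarrow> (nat \<Rightarrow> nat) \<Rightarrow> (nat \<Rightarrow> 'a) set" where
  "block_fibre u \<rho> = {v \<in> orderings. \<forall>i<t. v (i * l) = u (\<rho> i * l) \<and> (\<exists>s<t. {\<rho> i, \<rho> (nx i)} = {s, nx s} \<and> inner v i = inner u s)}"

text \<open>Two orderings of one cycle have the same hubs, which yields the index map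
  \<open>\<rho>\<close>. Cutting a common edge into its hubs and the rest shows that
  \<open>\<rho>\<close> preserves adjacency and that the inner sets match. Conversely, matching hubs
  and inner sets make every edge of \<open>cyc v\<close> an edge of \<open>cyc u\<close>, and both
  cycles have \<open>t\<close> edges.\<close>

lemma fibre_cyc:
  assumes u: "u \<in> orderings"
  shows "{v\<in>orderings. cyc v = cyc u} = (\<Union>\<rho>\<in>dihedral. block_fibre u \<rho>)"
proof
  have bu: "bij_betw u {..<n} V" using u unfolding orderings_def by auto
  have l0: "0 < l" using l_ge by simp
  show "{v\<in>orderings. cyc v = cyc u} \<subseteq> (\<Union>\<rho>\<in>dihedral. block_fibre u \<rho>)"
  proof
    fix v assume "v \<in> {v\<in>orderings. cyc v = cyc u}"
    then have v: "v \<in> orderings" "cyc v = cyc u" by auto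
    have bv: "bij_betw v {..<n} V" using v unfolding orderings_def by auto
    have "\<exists>j<t. v (i * l) = u (j * l)" if "i < t" for i
      using hub_mem[OF bv that] hubs_cyc[OF bu] v(2) by auto
    then obtain f where f: "\<And>i. i < t \<Longrightarrow> f i < t \<and> v (i * l) = u (f i * l)" by metis
    define \<rho> where "\<rho> = restrict f {..<t}"
    have \<rho>: "\<rho> i < t" "v (i * l) = u (\<rho> i * l)" if "i < t" for i using f[OF that] that by (auto simp: \<rho>_def)
    have inj: "inj_on \<rho> {..<t}"
    proof (rule inj_onI)
      fix i j assume ij: "i \<in> {..<t}" "j \<in> {..<t}" "\<rho> i = \<rho> j"
      then have "v (i * l) = v (j * l)" using \<rho>(2) by simp
      then show "i = j" using ordering_pos_eq_iff[OF bv _ _ l0 l0, of i j] ij by simp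
    qed
    have ex: "\<exists>s<t. {\<rho> i, \<rho> (nx i)} = {s, nx s} \<and> inner v i = inner u s" if i: "i < t" for i
    proof -
      have "hedge v i \<in> cyc u" using i v(2) unfolding cyc_def by auto
      then obtain s where s: "s < t" "hedge v i = hedge u s" unfolding cyc_def by auto
      have D: "hubs (cyc v) = hubs (cyc u)" using v(2) by simp
      have hv: "hedge v i \<inter> hubs (cyc v) = {v (i * l), v (nx i * l)}" "hedge v i - hubs (cyc v) = inner v i"
        unfolding hedge_eq[OF i] using inner_disjoint_hubs[OF bv i] hub_mem[OF bv i] hub_mem[OF bv nx_less[OF i]] by auto
      have hu: "hedge u s \<inter> hubs (cyc u) = {u (s * l), u (nx s * l)}" "hedge u s - hubs (cyc u) = inner u s"
        unfolding hedge_eq[OF s(1)] using inner_disjoint_hubs[OF bu s(1)] hub_mem[OF bu s(1)] hub_mem[OF bu nx_less[OF s(1)]] by auto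
      have "{u (\<rho> i * l), u (\<rho> (nx i) * l)} = {u (s * l), u (nx s * l)}"
        using hv(1) hu(1) s(2) D \<rho>(2)[OF i] \<rho>(2)[OF nx_less[OF i]] by simp
      moreover have eqi: "u (a * l) = u (b * l) \<longleftrightarrow> a = b" if "a < t" "b < t" for a b
        using ordering_pos_eq_iff[OF bu that l0 l0] by simp
      ultimately have "{\<rho> i, \<rho> (nx i)} = {s, nx s}"
        using \<rho>(1)[OF i] \<rho>(1)[OF nx_less[OF i]] s(1) nx_less[OF s(1)] by (simp add: doubleton_eq_iff)
      then show ?thesis using s hv(2) hu(2) D by auto
    qed
    have "\<rho> \<in> dihedral" 
    proof -
      have "\<rho> \<in> {..<t} \<rightarrow>\<^sub>E {..<t}" using f by (auto simp: \<rho>_def)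
      then show ?thesis using inj ex unfolding dihedral_def by blast
    qed
    moreover have "v \<in> block_fibre u \<rho>" unfolding block_fibre_def using v(1) \<rho>(2) ex by auto
    ultimately show "v \<in> (\<Union>\<rho>\<in>dihedral. block_fibre u \<rho>)" by blast
  qed
  show "(\<Union>\<rho>\<in>dihedral. block_fibre u \<rho>) \<subseteq> {v\<in>orderings. cyc v = cyc u}"
  proof
    fix v assume "v \<in> (\<Union>\<rho>\<in>dihedral. block_fibre u \<rho>)"
    then obtain \<rho> where \<rho>: "\<rho> \<in> dihedral" "v \<in> block_fibre u \<rho>" by blast
    have v: "v \<in> orderings" using \<rho>(2) unfolding block_fibre_def by auto
    then have bv: "bij_betw v {..<n} V" unfolding orderings_def by auto
    have "hedge v i \<in> cyc u" if i: "i < t" for i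
    proof -
      have h: "v (i * l) = u (\<rho> i * l)" "v (nx i * l) = u (\<rho> (nx i) * l)"
        using \<rho>(2) i nx_less[OF i] unfolding block_fibre_def by auto
      obtain s where s: "s < t" "{\<rho> i, \<rho> (nx i)} = {s, nx s}" "inner v i = inner u s"
        using \<rho>(2) i unfolding block_fibre_def by auto
      have "hedge v i = {v (i * l), v (nx i * l)} \<union> inner v i" unfolding hedge_eq[OF i] by auto
      also have "{v (i * l), v (nx i * l)} = (\<lambda>a. u (a * l)) ` {\<rho> i, \<rho> (nx i)}" using h by simp
      also have "\<dots> \<union> inner v i = hedge u s" unfolding s(2,3) hedge_eq[OF s(1)] by auto
      finally show ?thesis using s(1) unfolding cyc_def by auto
    qed
    then have "cyc v \<subseteq> cyc u" unfolding cyc_def[of v] by auto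
    moreover have "finite (cyc u)" unfolding cyc_def by simp
    ultimately have "cyc v = cyc u" using card_cyc[OF bv] card_cyc[OF bu] by (simp add: card_subset_eq)
    then show "v \<in> {v\<in>orderings. cyc v = cyc u}" using v by simp
  qed
qed

lemma inner_eq_index:
  assumes "bij_betw u {..<n} V" "a < t" "b < t" "x \<in> inner u a" "x \<in> inner u b"
  shows "a = b"
proof -
  obtain j where j: "x = u (a * l + j)" "j < l" using assms(4) unfolding inner_def by auto
  show ?thesis using mem_inner_iff[OF assms(1-3) j(2)] assms(5) j(1) by simp
qed

text \<open>Once \<open>\<rho>\<close> is fixed, the hubs of \<open>v\<close> are forced and so are
  the sets filling its blocks; only the orders within these \<open>t\<close> sets of
  \<open>l - 1\<close> vertices are free.\<close>

lemma card_block_fibre: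
  assumes u: "u \<in> orderings" and \<rho>: "\<rho> \<in> dihedral"
  shows "card (block_fibre u \<rho>) = fact (l - 1) ^ t"
proof -
  have bu: "bij_betw u {..<n} V" using u unfolding orderings_def by auto
  have l0: "0 < l" using l_ge by simp
  have \<rho>t: "\<And>i. i < t \<Longrightarrow> \<rho> i < t" and \<rho>inj: "inj_on \<rho> {..<t}" using \<rho> unfolding dihedral_def by auto
  \<comment> \<open>\<open>\<tau> i\<close> is the edge of \<open>u\<close> that joins the hubs
    \<open>\<rho> i\<close> and \<open>\<rho> (nx i)\<close>: its index is \<open>\<rho> i\<close>
    for a rotation and \<open>\<rho> (nx i)\<close> for a reflection.\<close>
  obtain \<tau> where \<tau>: "\<And>i. i < t \<Longrightarrow> \<tau> i < t \<and> {\<rho> i, \<rho> (nx i)} = {\<tau> i, nx (\<tau> i)}"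
    using dihedralD[OF \<rho>] by metis
  have \<tau>inj: "i = i'" if i: "i < t" "i' < t" "\<tau> i = \<tau> i'" for i i'
  proof -
    have "\<rho> ` {i, nx i} = \<rho> ` {i', nx i'}" using \<tau>[OF i(1)] \<tau>[OF i(2)] i(3) by simp
    then have "{i, nx i} = {i', nx i'}"
      using inj_on_image_eq_iff[OF \<rho>inj, of "{i, nx i}" "{i', nx i'}"] i nx_less by simp
    then show ?thesis using nx_pair_eq i by blast
  qed
  have bf: "block_fibre u \<rho> = {v \<in> orderings. \<forall>i<t. v (i * l) = u (\<rho> i * l) \<and> inner v i = inner u (\<tau> i)}"
  proof -
    have "(\<exists>s<t. {\<rho> i, \<rho> (nx i)} = {s, nx s} \<and> inner v i = inner u s) \<longleftrightarrow> inner v i = inner u (\<tau> i)" if "i < t" for i v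
    proof
      assume "\<exists>s<t. {\<rho> i, \<rho> (nx i)} = {s, nx s} \<and> inner v i = inner u s"
      then obtain s where s: "s < t" "{\<rho> i, \<rho> (nx i)} = {s, nx s}" "inner v i = inner u s" by blast
      then have "s = \<tau> i" using \<tau>[OF that] by (intro nx_pair_eq) auto
      then show "inner v i = inner u (\<tau> i)" using s by simp
    qed (use \<tau>[OF that] in blast)
    then show ?thesis unfolding block_fibre_def by blast
  qed
  define B where "B i = {g \<in> {1..<l} \<rightarrow>\<^sub>E inner u (\<tau> i). bij_betw g {1..<l} (inner u (\<tau> i))}" for i
  let ?P = "\<Pi>\<^sub>E i\<in>{..<t}. B i"
  let ?f = "\<lambda>v. \<lambda>i\<in>{..<t}. \<lambda>j\<in>{1..<l}. v (i * l + j)"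
  let ?g = "\<lambda>h. \<lambda>x\<in>{..<n}. if x mod l = 0 then u (\<rho> (x div l) * l) else h (x div l) (x mod l)"
  have g: "?g h (i * l + j) = (if j = 0 then u (\<rho> i * l) else h i j)" if "i < t" "j < l" for h i j
    using pos_less[OF that] that by simp
  have "bij_betw ?f (block_fibre u \<rho>) ?P"
  proof (rule bij_betw_byWitness[where f' = ?g])
    show "\<forall>v\<in>block_fibre u \<rho>. ?g (?f v) = v"
    proof
      fix v assume v: "v \<in> block_fibre u \<rho>"
      show "?g (?f v) = v"
      proof (rule extensionalityI[of _ "{..<n}"])
        show "v \<in> extensional {..<n}" using v unfolding block_fibre_def orderings_def by (simp add: PiE_def)
        fix x assume "x \<in> {..<n}"
        then obtain i j where x: "i < t" "j < l" "x = i * l + j" using pos_cases[of x] by auto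
        show "?g (?f v) x = v x" unfolding x(3) g[OF x(1,2)] using v x unfolding bf by auto
      qed simp
    qed
    show "\<forall>h\<in>?P. ?f (?g h) = h"
    proof
      fix h assume h: "h \<in> ?P"
      show "?f (?g h) = h"
      proof (rule extensionalityI[of _ "{..<t}"])
        show "h \<in> extensional {..<t}" using h by (simp add: PiE_def)
        fix i assume i: "i \<in> {..<t}"
        have hi: "h i \<in> extensional {1..<l}" using PiE_mem[OF h i] unfolding B_def by (simp add: PiE_def)
        have "(\<lambda>j\<in>{1..<l}. ?g h (i * l + j)) = h i"
        proof (rule extensionalityI[OF _ hi])
          fix j assume j: "j \<in> {1..<l}"
          then have "?g h (i * l + j) = h i j" using g[of i j h] i by auto
          then show "(\<lambda>j\<in>{1..<l}. ?g h (i * l + j)) j = h i j" using j by (simp only: restrict_apply' )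
        qed simp
        then show "?f (?g h) i = h i" using i by (simp only: restrict_apply')
      qed simp
    qed
    show "?f ` block_fibre u \<rho> \<subseteq> ?P"
    proof (rule image_subsetI)
      fix v assume v: "v \<in> block_fibre u \<rho>"
      have bv: "bij_betw v {..<n} V" using v unfolding block_fibre_def orderings_def by auto
      have "(\<lambda>j\<in>{1..<l}. v (i * l + j)) \<in> B i" if i: "i < t" for i
      proof -
        have "inj_on (\<lambda>j. v (i * l + j)) {1..<l}" using ordering_pos_eq_iff[OF bv i i] by (auto simp: inj_on_def)
        moreover have "(\<lambda>j. v (i * l + j)) ` {1..<l} = inner u (\<tau> i)" using v i unfolding bf inner_def by auto
        ultimately have "bij_betw (\<lambda>j. v (i * l + j)) {1..<l} (inner u (\<tau> i))" by (simp add: bij_betw_def)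
        then show ?thesis
          unfolding B_def using bij_betw_apply[of "\<lambda>j. v (i * l + j)" "{1..<l}" "inner u (\<tau> i)"] by auto
      qed
      then show "?f v \<in> ?P" by (intro restrict_PiE_iff[THEN iffD2]) simp
    qed
    show "?g ` ?P \<subseteq> block_fibre u \<rho>"
    proof (rule image_subsetI)
      fix h assume h: "h \<in> ?P"
      define v where "v = ?g h"
      have vg: "v (i * l + j) = (if j = 0 then u (\<rho> i * l) else h i j)" if "i < t" "j < l" for i j
        unfolding v_def by (rule g[OF that])
      have hb: "bij_betw (h i) {1..<l} (inner u (\<tau> i))" if "i < t" for i
        using PiE_mem[OF h, of i] that unfolding B_def by simp
      have hm: "h i j \<in> inner u (\<tau> i)" if "i < t" "j < l" "j \<noteq> 0" for i j
        using bij_betw_apply[OF hb[OF that(1)], of j] that by simp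
      have hub: "u (\<rho> i * l) \<in> hubs (cyc u)" if "i < t" for i using hub_mem[OF bu \<rho>t[OF that]] .
      have nhub: "h i j \<notin> hubs (cyc u)" if "i < t" "j < l" "j \<noteq> 0" for i j
        using hm[OF that] inner_disjoint_hubs[OF bu, of "\<tau> i"] \<tau>[OF that(1)] by blast
      have inV: "v x \<in> V" if xn: "x < n" for x
      proof -
        obtain i j where x: "i < t" "j < l" "x = i * l + j" using pos_cases[OF xn] .
        have "inner u (\<tau> i) \<subseteq> V" using \<tau>[OF x(1)] ordering_mem_V[OF bu, of "\<tau> i"] unfolding inner_def by auto
        then show ?thesis using vg[OF x(1,2)] hm[OF x(1,2)] hub[OF x(1)] x(3) unfolding hubs_def by auto
      qed
      \<comment> \<open>Hubs and inner vertices of \<open>u\<close> never coincide, so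
        \<open>v x = v y\<close> compares either two hubs, settled by injectivity of
        \<open>\<rho>\<close>, or two inner vertices, whose block is settled by injectivity of
        \<open>\<tau>\<close> and whose place by the bijection \<open>h i\<close>.\<close>
      have inj: "inj_on v {..<n}"
      proof (rule inj_onI)
        fix x y assume xy: "x \<in> {..<n}" "y \<in> {..<n}" "v x = v y"
        obtain i j where x: "i < t" "j < l" "x = i * l + j" using pos_cases[of x] xy by auto
        obtain i' j' where y: "i' < t" "j' < l" "y = i' * l + j'" using pos_cases[of y] xy by auto
        have e: "v (i * l + j) = v (i' * l + j')" using xy x y by simp
        show "x = y"
        proof (cases "j = 0")
          case True
          then have j': "j' = 0" using e vg[OF x(1,2)] vg[OF y(1,2)] hub[OF x(1)] nhub[OF y(1,2)] by (auto split: if_splits)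
          have "u (\<rho> i * l) = u (\<rho> i' * l)" using e True j' vg[OF x(1,2)] vg[OF y(1,2)] by simp
          then have "\<rho> i = \<rho> i'" using ordering_pos_eq_iff[OF bu \<rho>t[OF x(1)] \<rho>t[OF y(1)] l0 l0] by simp
          then have "i = i'" using \<rho>inj x y by (simp add: inj_on_def)
          then show ?thesis using x y True j' by simp
        next
          case False
          then have j': "j' \<noteq> 0" using e vg[OF x(1,2)] vg[OF y(1,2)] hub[OF y(1)] nhub[OF x(1,2)] by (auto split: if_splits)
          have hh: "h i j = h i' j'" using e False j' vg[OF x(1,2)] vg[OF y(1,2)] by simp
          have "\<tau> i = \<tau> i'"
            using inner_eq_index[OF bu, of "\<tau> i" "\<tau> i'"] \<tau>[OF x(1)] \<tau>[OF y(1)] hm[OF x(1,2) False] hm[OF y(1,2) j'] hh by simp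
          then have ii: "i = i'" using \<tau>inj x y by simp
          then have "j = j'" using hb[OF x(1)] hh x(2) y(2) False j' by (auto simp: bij_betw_def inj_on_def)
          then show ?thesis using x y ii by simp
        qed
      qed
      have "v ` {..<n} = V"
        using inV inj card_V finite_V by (intro card_subset_eq) (auto simp: card_image)
      then have "bij_betw v {..<n} V" using inj by (simp add: bij_betw_def)
      moreover have "v \<in> {..<n} \<rightarrow>\<^sub>E V" using inV unfolding v_def by auto
      ultimately have vo: "v \<in> orderings" unfolding orderings_def by simp
      have "v (i * l) = u (\<rho> i * l) \<and> inner v i = inner u (\<tau> i)" if i: "i < t" for i
      proof
        show "v (i * l) = u (\<rho> i * l)" using vg[OF i l0] by simp
        have "inner v i = h i ` {1..<l}" unfolding inner_def using vg[OF i] by (intro image_cong) auto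
        then show "inner v i = inner u (\<tau> i)" using hb[OF i] by (simp add: bij_betw_def)
      qed
      then show "?g h \<in> block_fibre u \<rho>" using vo unfolding bf v_def by blast
    qed
  qed
  then have "card (block_fibre u \<rho>) = card ?P" by (rule bij_betw_same_card)
  also have "\<dots> = (\<Prod>i<t. card (B i))" by (rule card_PiE) simp
  also have "\<dots> = (\<Prod>i<t. fact (l - 1))"
  proof (rule prod.cong[OF refl])
    fix i assume "i \<in> {..<t}"
    then have ti: "\<tau> i < t" using \<tau> by simp
    have fin: "finite (inner u (\<tau> i))" unfolding inner_def by simp
    have "card (inner u (\<tau> i)) = l - 1"
      unfolding inner_def using ordering_pos_eq_iff[OF bu ti ti] by (subst card_image) (auto simp: inj_on_def)
    then show "card (B i) = fact (l - 1)"
      unfolding B_def using card_bijections[of "{1..<l}" "inner u (\<tau> i)"] fin by simp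
  qed
  finally show ?thesis by simp
qed

lemma finite_orderings: "finite orderings"
  unfolding orderings_def by (intro finite_bijections finite_V) simp

text \<open>The block fibres are disjoint because \<open>v\<close> determines \<open>\<rho>\<close>
  through its hubs.\<close>

lemma card_fibre_cyc:
  assumes u: "u \<in> orderings"
  shows "card {v\<in>orderings. cyc v = cyc u} = 2 * t * fact (l - 1) ^ t"
proof -
  have bu: "bij_betw u {..<n} V" using u unfolding orderings_def by auto
  have l0: "0 < l" using l_ge by simp
  have "card (\<Union>\<rho>\<in>dihedral. block_fibre u \<rho>) = (\<Sum>\<rho>\<in>dihedral. card (block_fibre u \<rho>))"
  proof (rule card_UN_disjoint)
    show "finite dihedral" using card_dihedral t_ge by (intro card_ge_0_finite) simp
    show "\<forall>\<rho>\<in>dihedral. finite (block_fibre u \<rho>)"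
      using finite_orderings unfolding block_fibre_def by auto
    show "\<forall>\<rho>\<in>dihedral. \<forall>\<sigma>\<in>dihedral. \<rho> \<noteq> \<sigma> \<longrightarrow> block_fibre u \<rho> \<inter> block_fibre u \<sigma> = {}"
    proof (intro ballI impI, rule ccontr)
      fix \<rho> \<sigma> assume d: "\<rho> \<in> dihedral" "\<sigma> \<in> dihedral" "\<rho> \<noteq> \<sigma>" and ne: "block_fibre u \<rho> \<inter> block_fibre u \<sigma> \<noteq> {}"
      then obtain v where v: "v \<in> block_fibre u \<rho>" "v \<in> block_fibre u \<sigma>" by auto
      have "\<rho> i = \<sigma> i" if i: "i < t" for i
      proof -
        have "\<rho> i < t" "\<sigma> i < t" using d i unfolding dihedral_def by auto
        moreover have "u (\<rho> i * l) = u (\<sigma> i * l)" using v i unfolding block_fibre_def by auto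
        ultimately show ?thesis using ordering_pos_eq_iff[OF bu _ _ l0 l0] by simp
      qed
      then have "\<rho> = \<sigma>" using d(1,2) unfolding dihedral_def
        by (intro extensionalityI[of _ "{..<t}"]) (auto simp: PiE_def)
      then show False using d(3) by simp
    qed
  qed
  then show ?thesis unfolding fibre_cyc[OF u] using card_block_fibre[OF u] card_dihedral by simp
qed

lemma card_cycles: "card (cyc ` orderings) * (2 * t * fact (l - 1) ^ t) = fact n"
proof -
  have "card orderings = (\<Sum>C\<in>cyc ` orderings. card {v\<in>orderings. cyc v = C})"
    using sum.image_gen[OF finite_orderings, of "\<lambda>_. 1::nat" cyc] by simp
  also have "\<dots> = (\<Sum>C\<in>cyc ` orderings. 2 * t * fact (l - 1) ^ t)"
    using card_fibre_cyc by (intro sum.cong) auto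
  finally show ?thesis using card_orderings by simp
qed

text \<open>The bijection in the definition is arbitrary outside \<open>{..<n}\<close>; cutting it
  down to an extensional function leaves the edges unchanged, as indices are taken modulo
  \<open>n\<close>. The cardinality clause is \<open>card_cyc\<close>.\<close>

lemma loose_Hamilton_cycle_iff: "loose_Hamilton_cycle V (Suc l) C \<longleftrightarrow> C \<in> cyc ` orderings"
proof -
  have td: "n div l = t" using n_eq l_ge by simp
  have cv: "(\<lambda>i. (\<lambda>j. v ((i * (Suc l - 1) + j) mod card V)) ` {0..Suc l - 1}) ` {..<card V div (Suc l - 1)} = cyc v" for v
    unfolding card_V cyc_def hedge_def by (simp add: td)
  have n0: "n > 0" using n_eq t_ge l_ge by simp
  show ?thesis
  proof
    assume "loose_Hamilton_cycle V (Suc l) C"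
    then obtain v where v: "bij_betw v {..<n} V" "C = cyc v"
      unfolding loose_Hamilton_cycle_def cv unfolding card_V by blast
    have "cyc (restrict v {..<n}) = cyc v" unfolding cyc_def hedge_def using n0 by simp
    moreover have "restrict v {..<n} \<in> orderings"
      unfolding orderings_def using v(1) by (auto simp: bij_betw_apply)
    ultimately show "C \<in> cyc ` orderings" using v(2) by (metis imageI)
  next
    assume "C \<in> cyc ` orderings"
    then obtain v where v: "bij_betw v {..<n} V" "C = cyc v" unfolding orderings_def by auto
    have "card C = t" using v card_cyc by simp
    moreover have "l dvd n" unfolding n_eq by simp
    ultimately show "loose_Hamilton_cycle V (Suc l) C"
      unfolding loose_Hamilton_cycle_def cv unfolding card_V using v td by auto
  qed
qed

end

text \<open>Linearity of expectation, as an interchange of finite sums. Nonemptiness makes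
  \<open>pmf_of_set\<close> the uniform distribution; it is later read off from the positive value
  of the count of regular hypergraphs.\<close>

lemma expectation_eq_sum_over_cycles:
  assumes "hypergraphs_avoiding {..<n} (\<lambda>_. k) r {} \<noteq> {}"
  shows "expected_loose_Hamilton_cycles r k n =
    (\<Sum>C\<in>{C. loose_Hamilton_cycle {..<n} r C}. real (card {H\<in>regular_uniform_hypergraphs {..<n} r k. C \<subseteq> H}))
      / real (card (hypergraphs_avoiding {..<n} (\<lambda>_. k) r {}))"
proof -
  let ?G = "regular_uniform_hypergraphs {..<n} r k" and ?Y = "{C. loose_Hamilton_cycle {..<n} r C}"
  have G: "?G = hypergraphs_avoiding {..<n} (\<lambda>_. k) r {}"
    unfolding regular_uniform_hypergraphs_def hypergraphs_avoiding_def by auto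
  have sub: "?G \<subseteq> Pow (Pow {..<n})" unfolding regular_uniform_hypergraphs_def by auto
  then have finG: "finite ?G" by (rule finite_subset) simp
  have "?Y \<subseteq> Pow (Pow {..<n})"
  proof
    fix C assume "C \<in> ?Y"
    then obtain v where v: "bij_betw v {..<n} {..<n}"
      "C = (\<lambda>i. (\<lambda>j. v ((i * (r - 1) + j) mod n)) ` {0..r - 1}) ` {..<n div (r - 1)}"
      unfolding loose_Hamilton_cycle_def by auto
    show "C \<in> Pow (Pow {..<n})"
    proof (cases "n = 0")
      case False
      then have "v (x mod n) \<in> {..<n}" for x using bij_betw_apply[OF v(1), of "x mod n"] by simp
      then show ?thesis unfolding v(2) by blast
    qed (simp add: v(2))
  qed
  then have finY: "finite ?Y" by (rule finite_subset) simp
  have "expected_loose_Hamilton_cycles r k n = (\<Sum>H\<in>?G. real (card {C. C \<subseteq> H \<and> loose_Hamilton_cycle {..<n} r C})) / real (card ?G)"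
    unfolding expected_loose_Hamilton_cycles_def num_loose_Hamilton_cycles_def
    using assms finG by (subst integral_pmf_of_set) (auto simp: G)
  also have "(\<Sum>H\<in>?G. real (card {C. C \<subseteq> H \<and> loose_Hamilton_cycle {..<n} r C})) = (\<Sum>H\<in>?G. \<Sum>C\<in>?Y. if C \<subseteq> H then 1 else 0)"
  proof (rule sum.cong[OF refl])
    fix H
    have "{C. C \<subseteq> H \<and> loose_Hamilton_cycle {..<n} r C} = ?Y \<inter> {C. C \<subseteq> H}" by auto
    then show "real (card {C. C \<subseteq> H \<and> loose_Hamilton_cycle {..<n} r C}) = (\<Sum>C\<in>?Y. if C \<subseteq> H then 1 else 0)"
      using finY by (simp add: sum.If_cases)
  qed
  also have "\<dots> = (\<Sum>C\<in>?Y. \<Sum>H\<in>?G. if C \<subseteq> H then 1 else 0)" by (rule sum.swap)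
  also have "\<dots> = (\<Sum>C\<in>?Y. real (card {H\<in>?G. C \<subseteq> H}))"
    using finG by (simp add: sum.If_cases Int_def)
  finally show ?thesis by (simp only: G)
qed

section \<open>Hypergraphs that contain a given cycle\<close>

lemma hdegree_Un_disjoint:
  assumes "finite A" "finite B" "A \<inter> B = {}"
  shows "hdegree (A \<union> B) x = hdegree A x + hdegree B x"
proof -
  have "{e \<in> A \<union> B. x \<in> e} = {e \<in> A. x \<in> e} \<union> {e \<in> B. x \<in> e}" by auto
  moreover have "{e \<in> A. x \<in> e} \<inter> {e \<in> B. x \<in> e} = {}" using assms(3) by blast
  ultimately show ?thesis
    unfolding hdegree_def using assms(1,2) card_Un_disjoint[of "{e \<in> A. x \<in> e}" "{e \<in> B. x \<in> e}"] by simp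
qed

text \<open>Deleting \<open>C\<close> and adding it back are inverse to each other because
  \<open>H - C\<close> avoids \<open>C\<close>; disjointness also makes the degrees add.\<close>

lemma card_hypergraphs_containing:
  assumes V: "finite V" and C: "\<And>e. e \<in> C \<Longrightarrow> e \<subseteq> V \<and> card e = r"
    and dC: "\<And>x. x \<in> V \<Longrightarrow> hdegree C x + d x = k"
  shows "card {H\<in>regular_uniform_hypergraphs V r k. C \<subseteq> H} = card (hypergraphs_avoiding V d r C)"
proof (rule bij_betw_same_card[of "\<lambda>H. H - C"], rule bij_betw_byWitness[where f' = "\<lambda>H. H \<union> C"])
  have fin: "finite H" if "\<And>e. e \<in> H \<Longrightarrow> e \<subseteq> V \<and> card e = r" for H
    using sum_hdegree(1)[OF V that] by blast
  show "\<forall>H\<in>{H\<in>regular_uniform_hypergraphs V r k. C \<subseteq> H}. H - C \<union> C = H" by auto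
  show "\<forall>H\<in>hypergraphs_avoiding V d r C. H \<union> C - C = H" unfolding hypergraphs_avoiding_def by auto
  show "(\<lambda>H. H - C) ` {H\<in>regular_uniform_hypergraphs V r k. C \<subseteq> H} \<subseteq> hypergraphs_avoiding V d r C"
  proof (rule image_subsetI)
    fix H assume "H \<in> {H\<in>regular_uniform_hypergraphs V r k. C \<subseteq> H}"
    then have H: "\<And>e. e \<in> H \<Longrightarrow> e \<subseteq> V \<and> card e = r" "\<And>x. x \<in> V \<Longrightarrow> hdegree H x = k" "C \<subseteq> H"
      unfolding regular_uniform_hypergraphs_def by auto
    have "hdegree (H - C) x = d x" if "x \<in> V" for x
    proof -
      have "H = (H - C) \<union> C" using H(3) by auto
      then have "hdegree H x = hdegree (H - C) x + hdegree C x"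
        using hdegree_Un_disjoint[of "H - C" C x] fin[OF H(1)] fin[OF C] by auto
      then show ?thesis using H(2)[OF that] dC[OF that] by simp
    qed
    then show "H - C \<in> hypergraphs_avoiding V d r C" unfolding hypergraphs_avoiding_def using H(1) by auto
  qed
  show "(\<lambda>H. H \<union> C) ` hypergraphs_avoiding V d r C \<subseteq> {H\<in>regular_uniform_hypergraphs V r k. C \<subseteq> H}"
  proof (rule image_subsetI)
    fix H assume "H \<in> hypergraphs_avoiding V d r C"
    then have H: "\<And>e. e \<in> H \<Longrightarrow> e \<subseteq> V \<and> card e = r" "\<And>x. x \<in> V \<Longrightarrow> hdegree H x = d x" "H \<inter> C = {}"
      unfolding hypergraphs_avoiding_def by auto
    have "hdegree (H \<union> C) x = k" if "x \<in> V" for x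
      using hdegree_Un_disjoint[OF fin[OF H(1)] fin[OF C] H(3)] H(2)[OF that] dC[OF that] by simp
    then show "H \<union> C \<in> {H\<in>regular_uniform_hypergraphs V r k. C \<subseteq> H}"
      unfolding regular_uniform_hypergraphs_def using H(1) C by blast
  qed
qed

context loose_cycle_count begin

lemma card_hubs:
  assumes v: "bij_betw v {..<n} V"
  shows "card (hubs (cyc v)) = t" "hubs (cyc v) \<subseteq> V"
proof -
  have l0: "0 < l" using l_ge by simp
  have "inj_on (\<lambda>i. v (i * l)) {..<t}"
    using ordering_pos_eq_iff[OF v _ _ l0 l0] by (auto simp: inj_on_def)
  then show "card (hubs (cyc v)) = t" unfolding hubs_cyc[OF v] by (simp add: card_image)
  show "hubs (cyc v) \<subseteq> V" unfolding hubs_def by auto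
qed

lemma hdegree_cyc_hubs:
  assumes v: "bij_betw v {..<n} V" and x: "x \<in> V"
  shows "hdegree (cyc v) x = (if x \<in> hubs (cyc v) then 2 else 1)"
proof -
  obtain y where y: "y < n" "x = v y" using v x by (auto simp: bij_betw_def)
  obtain i j where ij: "i < t" "j < l" "y = i * l + j" using pos_cases[OF y(1)] .
  have "hdegree (cyc v) x = 2 \<or> hdegree (cyc v) x = 1" using hdegree_cyc[OF v ij(1,2)] y(2) ij(3) by auto
  then show ?thesis using x unfolding hubs_def by auto
qed

text \<open>The degrees that remain to be filled once the cycle is removed. Under
  \<open>2 \<le> k\<close> the subtractions are exact.\<close>

definition residual :: "nat \<Rightarrow> (nat \<Rightarrow> 'a) \<Rightarrow> 'a \<Rightarrow> nat" where
  "residual k v x = (if x \<in> hubs (cyc v) then k - 2 else k - 1)"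

lemma residual_split:
  assumes v: "bij_betw v {..<n} V"
  shows "V = hubs (cyc v) \<union> (V - hubs (cyc v))" "card (V - hubs (cyc v)) = n - t" 
    "finite (hubs (cyc v))" "finite (V - hubs (cyc v))"
proof -
  show "V = hubs (cyc v) \<union> (V - hubs (cyc v))" using card_hubs[OF v] by auto
  show f: "finite (hubs (cyc v))" using card_hubs(2)[OF v] finite_V by (rule finite_subset)
  show "finite (V - hubs (cyc v))" using finite_V by simp
  have "card (V - hubs (cyc v)) = card V - card (hubs (cyc v))" by (rule card_Diff_subset[OF f card_hubs(2)[OF v]])
  then show "card (V - hubs (cyc v)) = n - t" by (simp only: card_V card_hubs(1)[OF v])
qed

lemma prod_residual:
  assumes v: "bij_betw v {..<n} V"
  shows "(\<Prod>x\<in>V. fact (residual k v x) :: real) = fact (k - 2) ^ t * fact (k - 1) ^ (n - t)"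
proof -
  note s = residual_split[OF v]
  have "(\<Prod>x\<in>V. fact (residual k v x) :: real)
    = (\<Prod>x\<in>hubs (cyc v). fact (residual k v x)) * (\<Prod>x\<in>V - hubs (cyc v). fact (residual k v x))"
    using s by (subst s(1), subst prod.union_disjoint) auto
  also have "\<dots> = (\<Prod>x\<in>hubs (cyc v). fact (k - 2)) * (\<Prod>x\<in>V - hubs (cyc v). fact (k - 1))"
    by (intro arg_cong2[where f = "(*)"] prod.cong) (auto simp: residual_def)
  finally show ?thesis using card_hubs[OF v] s by simp
qed

lemma falling_sum_residual:
  assumes v: "bij_betw v {..<n} V" and k: "2 \<le> k"
  shows "falling_sum V (residual k v) = real t * ((real k - 2) * (real k - 3)) + real (n - t) * ((real k - 1) * (real k - 2))"
proof -
  note s = residual_split[OF v]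
  let ?f = "\<lambda>x. real (residual k v x) * (real (residual k v x) - 1)"
  have "falling_sum V (residual k v) = sum ?f (hubs (cyc v)) + sum ?f (V - hubs (cyc v))"
    unfolding falling_sum_def using s by (subst s(1), subst sum.union_disjoint) auto
  also have "\<dots> = (\<Sum>x\<in>hubs (cyc v). (real k - 2) * (real k - 3)) + (\<Sum>x\<in>V - hubs (cyc v). (real k - 1) * (real k - 2))"
    using k by (intro arg_cong2[where f = "(+)"] sum.cong) (auto simp: residual_def of_nat_diff)
  finally show ?thesis using card_hubs[OF v] s by simp
qed

lemma card_containing_cyc:
  assumes v: "bij_betw v {..<n} V" and k: "2 \<le> k"
  shows "card {H\<in>regular_uniform_hypergraphs V (Suc l) k. cyc v \<subseteq> H} = card (hypergraphs_avoiding V (residual k v) (Suc l) (cyc v))"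
proof (rule card_hypergraphs_containing[OF finite_V])
  show "e \<subseteq> V \<and> card e = Suc l" if "e \<in> cyc v" for e using that card_hedge[OF v] unfolding cyc_def by auto
  show "hdegree (cyc v) x + residual k v x = k" if "x \<in> V" for x
    using hdegree_cyc_hubs[OF v that] k unfolding residual_def by (cases "x \<in> hubs (cyc v)") simp_all
qed

lemma sum_residual:
  assumes v: "bij_betw v {..<n} V" and k: "2 \<le> k"
  shows "(\<Sum>x\<in>V. residual k v x) + Suc l * t = k * n"
proof -
  have "(\<Sum>x\<in>V. hdegree (cyc v) x) = Suc l * card (cyc v)"
    using card_hedge[OF v] by (intro sum_hdegree(2)[OF finite_V]) (auto simp: cyc_def)
  then have "(\<Sum>x\<in>V. residual k v x) + Suc l * t = (\<Sum>x\<in>V. residual k v x + hdegree (cyc v) x)"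
    unfolding card_cyc[OF v] sum.distrib by simp
  also have "\<dots> = (\<Sum>x\<in>V. k)"
  proof (rule sum.cong[OF refl])
    fix x assume "x \<in> V"
    then show "residual k v x + hdegree (cyc v) x = k"
      using hdegree_cyc_hubs[OF v] k unfolding residual_def by (cases "x \<in> hubs (cyc v)") simp_all
  qed
  finally show ?thesis using card_V by simp
qed

text \<open>\<open>m = k n / r - t\<close> edges remain. The main term and the error bound are the
  same for every ordering \<open>v\<close>, since the residual degrees differ only in which vertices
  are the hubs.\<close>

lemma count_containing_cyc:
  assumes v: "bij_betw v {..<n} V" and k: "2 \<le> k" and kn: "k * n = m * Suc l + Suc l * t"
    and m: "64 * k ^ 3 * Suc l \<le> m"
  obtains \<theta> where "\<bar>\<theta>\<bar> \<le> 60 * real k ^ 3 * real (Suc l) / real m"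
    "real (card {H\<in>regular_uniform_hypergraphs V (Suc l) k. cyc v \<subseteq> H}) =
      fact (m * Suc l) / (fact m * fact (Suc l) ^ m * (fact (k - 2) ^ t * fact (k - 1) ^ (n - t)))
        * exp (- real l * (real t * ((real k - 2) * (real k - 3)) + real (n - t) * ((real k - 1) * (real k - 2)))
             / (2 * real (m * Suc l)) + \<theta>)"
proof -
  have d: "residual k v x \<le> k" if "x \<in> V" for x unfolding residual_def by simp
  have sm: "(\<Sum>x\<in>V. residual k v x) = m * Suc l" using sum_residual[OF v k] kn by simp
  have r3: "3 \<le> Suc l" using l_ge by simp
  have k1: "1 \<le> k" using k by simp
  have X: "e \<subseteq> V \<and> card e = Suc l" if "e \<in> cyc v" for e using that card_hedge[OF v] unfolding cyc_def by auto
  \<comment> \<open>\<open>m r = (k - 1) t l - t \<ge> t l - t \<ge> t\<close>, so the cycle is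
    small enough to serve as the forbidden set.\<close>
  have cX: "card (cyc v) \<le> m * Suc l"
  proof -
    have "m * Suc l + (t * l + t) = k * (t * l)" using kn n_eq by (simp add: algebra_simps)
    moreover have "2 * (t * l) \<le> k * (t * l)" using k by (intro mult_right_mono) auto
    moreover have "t * 2 \<le> t * l" using l_ge by (intro mult_left_mono) auto
    ultimately show ?thesis unfolding card_cyc[OF v] by linarith
  qed
  obtain \<theta> where \<theta>: "\<bar>\<theta>\<bar> \<le> 60 * real k ^ 3 * real (Suc l) / real m"
    "real (card (hypergraphs_avoiding V (residual k v) (Suc l) (cyc v))) =
      fact (m * Suc l) / (fact m * fact (Suc l) ^ m * (\<Prod>x\<in>V. fact (residual k v x)))
        * exp (- (real (Suc l) - 1) * falling_sum V (residual k v) / (2 * real (m * Suc l)) + \<theta>)"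
    using hypergraph_count[OF finite_V d sm r3 k1 m X cX] by blast
  show ?thesis
    using that[OF \<theta>(1)] \<theta>(2) unfolding card_containing_cyc[OF v k] prod_residual[OF v] falling_sum_residual[OF v k] by simp
qed

end

lemma count_regular:
  assumes k: "2 \<le> k" and kn: "k * n = m * Suc l" and l: "2 \<le> l" and m: "64 * k ^ 3 * Suc l \<le> m" and n: "0 < n"
  obtains \<theta> where "\<bar>\<theta>\<bar> \<le> 60 * real k ^ 3 * real (Suc l) / real m"
    "real (card (hypergraphs_avoiding {..<n} (\<lambda>_. k) (Suc l) {})) =
      fact (m * Suc l) / (fact m * fact (Suc l) ^ m * fact k ^ n) * exp (- real l * (real k - 1) / 2 + \<theta>)"
proof -
  have r3: "3 \<le> Suc l" using l by simp
  have k1: "1 \<le> k" using k by simp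
  have sm: "(\<Sum>x<n. k) = m * Suc l" using kn by (simp add: mult.commute)
  obtain \<theta> where \<theta>: "\<bar>\<theta>\<bar> \<le> 60 * real k ^ 3 * real (Suc l) / real m"
    "real (card (hypergraphs_avoiding {..<n} (\<lambda>_. k) (Suc l) {})) =
      fact (m * Suc l) / (fact m * fact (Suc l) ^ m * (\<Prod>x<n. fact k))
        * exp (- (real (Suc l) - 1) * falling_sum {..<n} (\<lambda>_. k) / (2 * real (m * Suc l)) + \<theta>)"
    using hypergraph_count[OF finite_lessThan _ sm r3 k1 m, of "{}"] by auto
  \<comment> \<open>All degrees equal \<open>k\<close> and \<open>k n = m r\<close>, so the falling
    sum divided by \<open>m r\<close> is exactly \<open>k - 1\<close>.\<close>
  have "falling_sum {..<n} (\<lambda>_. k) = real (m * Suc l) * (real k - 1)"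
    unfolding falling_sum_def using kn[symmetric] by (simp add: mult.commute mult.left_commute)
  moreover have "c > 0 \<Longrightarrow> - (real (Suc l) - 1) * (c * (real k - 1)) / (2 * c) = - real l * (real k - 1) / 2" for c :: real
    by (simp add: field_simps)
  moreover have "real (m * Suc l) > 0" unfolding kn[symmetric] using k n by simp
  ultimately have "- (real (Suc l) - 1) * falling_sum {..<n} (\<lambda>_. k) / (2 * real (m * Suc l)) = - real l * (real k - 1) / 2"
    by (simp only:)
  then show ?thesis using that[OF \<theta>(1)] \<theta>(2) by simp
qed

section \<open>Stirling's formula with an error bound\<close>

text \<open>Chosen for \<open>x = 1 / n\<close>: multiplied by \<open>n + 1 / 2\<close>, the lower
  bound becomes exactly 1 and the upper one \<open>1 + 1 / (4 n (n + 1))\<close>, whose excess over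
  1 telescopes. Both hold with equality at 0 and follow by comparing derivatives.\<close>

lemma ln_one_plus_rational_bounds:
  fixes x :: real
  assumes "x \<ge> 0"
  shows "2 * x / (2 + x) \<le> ln (1 + x)" and "ln (1 + x) \<le> x * (x + 2) / (2 * (x + 1))"
proof -
  have "ln (1 + 0) - 2 * 0 / (2 + 0) \<le> ln (1 + x) - 2 * x / (2 + x)"
  proof (rule DERIV_nonneg_imp_nondecreasing[OF assms])
    fix t :: real assume t: "0 \<le> t" "t \<le> x"
    have "((\<lambda>t. ln (1 + t) - 2 * t / (2 + t)) has_real_derivative (1 / (1 + t) - 4 / (2 + t)\<^sup>2)) (at t)"
      using t by (auto intro!: derivative_eq_intros simp: field_simps power2_eq_square)
    moreover have "1 / (1 + t) - 4 / (2 + t)\<^sup>2 \<ge> 0"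
    proof -
      have "4 * (1 + t) \<le> (2 + t)\<^sup>2" by (simp add: power2_eq_square algebra_simps)
      then show ?thesis using t by (simp add: field_simps)
    qed
    ultimately show "\<exists>y. ((\<lambda>t. ln (1 + t) - 2 * t / (2 + t)) has_real_derivative y) (at t) \<and> 0 \<le> y" by blast
  qed
  then show "2 * x / (2 + x) \<le> ln (1 + x)" by simp
  have "(0 + 1) / 2 - 1 / (0 + 1) / 2 - ln (1 + 0) \<le> (x + 1) / 2 - 1 / (x + 1) / 2 - ln (1 + x)"
  proof (rule DERIV_nonneg_imp_nondecreasing[OF assms])
    fix t :: real assume t: "0 \<le> t" "t \<le> x"
    have "((\<lambda>t. (t + 1) / 2 - 1 / (t + 1) / 2 - ln (1 + t)) has_real_derivative (1 / 2 + 1 / (2 * (t + 1)\<^sup>2) - 1 / (1 + t))) (at t)"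
    proof -
      have "t * 2 + 2 \<noteq> 0" "t + 1 \<noteq> 0" using t by auto
      then show ?thesis
        using t by (auto intro!: derivative_eq_intros simp: power2_eq_square) (subst frac_eq_eq, simp, simp, simp add: algebra_simps)
    qed
    moreover have "1 / 2 + 1 / (2 * (t + 1)\<^sup>2) - 1 / (1 + t) = t\<^sup>2 / (2 * (t + 1)\<^sup>2)"
      using t by (simp add: divide_simps) (simp add: power2_eq_square algebra_simps)
    then have "1 / 2 + 1 / (2 * (t + 1)\<^sup>2) - 1 / (1 + t) \<ge> 0" by simp
    ultimately show "\<exists>y. ((\<lambda>t. (t + 1) / 2 - 1 / (t + 1) / 2 - ln (1 + t)) has_real_derivative y) (at t) \<and> 0 \<le> y" by blast
  qed
  moreover have "(x + 1) / 2 - 1 / (x + 1) / 2 = x * (x + 2) / (2 * (x + 1))"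
    using assms by (simp add: field_simps)
  ultimately show "ln (1 + x) \<le> x * (x + 2) / (2 * (x + 1))" by simp
qed

text \<open>It converges to \<open>ln (2 pi) / 2\<close>; this constant is left out until Wallis'
  product identifies it.\<close>

definition stirling_error :: "nat \<Rightarrow> real" where
  "stirling_error n = ln (fact n) - ((real n + 1 / 2) * ln (real n) - real n)"

lemma stirling_error_step:
  assumes "n \<ge> 1"
  shows "stirling_error (Suc n) \<le> stirling_error n"
    and "stirling_error n - stirling_error (Suc n) \<le> 1 / (4 * real n) - 1 / (4 * real (Suc n))"
proof -
  define x where "x = 1 / real n"
  have n: "real n \<ge> 1" using assms by simp
  have x: "x > 0" using n by (simp add: x_def)
  have l: "ln (1 + x) = ln (real (Suc n)) - ln (real n)"
  proof -
    have "1 + x = real (Suc n) / real n" using n by (simp add: x_def field_simps)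
    then show ?thesis by (simp only: ln_div) (use n in simp)
  qed
  have f: "ln (fact (Suc n) :: real) = ln (real (Suc n)) + ln (fact n)"
    unfolding fact_Suc of_nat_mult by (subst ln_mult) auto
  have d: "stirling_error n - stirling_error (Suc n) = (real n + 1 / 2) * ln (1 + x) - 1"
    unfolding stirling_error_def l f by (simp add: algebra_simps)
  have "1 = (real n + 1 / 2) * (2 * x / (2 + x))" using n by (simp add: x_def field_simps)
  also have "\<dots> \<le> (real n + 1 / 2) * ln (1 + x)"
    using ln_one_plus_rational_bounds(1)[of x] x n by (intro mult_left_mono) auto
  finally show "stirling_error (Suc n) \<le> stirling_error n" using d by simp
  have "(real n + 1 / 2) * ln (1 + x) \<le> (real n + 1 / 2) * (x * (x + 2) / (2 * (x + 1)))"
    using ln_one_plus_rational_bounds(2)[of x] x n by (intro mult_left_mono) auto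
  also have "\<dots> = 1 + (1 / (4 * real n) - 1 / (4 * real (Suc n)))"
    using n by (simp add: x_def divide_simps) (simp add: algebra_simps)
  finally show "stirling_error n - stirling_error (Suc n) \<le> 1 / (4 * real n) - 1 / (4 * real (Suc n))" using d by simp
qed

lemma stirling_error_diff:
  assumes "1 \<le> m" "m \<le> n"
  shows "stirling_error n \<le> stirling_error m \<and> stirling_error m \<le> stirling_error n + 1 / (4 * real m) - 1 / (4 * real n)"
  using assms(2)
proof (induction n rule: dec_induct)
  case (step n)
  then show ?case using stirling_error_step[of n] assms(1) by linarith
qed simp

text \<open>With the product expressed through \<open>n!\<close> and \<open>(2 n)!\<close>, its
  logarithm becomes a combination of \<open>stirling_error n\<close>,
  \<open>stirling_error (2 * n)\<close> and explicit bounded terms.\<close>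

lemma wallis_partial_product:
  "(\<Prod>k=1..n. (4*real k^2) / (4*real k^2 - 1)) = 2 ^ (4 * n) * fact n ^ 4 / (fact (2 * n) ^ 2 * (2 * real n + 1))"
proof (induction n)
  case (Suc n)
  define a where "a = real n + 1"
  have a: "a \<ge> 1" unfolding a_def by simp
  have f: "fact (2 * Suc n) = (2 * a) * (2 * a - 1) * (fact (2 * n) :: real)"
    by (simp add: a_def algebra_simps)
  have "(\<Prod>k=1..Suc n. (4*real k^2) / (4*real k^2 - 1)) = (4 * a^2) / (4 * a^2 - 1) * (2 ^ (4 * n) * fact n ^ 4 / (fact (2 * n) ^ 2 * (2 * a - 1)))"
    using Suc by (simp add: a_def add.commute algebra_simps)
  also have "4 * a^2 - 1 = (2 * a - 1) * (2 * a + 1)" by (simp add: power2_eq_square algebra_simps)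
  also have "(4 * a^2) / ((2 * a - 1) * (2 * a + 1)) * (2 ^ (4 * n) * fact n ^ 4 / (fact (2 * n) ^ 2 * (2 * a - 1)))
     = (2 ^ 4 * 2 ^ (4 * n)) * (a ^ 4 * fact n ^ 4) / (((2 * a) * (2 * a - 1) * fact (2 * n)) ^ 2 * (2 * a + 1))"
    using a by (simp add: power_mult_distrib divide_simps) (simp add: power2_eq_square power4_eq_xxxx algebra_simps)
  also have "\<dots> = 2 ^ (4 * Suc n) * fact (Suc n) ^ 4 / (fact (2 * Suc n) ^ 2 * (2 * real (Suc n) + 1))"
    unfolding f by (simp add: a_def power_mult_distrib add.commute power_add)
  finally show ?case .
qed simp

theorem stirling_ln_fact:
  assumes "n \<ge> 1"
  shows "\<bar>ln (fact n) - (ln (2 * pi) / 2 + (real n + 1 / 2) * ln (real n) - real n)\<bar> \<le> 1 / (4 * real n)"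
proof -
  \<comment> \<open>The shift makes the sequence start at 1, where
    \<open>stirling_error_step\<close> applies.\<close>
  define s where "s = (\<lambda>n. stirling_error (Suc n))"
  have "decseq s" unfolding s_def by (intro decseq_SucI stirling_error_step(1)) simp
  moreover have "s n \<ge> stirling_error 1 - 1 / 4" for n
    using stirling_error_diff[of 1 "Suc n"] by (simp add: s_def) (smt (verit) divide_nonneg_nonneg of_nat_0_le_iff)
  ultimately obtain c where "s \<longlonglongrightarrow> c" by (metis decseq_convergent)
  then have c: "stirling_error \<longlonglongrightarrow> c" unfolding s_def by (rule LIMSEQ_imp_Suc)
  have bounds: "c \<le> stirling_error m \<and> stirling_error m \<le> c + 1 / (4 * real m)" if "m \<ge> 1" for m
  proof
    have ev: "\<forall>\<^sub>F n in sequentially. m \<le> n" by (rule eventually_ge_at_top)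
    show "c \<le> stirling_error m"
    proof -
      have "\<forall>\<^sub>F i in sequentially. stirling_error i \<le> stirling_error m"
        using ev by eventually_elim (use stirling_error_diff[OF that] in blast)
      then show ?thesis by (rule tendsto_upperbound[OF c]) simp
    qed
    have "(\<lambda>n. stirling_error n + 1 / (4 * real m)) \<longlonglongrightarrow> c + 1 / (4 * real m)"
      by (intro tendsto_intros c)
    moreover have "\<forall>\<^sub>F n in sequentially. stirling_error m \<le> stirling_error n + 1 / (4 * real m)"
      using ev
    proof eventually_elim
      case (elim n)
      have "0 \<le> 1 / (4 * real n)" by simp
      then show ?case using stirling_error_diff[OF that elim] by linarith
    qed
    ultimately show "stirling_error m \<le> c + 1 / (4 * real m)" by (rule tendsto_lowerbound) simp
  qed
  \<comment> \<open>In the logarithm of the Wallis product the terms growing with \<open>n\<close>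
    cancel and this expression is left; its limit \<open>2 c - 2 ln 2\<close> must therefore equal
    \<open>ln (pi / 2)\<close>.\<close>
  have "(\<lambda>n. 4 * stirling_error n - 2 * stirling_error (2 * n) - ln 2 - ln (2 + 1 / real n)) \<longlonglongrightarrow> 4 * c - 2 * c - ln 2 - ln (2 + 0)"
  proof -
    have "(\<lambda>n. stirling_error (2 * n)) \<longlonglongrightarrow> c"
      by (rule filterlim_compose[OF c]) (auto intro!: filterlim_subseq strict_monoI)
    then show ?thesis by (intro tendsto_intros c lim_1_over_n) auto
  qed
  moreover have "(\<lambda>n. ln (\<Prod>k=1..n. (4*real k^2) / (4*real k^2 - 1))) \<longlonglongrightarrow> ln (pi / 2)"
    by (intro tendsto_ln wallis) simp
  moreover have "\<forall>\<^sub>F n in sequentially. ln (\<Prod>k=1..n. (4*real k^2) / (4*real k^2 - 1)) =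
      4 * stirling_error n - 2 * stirling_error (2 * n) - ln 2 - ln (2 + 1 / real n)"
    using eventually_ge_at_top[of "1::nat"]
  proof eventually_elim
    case (elim n)
    have n: "real n > 0" using elim by simp
    have "2 * real n + 1 = real n * (2 + 1 / real n)" using n by (simp add: field_simps)
    then have "ln (2 * real n + 1) = ln (real n) + ln (2 + 1 / real n)"
      using n by (simp only:) (subst ln_mult, auto intro: add_pos_pos)
    moreover have "ln (real (2 * n)) = ln 2 + ln (real n)" using n by (simp add: ln_mult)
    moreover have "ln (2 ^ (4 * n) * fact n ^ 4 / (fact (2 * n) ^ 2 * (2 * real n + 1)))
      = 4 * real n * ln 2 + 4 * ln (fact n) - (2 * ln (fact (2 * n)) + ln (2 * real n + 1))"
      using n by (simp add: ln_div ln_mult ln_realpow)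
    ultimately show ?case
      unfolding wallis_partial_product stirling_error_def by (simp add: algebra_simps)
  qed
  ultimately have "(\<lambda>n. ln (\<Prod>k=1..n. (4*real k^2) / (4*real k^2 - 1))) \<longlonglongrightarrow> 4 * c - 2 * c - ln 2 - ln (2 + 0)"
    by (simp add: tendsto_cong)
  with \<open>(\<lambda>n. ln (\<Prod>k=1..n. (4*real k^2) / (4*real k^2 - 1))) \<longlonglongrightarrow> ln (pi / 2)\<close>
  have "ln (pi / 2) = 4 * c - 2 * c - ln 2 - ln (2 + 0)" by (rule LIMSEQ_unique)
  then have "c = ln (2 * pi) / 2" by (simp add: ln_div ln_mult)
  then show ?thesis using bounds[OF assms] unfolding stirling_error_def by linarith
qed

section \<open>The expected number of loose Hamilton cycles\<close>

text \<open>The perturbations may differ from term to term; their average factor still lies between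
  \<open>exp (- \<delta>)\<close> and \<open>exp \<delta>\<close>.\<close>

lemma sum_exp_perturbation:
  assumes "finite Y" "Y \<noteq> {}" "0 < A"
    and "\<And>C. C \<in> Y \<Longrightarrow> \<exists>\<theta>. \<bar>\<theta>\<bar> \<le> \<delta> \<and> f C = A * exp (e + \<theta>)"
  obtains \<theta> where "\<bar>\<theta>\<bar> \<le> \<delta>" "(\<Sum>C\<in>Y. f C) = real (card Y) * A * exp (e + \<theta> :: real)"
proof -
  let ?B = "real (card Y) * A * exp e"
  have c: "real (card Y) > 0" using assms(1,2) by (simp add: card_gt_0_iff)
  then have B: "?B > 0" using assms(3) by simp
  have b: "A * exp e * exp (- \<delta>) \<le> f C \<and> f C \<le> A * exp e * exp \<delta>" if C: "C \<in> Y" for C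
  proof -
    obtain \<theta> where \<theta>: "\<bar>\<theta>\<bar> \<le> \<delta>" "f C = A * exp (e + \<theta>)" using assms(4)[OF C] by blast
    then have "- \<delta> \<le> \<theta>" "\<theta> \<le> \<delta>" by linarith+
    then show ?thesis unfolding \<theta>(2) exp_add mult.assoc[symmetric] using assms(3) by simp
  qed
  have l: "?B * exp (- \<delta>) \<le> sum f Y"
    using sum_bounded_below[of Y "A * exp e * exp (- \<delta>)" f] b by (simp add: mult.assoc)
  have u: "sum f Y \<le> ?B * exp \<delta>"
    using sum_bounded_above[of Y f "A * exp e * exp \<delta>"] b by (simp add: mult.assoc)
  have pos: "sum f Y > 0" using l B by (meson exp_gt_zero less_le_trans mult_pos_pos)
  define \<theta> where "\<theta> = ln (sum f Y / ?B)"
  have "exp (- \<delta>) \<le> sum f Y / ?B" "sum f Y / ?B \<le> exp \<delta>"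
    using l u B by (simp_all add: le_divide_eq divide_le_eq mult.commute)
  moreover have "sum f Y / ?B > 0" using pos B by (rule divide_pos_pos)
  ultimately have "ln (exp (- \<delta>)) \<le> \<theta>" "\<theta> \<le> ln (exp \<delta>)"
    unfolding \<theta>_def by (intro ln_mono; simp)+
  then have "\<bar>\<theta>\<bar> \<le> \<delta>" by simp
  moreover have "sum f Y = real (card Y) * A * exp (e + \<theta>)"
    unfolding exp_add \<theta>_def using pos B c assms(3) by simp
  ultimately show ?thesis using that by blast
qed

text \<open>As \<open>t \<le> t l / 2\<close>, the residual slots number
  \<open>m r \<ge> (k - 3 / 2) t l\<close>, which is at least \<open>k t l / 4\<close> for
  \<open>k \<ge> 2\<close>. This converts error bounds in \<open>1 / m\<close> into bounds in
  \<open>1 / n\<close>.\<close>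

lemma residual_size_bound:
  fixes l k t m :: nat
  assumes l: "2 \<le> l" and k: "2 \<le> k" and kn: "k * (t * l) = m * Suc l + Suc l * t"
  shows "t * l * k \<le> 4 * (m * Suc l)"
proof -
  have a: "t * 2 \<le> t * l" using l by (intro mult_left_mono) auto
  have b: "2 * (t * l) \<le> k * (t * l)" using k by (intro mult_right_mono) auto
  have e: "k * (t * l) = m * Suc l + t * l + t" using kn by (simp add: algebra_simps)
  show "t * l * k \<le> 4 * (m * Suc l)" using a b e by (simp only: mult.commute[of "t * l" k])
qed

text \<open>The number of cycles times the count for one cycle, divided by the count of all regular
  hypergraphs. The two perturbations are subtracted in the exponent; each is at most
  \<open>60 k^3 r / m\<close>, hence at most \<open>240 k^2 r^2 / n\<close>, which gives
  480.\<close>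

lemma expectation_factorial_form:
  fixes l k t m :: nat
  defines "n \<equiv> t * l" and "r \<equiv> Suc l"
  assumes l: "2 \<le> l" and k: "2 \<le> k" and t: "3 \<le> t"
    and kn: "k * n = m * r + r * t" and large: "256 * k ^ 2 * r ^ 4 \<le> n"
  obtains \<theta> where "\<bar>\<theta>\<bar> \<le> 480 * real k ^ 2 * real r ^ 2 / real n"
    "expected_loose_Hamilton_cycles r k n =
      fact n / (2 * real t * fact (l - 1) ^ t)
      * (fact (m * r) / (fact m * fact r ^ m * (fact (k - 2) ^ t * fact (k - 1) ^ (n - t))))
      / (fact ((m + t) * r) / (fact (m + t) * fact r ^ (m + t) * fact k ^ n))
      * exp (real l * (real k - 1) / 2
          - real l * (real t * ((real k - 2) * (real k - 3)) + real (n - t) * ((real k - 1) * (real k - 2))) / (2 * real (m * r))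
          + \<theta>)"
proof -
  interpret loose_cycle_count t l n "{..<n}"
    by unfold_locales (use l t in \<open>auto simp: n_def\<close>)
  have n0: "0 < n" using t l by (simp add: n_def)
  have tlk: "t * l * k \<le> 4 * (m * r)" using residual_size_bound[OF l k kn[unfolded n_def r_def]] by (simp add: r_def)
  have r0: "0 < r" by (simp add: r_def)
  \<comment> \<open>The constant \<open>256 = 4 * 64\<close> is chosen so that after the factor 4 of
    \<open>residual_size_bound\<close> is lost, \<open>64 k^3 r \<le> m\<close> still holds.\<close>
  have "4 * (64 * k ^ 3 * r ^ 4) = 256 * k ^ 2 * r ^ 4 * k" by (simp add: power2_eq_square power3_eq_cube)
  also have "\<dots> \<le> n * k" using large by (rule mult_right_mono) simp
  also have "\<dots> \<le> 4 * (m * r)" using tlk by (simp add: n_def)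
  finally have "64 * k ^ 3 * r ^ 4 \<le> m * r" by simp
  then have "(64 * k ^ 3 * r ^ 3) * r \<le> m * r" by (simp add: power4_eq_xxxx power3_eq_cube mult.assoc)
  then have "64 * k ^ 3 * r ^ 3 \<le> m" using r0 by simp
  moreover have "64 * k ^ 3 * r \<le> 64 * k ^ 3 * r ^ 3" using r0 by (intro mult_left_mono self_le_power) auto
  ultimately have mlarge: "64 * k ^ 3 * Suc l \<le> m" by (simp add: r_def)
  have m0: "real m > 0" 
  proof -
    have "0 < 64 * k ^ 3 * Suc l" using k by simp
    then show ?thesis using mlarge by linarith
  qed
  define \<delta> where "\<delta> = 60 * real k ^ 3 * real r / real m"
  have \<delta>: "\<delta> \<le> 240 * real k ^ 2 * real r ^ 2 / real n"
  proof -
    have "real (n * k) \<le> real (4 * (m * r))" using tlk by (simp only: of_nat_le_iff n_def)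
    then have "real n * real k \<le> 4 * real m * real r" by simp
    then have "(60 * real k ^ 2 * real r) * (real n * real k) \<le> (60 * real k ^ 2 * real r) * (4 * real m * real r)"
      by (intro mult_left_mono) auto
    then show ?thesis
      unfolding \<delta>_def using m0 n0 by (simp add: divide_le_eq le_divide_eq power2_eq_square power3_eq_cube mult_ac)
  qed
  let ?Y = "cyc ` orderings"
  let ?A = "fact (m * r) / (fact m * fact r ^ m * (fact (k - 2) ^ t * fact (k - 1) ^ (n - t))) :: real"
  let ?e = "- real l * (real t * ((real k - 2) * (real k - 3)) + real (n - t) * ((real k - 1) * (real k - 2))) / (2 * real (m * r))"
  have Y: "{C. loose_Hamilton_cycle {..<n} r C} = ?Y" unfolding r_def using loose_Hamilton_cycle_iff by auto
  have "card ?Y * (2 * t * fact (l - 1) ^ t) = fact n" by (rule card_cycles)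
  then have "real (card ?Y * (2 * t * fact (l - 1) ^ t)) = real (fact n)" by (simp only:)
  then have cY: "real (card ?Y) = fact n / (2 * real t * fact (l - 1) ^ t)"
    using t by (simp add: field_simps)
  have Yne: "?Y \<noteq> {}" 
  proof
    assume "?Y = {}"
    then have "real (card ?Y) = 0" by (simp only: card.empty of_nat_0)
    then show False using cY t by simp
  qed
  have f: "\<exists>\<theta>. \<bar>\<theta>\<bar> \<le> \<delta> \<and> real (card {H\<in>regular_uniform_hypergraphs {..<n} r k. C \<subseteq> H}) = ?A * exp (?e + \<theta>)" if C: "C \<in> ?Y" for C
  proof -
    obtain v where v: "bij_betw v {..<n} {..<n}" "C = cyc v" using C unfolding orderings_def by auto
    show ?thesis
      using count_containing_cyc[OF v(1) k kn[unfolded r_def] mlarge] unfolding v(2) \<delta>_def r_def by blast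
  qed
  have finY: "finite ?Y" using finite_orderings by simp
  obtain \<theta>1 where \<theta>1: "\<bar>\<theta>1\<bar> \<le> \<delta>"
    "(\<Sum>C\<in>?Y. real (card {H\<in>regular_uniform_hypergraphs {..<n} r k. C \<subseteq> H})) = real (card ?Y) * ?A * exp (?e + \<theta>1)"
    by (rule sum_exp_perturbation[OF finY Yne _ f]) auto
  have kn': "k * n = (m + t) * Suc l" using kn by (simp add: r_def algebra_simps)
  have ml': "64 * k ^ 3 * Suc l \<le> m + t" using mlarge by simp
  obtain \<theta>2 where \<theta>2: "\<bar>\<theta>2\<bar> \<le> 60 * real k ^ 3 * real r / real (m + t)"
    "real (card (hypergraphs_avoiding {..<n} (\<lambda>_. k) r {})) =
      fact ((m + t) * r) / (fact (m + t) * fact r ^ (m + t) * fact k ^ n) * exp (- real l * (real k - 1) / 2 + \<theta>2)"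
    using count_regular[OF k kn' l ml' n0] unfolding r_def by blast
  let ?B = "fact ((m + t) * r) / (fact (m + t) * fact r ^ (m + t) * fact k ^ n) :: real"
  have ne: "hypergraphs_avoiding {..<n} (\<lambda>_. k) r {} \<noteq> {}"
  proof
    assume "hypergraphs_avoiding {..<n} (\<lambda>_. k) r {} = {}"
    then have "?B * exp (- real l * (real k - 1) / 2 + \<theta>2) = 0" using \<theta>2(2) by simp
    then show False by simp
  qed
  have "60 * real k ^ 3 * real r / real (m + t) \<le> 60 * real k ^ 3 * real r / real m"
    using m0 by (intro divide_left_mono) auto
  then have \<theta>2': "\<bar>\<theta>2\<bar> \<le> 60 * real k ^ 3 * real r / real m" using \<theta>2(1) by linarith
  have E: "expected_loose_Hamilton_cycles r k n = real (card ?Y) * ?A * exp (?e + \<theta>1) / (?B * exp (- real l * (real k - 1) / 2 + \<theta>2))"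
    unfolding expectation_eq_sum_over_cycles[OF ne] Y \<theta>1(2) \<theta>2(2) ..
  have quot: "exp (- a * b / c + x) / exp (- a * d / 2 + y) = exp (a * d / 2 - a * b / c + (x - y))" for a b c d x y :: real
    unfolding exp_diff[symmetric] by simp
  have ex: "exp (?e + \<theta>1) / exp (- real l * (real k - 1) / 2 + \<theta>2) = exp (real l * (real k - 1) / 2
          - real l * (real t * ((real k - 2) * (real k - 3)) + real (n - t) * ((real k - 1) * (real k - 2))) / (2 * real (m * r))
          + (\<theta>1 - \<theta>2))"
    by (rule quot)
  have split: "a * b * x / (c * y) = a * b / c * (x / y)" for a b c x y :: real by simp
  have main: "expected_loose_Hamilton_cycles r k n =
      fact n / (2 * real t * fact (l - 1) ^ t)
      * (fact (m * r) / (fact m * fact r ^ m * (fact (k - 2) ^ t * fact (k - 1) ^ (n - t))))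
      / (fact ((m + t) * r) / (fact (m + t) * fact r ^ (m + t) * fact k ^ n))
      * exp (real l * (real k - 1) / 2
          - real l * (real t * ((real k - 2) * (real k - 3)) + real (n - t) * ((real k - 1) * (real k - 2))) / (2 * real (m * r))
          + (\<theta>1 - \<theta>2))"
    unfolding E split ex cY ..
  have "\<bar>\<theta>1 - \<theta>2\<bar> \<le> 2 * \<delta>" using \<theta>1(1) \<theta>2' unfolding \<delta>_def by linarith
  also have "\<dots> \<le> 480 * real k ^ 2 * real r ^ 2 / real n" using \<delta> by simp
  finally show ?thesis by (rule that[OF _ main])
qed

text \<open>Stirling's formula is applied to the factorials of \<open>n\<close>, \<open>m r\<close>,
  \<open>m\<close>, \<open>(m + t) r\<close> and \<open>m + t\<close>; these five account for the 5.
  The factorials of \<open>r\<close>, \<open>k\<close> and the numbers just below them cancel down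
  to powers of \<open>r\<close>, \<open>r - 1\<close>, \<open>k\<close> and \<open>k - 1\<close>.
  After taking logarithms the claim is a linear identity in the logarithms that remain.\<close>

lemma factorial_form_asymptotics:
  fixes l k t m n r :: nat
  assumes l: "2 \<le> l" and k: "2 \<le> k" and t: "0 < t" and n: "n = t * l" and r: "r = Suc l"
    and kn: "k * n = m * r + r * t" and m: "0 < m"
  obtains \<eta> where "\<bar>\<eta>\<bar> \<le> 5 * real k ^ 2 * real r ^ 2 / real n"
    "fact n / (2 * real t * fact (l - 1) ^ t)
      * (fact (m * r) / (fact m * fact r ^ m * (fact (k - 2) ^ t * fact (k - 1) ^ (n - t))))
      / (fact ((m + t) * r) / (fact (m + t) * fact r ^ (m + t) * fact k ^ n))
     = sqrt (pi / (2 * real n)) * (real r - 1) *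
        ((real k - 1) * (real r - 1) *
          ((real r * real k - real k - real r) / (real r * real k - real k))
            powr ((real r - 1) * (real r * real k - real r - real k) / real r))
        powr (real n / (real r - 1)) * exp \<eta>"
proof -
  let ?P = "fact n / (2 * real t * fact (l - 1) ^ t)
      * (fact (m * r) / (fact m * fact r ^ m * (fact (k - 2) ^ t * fact (k - 1) ^ (n - t))))
      / (fact ((m + t) * r) / (fact (m + t) * fact r ^ (m + t) * fact k ^ n)) :: real"
  let ?a = "(real r * real k - real k - real r) / (real r * real k - real k)"
  let ?b = "(real r - 1) * (real r * real k - real r - real k) / real r"
  let ?Q = "sqrt (pi / (2 * real n)) * (real r - 1) * ((real k - 1) * (real r - 1) * ?a powr ?b) powr (real n / (real r - 1))"
  define s where "s x = ln (fact x) - (ln (2 * pi) / 2 + (real x + 1 / 2) * ln (real x) - real x)" for x :: nat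
  define M where "M = real (m * r)"
  define M0 where "M0 = real k * real n"
  define R where "R = real r"
  define K where "K = real k"
  define N where "N = real n"
  define T where "T = real t"
  have rl: "real l = R - 1" by (simp add: R_def r)
  have R3: "R \<ge> 3" using l by (simp add: R_def r)
  have K2: "K \<ge> 2" using k by (simp add: K_def)
  have T0: "T > 0" using t by (simp add: T_def)
  have N: "N = T * (R - 1)" by (simp add: N_def n T_def rl)
  have N0: "N > 0" unfolding N using T0 R3 by simp
  have M0: "M0 = K * N" by (simp add: M0_def K_def N_def)
  have "real (k * n) = real (m * r + r * t)" using kn by (simp only:)
  then have MM: "M0 = M + R * T" by (simp add: M0_def M_def R_def T_def)
  have M: "M = T * (R * K - K - R)" using MM unfolding M0 N by (simp add: algebra_simps)
  have m_pos: "real m > 0" using m by simp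
  have Mpos: "M > 0" using m R3 by (simp add: M_def R_def)
  have M0pos: "M0 > 0" unfolding M0 using K2 N0 by simp
  have c0: "R * K - K - R > 0" using Mpos T0 unfolding M by (simp add: zero_less_mult_iff)
  have c1: "R * K - K > 0" using c0 R3 by linarith
  have mr: "real m = M / R" using R3 by (simp add: M_def R_def)
  have mtr: "real (m + t) = M0 / R" using R3 by (simp add: MM mr T_def field_simps)
  have m0r: "real ((m + t) * r) = M0" using R3 mtr by (simp add: R_def)
  have tn: "t \<le> n" using l by (simp add: n)
  have st: "ln (fact x) = ln (2 * pi) / 2 + (real x + 1 / 2) * ln (real x) - real x + s x" for x
    by (simp add: s_def)
  \<comment> \<open>The positive number \<open>R K - K - R\<close> is an integer, hence at least 1.
    So \<open>m\<close> is at least \<open>N / R^2\<close>, and the Stirling error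
    \<open>1 / (4 m)\<close> is within the stated bound.\<close>
  have NmR: "N \<le> real m * R ^ 2"
  proof -
    have *: "R * K - K - R = real (l * k) - real r" by (simp add: rl K_def R_def[symmetric] algebra_simps)
    then have "real r < real (l * k)" using c0 by linarith
    then have "Suc r \<le> l * k" by (simp only: of_nat_less_iff Suc_le_eq)
    then have "real (Suc r) \<le> real (l * k)" by (simp only: of_nat_le_iff)
    then have c: "1 \<le> R * K - K - R" using * by simp
    have "R - 1 \<le> 1 * R" by simp
    also have "\<dots> \<le> (R * K - K - R) * R" using c R3 by (intro mult_right_mono) auto
    finally have "N \<le> T * ((R * K - K - R) * R)" unfolding N using T0 by (intro mult_left_mono) auto
    also have "\<dots> = M * R" unfolding M by (simp only: mult.assoc)
    also have "\<dots> = real m * R ^ 2" by (simp add: M_def R_def power2_eq_square)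
    finally show ?thesis .
  qed
  have sb: "\<bar>s x\<bar> \<le> K ^ 2 * R ^ 2 / N" if x1: "1 \<le> x" and xN: "N \<le> real x * R ^ 2" for x
  proof -
    have "\<bar>s x\<bar> \<le> 1 / (4 * real x)" unfolding s_def using stirling_ln_fact[OF x1] .
    also have "\<dots> \<le> K ^ 2 * R ^ 2 / N"
    proof -
      have "N \<le> real x * R ^ 2" by (rule xN)
      also have "\<dots> \<le> (4 * real x * K ^ 2) * R ^ 2"
      proof (rule mult_right_mono)
        have "1 \<le> K ^ 2" using K2 by (intro one_le_power) simp
        then have "1 \<le> 4 * K ^ 2" by linarith
        then have "real x * 1 \<le> real x * (4 * K ^ 2)" by (intro mult_left_mono) auto
        then show "real x \<le> 4 * real x * K ^ 2" by (simp add: mult_ac)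
      qed simp
      finally have "1 * N \<le> (K ^ 2 * R ^ 2) * (4 * real x)" by (simp add: mult_ac)
      then show ?thesis using N0 x1 by (simp add: divide_le_eq le_divide_eq mult_ac)
    qed
    finally show ?thesis .
  qed
  have N_ge_1: "1 \<le> n" using N0 by (simp add: N_def)
  define \<eta> where "\<eta> = s n + s (m * r) - s m - s ((m + t) * r) + s (m + t)"
  have sn: "\<bar>s n\<bar> \<le> K ^ 2 * R ^ 2 / N"
  proof (rule sb[OF N_ge_1])
    have "1 \<le> R ^ 2" using R3 by (intro one_le_power) simp
    then have "N * 1 \<le> N * R ^ 2" using N0 by (intro mult_left_mono) auto
    then show "N \<le> real n * R ^ 2" by (simp add: N_def)
  qed
  have sm: "\<bar>s x\<bar> \<le> K ^ 2 * R ^ 2 / N" if "m \<le> x" for x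
  proof (rule sb)
    show "1 \<le> x" using m that by simp
    have "real m * R ^ 2 \<le> real x * R ^ 2" using that by (intro mult_right_mono) auto
    then show "N \<le> real x * R ^ 2" using NmR by linarith
  qed
  have r1: "1 \<le> r" by (simp add: r)
  then have le1: "m \<le> m * r" by simp
  have le: "m \<le> m * r" "m \<le> (m + t) * r" "m \<le> m + t"
    by (rule le1, rule order_trans[OF le1 mult_le_mono1], simp_all)
  have \<eta>: "\<bar>\<eta>\<bar> \<le> 5 * K ^ 2 * R ^ 2 / N"
    using sn sm[OF le(1)] sm[OF le(2)] sm[OF le(3)] sm[OF order_refl] unfolding \<eta>_def by (simp only: mult.assoc times_divide_eq_right[symmetric])
  define \<mu> where "\<mu> = real m"
  have e: "real n = T * (R - 1)" "real (m * r) = \<mu> * R" "real ((m + t) * r) = (\<mu> + T) * R" "real (m + t) = \<mu> + T" "real (n - t) = T * (R - 1) - T"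
    using N tn by (simp_all add: N_def T_def \<mu>_def R_def of_nat_diff)
  have lm: "ln (\<mu> * R) = ln \<mu> + ln R" "ln ((\<mu> + T) * R) = ln (\<mu> + T) + ln R" "ln (T * (R - 1)) = ln T + ln (R - 1)"
    using m_pos T0 R3 by (auto simp: ln_mult \<mu>_def)
  \<comment> \<open>The handshake identity; it eliminates \<open>ln K\<close> in favour of the
    logarithms of \<open>\<mu> + T\<close>, \<open>T\<close>, \<open>R\<close> and
    \<open>R - 1\<close>.\<close>
  have KN: "(\<mu> + T) * R = K * (T * (R - 1))" using MM M0 N by (simp add: \<mu>_def M_def R_def[symmetric] algebra_simps)
  have lK: "ln K = ln (\<mu> + T) + ln R - ln T - ln (R - 1)"
  proof -
    have "ln ((\<mu> + T) * R) = ln K + (ln T + ln (R - 1))" unfolding KN lm(3)[symmetric] using K2 T0 R3 by (simp add: ln_mult)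
    then show ?thesis using lm(2) by simp
  qed
  have fr: "ln (fact r :: real) = ln R + ln (R - 1) + ln (fact (l - 1))"
  proof -
    have "(fact r :: real) = R * ((R - 1) * fact (l - 1))"
      using l by (simp add: r R_def fact_reduce[of l])
    then show ?thesis using R3 by (simp add: ln_mult)
  qed
  have fk: "ln (fact k :: real) = ln K + ln (K - 1) + ln (fact (k - 2))" "ln (fact (k - 1) :: real) = ln (K - 1) + ln (fact (k - 2))"
  proof -
    obtain j where j: "k = Suc (Suc j)" using k by (metis add_2_eq_Suc le_Suc_ex)
    have "(fact (k - 1) :: real) = (K - 1) * fact (k - 2)" by (simp add: K_def j)
    moreover have "(fact k :: real) = K * ((K - 1) * fact (k - 2))" by (simp add: K_def j algebra_simps)
    ultimately show "ln (fact k :: real) = ln K + ln (K - 1) + ln (fact (k - 2))" "ln (fact (k - 1) :: real) = ln (K - 1) + ln (fact (k - 2))"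
      using K2 by (simp_all add: ln_mult)
  qed
  have Ppos: "?P > 0" using t by simp
  have lnP: "ln ?P = ln (fact n) - (ln 2 + ln T + T * ln (fact (l - 1)))
      + (ln (fact (m * r)) - (ln (fact m) + \<mu> * ln (fact r) + (T * ln (fact (k - 2)) + real (n - t) * ln (fact (k - 1)))))
      - (ln (fact ((m + t) * r)) - (ln (fact (m + t)) + (\<mu> + T) * ln (fact r) + real n * ln (fact k)))"
    using t by (simp add: ln_mult ln_div ln_realpow T_def \<mu>_def)
  have mu: "\<mu> * R = T * (R * K - K - R)" using M by (simp add: M_def \<mu>_def R_def)
  have \<mu>0: "\<mu> > 0" using m_pos by (simp add: \<mu>_def)
  \<comment> \<open>The base of the inner power is the fraction \<open>m / (m + t)\<close> of edges
    outside the cycle.\<close>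
  have a: "?a = \<mu> / (\<mu> + T)"
  proof -
    have "?a = (T * (R * K - K - R)) / (T * (R * K - K))"
      using T0 unfolding K_def R_def by (subst mult_divide_mult_cancel_left) simp_all
    also have "T * (R * K - K) = K * (T * (R - 1))" by (simp add: algebra_simps)
    finally have "?a = (T * (R * K - K - R)) / (K * (T * (R - 1)))" .
    then show ?thesis unfolding KN[symmetric] mu[symmetric] using R3 by simp
  qed
  have lna: "ln ?a = ln \<mu> - ln (\<mu> + T)" unfolding a using \<mu>0 T0 by (simp add: ln_div)
  have a0: "?a > 0" unfolding a using \<mu>0 T0 by simp
  \<comment> \<open>The two exponents multiply to \<open>m (r - 1)\<close>. This power comes from
    comparing \<open>(m r)! / m!\<close> with \<open>((m + t) r)! / (m + t)!\<close>.\<close>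
  have b: "T * ?b = \<mu> * (R - 1)"
  proof -
    have "T * ?b = (R - 1) * (T * (R * K - K - R)) / R" by (simp add: K_def[symmetric] R_def[symmetric] algebra_simps)
    then show ?thesis unfolding mu[symmetric] using R3 by simp
  qed
  have Nd: "real n / (real r - 1) = T" using N R3 by (simp add: N_def R_def)
  have Qpos: "?Q > 0"
    using N0 R3 K2 a0 by (intro mult_pos_pos powr_gt_zero[THEN iffD2]) (auto simp: N_def R_def K_def)
  have "ln ?Q = ln (sqrt (pi / (2 * real n))) + ln (R - 1) + T * (ln (K - 1) + ln (R - 1) + ?b * ln ?a)"
    unfolding Nd using N0 R3 K2 a0 c0 by (simp add: ln_mult ln_powr N_def[symmetric] R_def[symmetric] K_def[symmetric])
  also have "ln (sqrt (pi / (2 * real n))) = (ln pi - ln 2 - ln (real n)) / 2"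
    using N0 by (simp add: ln_sqrt ln_div ln_mult N_def)
  also have "T * (ln (K - 1) + ln (R - 1) + ?b * ln ?a) = T * (ln (K - 1) + ln (R - 1)) + (T * ?b) * ln ?a"
    by (simp only: distrib_left mult.assoc)
  finally have lnQ: "ln ?Q = (ln pi - ln 2 - (ln T + ln (R - 1))) / 2 + ln (R - 1) 
      + (T * (ln (K - 1) + ln (R - 1)) + \<mu> * (R - 1) * (ln \<mu> - ln (\<mu> + T)))"
    unfolding b lna e(1) lm(3) by simp
  have l2pi: "ln (2 * pi) = ln 2 + ln pi" by (simp add: ln_mult)
  define x where "x = ln ?P"
  define y where "y = ln ?Q"
  have "x = y + \<eta>"
    unfolding lnP[folded x_def] lnQ[folded y_def] fk fr st[of n] st[of m] st[of "m * r"] st[of "(m + t) * r"] st[of "m + t"] \<eta>_def e lm \<mu>_def[symmetric] l2pi lK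
    by (simp add: field_simps)
  then have "exp (ln ?P) = exp (ln ?Q) * exp \<eta>" unfolding x_def y_def by (simp only: exp_add)
  then have "?P = ?Q * exp \<eta>" unfolding exp_ln[OF Ppos] exp_ln[OF Qpos] .
  then show ?thesis using that[of \<eta>] \<eta> by (simp only: K_def R_def N_def)
qed

text \<open>The first term stems from the count of all regular hypergraphs, the second from the
  residual ones, with \<open>t\<close> hubs of degree \<open>k - 2\<close> and
  \<open>t (r - 2)\<close> other vertices of degree \<open>k - 1\<close>. The factor
  \<open>T\<close> cancels against \<open>M\<close>, and a polynomial identity remains.\<close>

lemma exponent_eq:
  fixes R K T M :: real
  assumes "M = T * (R * K - K - R)" "0 < T" "0 < R * K - K - R"
  shows "(R - 1) * (K - 1) / 2 - (R - 1) * (T * ((K - 2) * (K - 3)) + T * (R - 2) * ((K - 1) * (K - 2))) / (2 * M)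
    = (R - 1) * (R * K - R - 2) / (2 * (R * K - R - K))"
proof -
  define c where "c = R * K - K - R"
  have c: "c > 0" "R * K - R - K = c" using assms(3) by (simp_all add: c_def)
  have "(R - 1) * (T * ((K - 2) * (K - 3)) + T * (R - 2) * ((K - 1) * (K - 2))) / (2 * M)
    = (T * ((R - 1) * ((K - 2) * (K - 3) + (R - 2) * ((K - 1) * (K - 2))))) / (T * (2 * c))"
    unfolding assms(1) c_def by (simp add: algebra_simps)
  also have "\<dots> = (R - 1) * ((K - 2) * (K - 3) + (R - 2) * ((K - 1) * (K - 2))) / (2 * c)"
    using assms(2) by (subst mult_divide_mult_cancel_left) auto
  finally have "(R - 1) * (K - 1) / 2 - (R - 1) * (T * ((K - 2) * (K - 3)) + T * (R - 2) * ((K - 1) * (K - 2))) / (2 * M)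
    = ((R - 1) * (K - 1) * c - (R - 1) * ((K - 2) * (K - 3) + (R - 2) * ((K - 1) * (K - 2)))) / (2 * c)"
    using c(1) by (simp add: diff_divide_distrib)
  also have "(R - 1) * (K - 1) * c - (R - 1) * ((K - 2) * (K - 3) + (R - 2) * ((K - 1) * (K - 2))) = (R - 1) * (R * K - R - 2)"
    unfolding c_def by (simp add: algebra_simps)
  finally show ?thesis unfolding c(2) .
qed

lemma expectation_explicit:
  fixes r k n :: nat
  defines "R \<equiv> real r" and "K \<equiv> real k"
  assumes r: "3 \<le> r" and k: "2 \<le> k" and dvd: "r dvd k * n" "(r - 1) dvd n" and n: "0 < n"
    and large: "256 * k ^ 2 * r ^ 4 \<le> n"
  obtains \<theta> where "\<bar>\<theta>\<bar> \<le> 500 * (R ^ 4 * K ^ 2 / real n)"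
    "expected_loose_Hamilton_cycles r k n =
      sqrt (pi / (2 * real n)) * (R - 1) *
      ((K - 1) * (R - 1) * ((R * K - K - R) / (R * K - K)) powr ((R - 1) * (R * K - R - K) / R)) powr (real n / (R - 1)) *
      exp ((R - 1) * (R * K - R - 2) / (2 * (R * K - R - K)) + \<theta>)"
proof -
  define l where "l = r - 1"
  have rl: "r = Suc l" using r by (simp add: l_def)
  have l: "2 \<le> l" using r by (simp add: l_def)
  obtain t where nt: "n = t * l" using dvd(2) unfolding l_def[symmetric] by (metis dvdE mult.commute)
  have t0: "0 < t" using n nt by (cases t) auto
  \<comment> \<open>With \<open>t \<le> 2\<close> one would have \<open>n \<le> 2 l < 3 r\<close>,
    below the size required of \<open>n\<close>.\<close>
  have t: "3 \<le> t"
  proof (rule ccontr)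
    assume "\<not> 3 \<le> t"
    then have "t * l \<le> 2 * l" by (intro mult_right_mono) auto
    then have "n \<le> 2 * r" unfolding nt rl by (rule order_trans) simp
    moreover have "3 * r \<le> 256 * k ^ 2 * r ^ 4"
    proof -
      have "1 \<le> k ^ 2" "r \<le> r ^ 4" using k r by (auto intro: one_le_power self_le_power)
      then have "1 * r \<le> k ^ 2 * r ^ 4" by (intro mult_mono) auto
      then show ?thesis by linarith
    qed
    ultimately show False using large r by linarith
  qed
  obtain m0 where m0: "k * n = m0 * r" using dvd(1) by (metis dvdE mult.commute)
  \<comment> \<open>At least one edge lies outside the cycle:
    \<open>k t l \<ge> 2 t l \<ge> t l + 2 t > r t\<close>.\<close>
  have "r * t < m0 * r"
  proof -
    have "2 * (t * l) \<le> k * (t * l)" using k by (intro mult_right_mono) auto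
    moreover have "t * 2 \<le> t * l" using l by (intro mult_left_mono) auto
    moreover have "r * t = t * l + t" by (simp add: rl)
    moreover have "k * (t * l) = m0 * r" using m0 nt by simp
    ultimately show ?thesis using t0 by linarith
  qed
  then have "t * r < m0 * r" by (simp only: mult.commute)
  then have tm: "t < m0" by simp
  define m where "m = m0 - t"
  have m: "0 < m" "m0 = m + t" using tm by (simp_all add: m_def)
  have kn: "k * n = m * r + r * t" unfolding m0 m(2) by (simp add: algebra_simps)
  obtain \<theta>1 where \<theta>1: "\<bar>\<theta>1\<bar> \<le> 480 * real k ^ 2 * real r ^ 2 / real n"
    "expected_loose_Hamilton_cycles r k n =
      fact n / (2 * real t * fact (l - 1) ^ t)
      * (fact (m * r) / (fact m * fact r ^ m * (fact (k - 2) ^ t * fact (k - 1) ^ (n - t))))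
      / (fact ((m + t) * r) / (fact (m + t) * fact r ^ (m + t) * fact k ^ n))
      * exp (real l * (real k - 1) / 2
          - real l * (real t * ((real k - 2) * (real k - 3)) + real (n - t) * ((real k - 1) * (real k - 2))) / (2 * real (m * r))
          + \<theta>1)"
    using expectation_factorial_form[OF l k t, of m] kn large unfolding nt rl by blast
  obtain \<theta>2 where \<theta>2: "\<bar>\<theta>2\<bar> \<le> 5 * real k ^ 2 * real r ^ 2 / real n"
    "fact n / (2 * real t * fact (l - 1) ^ t)
      * (fact (m * r) / (fact m * fact r ^ m * (fact (k - 2) ^ t * fact (k - 1) ^ (n - t))))
      / (fact ((m + t) * r) / (fact (m + t) * fact r ^ (m + t) * fact k ^ n))
     = sqrt (pi / (2 * real n)) * (real r - 1) *
        ((real k - 1) * (real r - 1) *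
          ((real r * real k - real k - real r) / (real r * real k - real k))
            powr ((real r - 1) * (real r * real k - real r - real k) / real r))
        powr (real n / (real r - 1)) * exp \<theta>2"
    using factorial_form_asymptotics[OF l k t0 nt rl kn m(1)] by blast
  have lR: "real l = R - 1" by (simp add: R_def rl)
  have T0: "real t > 0" using t0 by simp
  have tn: "t \<le> n" using nt l by simp
  have ntR: "real (n - t) = real t * (R - 2)" using tn by (simp add: of_nat_diff nt lR algebra_simps)
  have "real (k * n) = real (m * r + r * t)" using kn by (simp only:)
  then have M: "real (m * r) = real t * (R * K - K - R)" by (simp add: nt lR K_def[symmetric] R_def[symmetric] algebra_simps)
  moreover have "real (m * r) > 0" using m(1) r by simp
  ultimately have c0: "R * K - K - R > 0" using T0 by (simp add: zero_less_mult_iff)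
  have ex: "real l * (real k - 1) / 2
          - real l * (real t * ((real k - 2) * (real k - 3)) + real (n - t) * ((real k - 1) * (real k - 2))) / (2 * real (m * r))
     = (R - 1) * (R * K - R - 2) / (2 * (R * K - R - K))"
    unfolding ntR lR K_def[symmetric] by (rule exponent_eq[OF M T0 c0])
  have split: "q * exp y * exp (x + z) = q * exp (x + (z + y))" for q x y z :: real
    by (simp add: exp_add)
  \<comment> \<open>The switching errors give 480 and Stirling's formula gives 5; 500 rounds up, and
    \<open>R^2 \<le> R^4\<close> brings the bound into the stated shape.\<close>
  have "\<bar>\<theta>1 + \<theta>2\<bar> \<le> 480 * K ^ 2 * R ^ 2 / real n + 5 * K ^ 2 * R ^ 2 / real n"
    using \<theta>1(1) \<theta>2(1) unfolding K_def R_def by linarith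
  also have "\<dots> = 485 * (R ^ 2 * K ^ 2 / real n)" by simp
  also have "\<dots> \<le> 500 * (R ^ 4 * K ^ 2 / real n)"
  proof (rule mult_mono)
    have "R ^ 2 \<le> R ^ 4" using r by (intro power_increasing) (auto simp: R_def)
    then show "R ^ 2 * K ^ 2 / real n \<le> R ^ 4 * K ^ 2 / real n" by (intro divide_right_mono mult_right_mono) auto
  qed auto
  finally have "\<bar>\<theta>1 + \<theta>2\<bar> \<le> 500 * (R ^ 4 * K ^ 2 / real n)" .
  then show ?thesis
    by (rule that) (unfold \<theta>1(2) \<theta>2(2) ex split, simp only: R_def K_def)
qed

theorem corollary3p2:
  fixes r k :: "nat \<Rightarrow> nat"
  assumes "\<And>n. n \<ge> 3 \<Longrightarrow> r n \<ge> 3"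
    and "\<And>n. n \<ge> 3 \<Longrightarrow> k n \<ge> 2"
    and "infinite (admissible r k)"
    and "(\<lambda>n. real (r n) ^ 4 * real (k n) ^ 2) \<in> o[along_admissible r k](\<lambda>n. real n)"
  shows "\<exists>\<epsilon> :: nat \<Rightarrow> real.
    \<epsilon> \<in> O[along_admissible r k](\<lambda>n. real (r n) ^ 4 * real (k n) ^ 2 / real n) \<and>
    (\<forall>\<^sub>F n in along_admissible r k.
      expected_loose_Hamilton_cycles (r n) (k n) n =
        (let R = real (r n); K = real (k n) in
          sqrt (pi / (2 * real n)) * (R - 1) *
          ((K - 1) * (R - 1) *
             ((R * K - K - R) / (R * K - K)) powr ((R - 1) * (R * K - R - K) / R))
            powr (real n / (R - 1)) *
          exp ((R - 1) * (R * K - R - 2) / (2 * (R * K - R - K)) + \<epsilon> n)))"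
proof -
  \<comment> \<open>For a single \<open>n\<close> the expansion needs divisibility and a size
    condition; the little-o hypothesis, used with the constant 1/256, makes the latter hold
    eventually.\<close>
  define good where "good n \<longleftrightarrow> n \<in> admissible r k \<and> 256 * k n ^ 2 * r n ^ 4 \<le> n" for n
  have ev: "\<forall>\<^sub>F n in along_admissible r k. good n"
  proof -
    have "\<forall>\<^sub>F n in along_admissible r k. n \<in> admissible r k"
      unfolding along_admissible_def by (simp add: eventually_inf_principal)
    moreover have "\<forall>\<^sub>F n in along_admissible r k. norm (real (r n) ^ 4 * real (k n) ^ 2) \<le> 1 / 256 * norm (real n)"
      by (rule landau_o.smallD[OF assms(4)]) simp
    ultimately show ?thesis
    proof eventually_elim
      case (elim n)
      then have "real (256 * k n ^ 2 * r n ^ 4) \<le> real n" by (simp add: mult_ac)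
      then have "256 * k n ^ 2 * r n ^ 4 \<le> n" by (simp only: of_nat_le_iff)
      then show ?case using elim unfolding good_def by blast
    qed
  qed
  define claim where "claim n \<theta> \<longleftrightarrow> \<bar>\<theta>\<bar> \<le> 500 * (real (r n) ^ 4 * real (k n) ^ 2 / real n) \<and>
      expected_loose_Hamilton_cycles (r n) (k n) n =
        (let R = real (r n); K = real (k n) in
          sqrt (pi / (2 * real n)) * (R - 1) *
          ((K - 1) * (R - 1) *
             ((R * K - K - R) / (R * K - K)) powr ((R - 1) * (R * K - R - K) / R))
            powr (real n / (R - 1)) *
          exp ((R - 1) * (R * K - R - 2) / (2 * (R * K - R - K)) + \<theta>))" for n \<theta>
  have "\<exists>\<theta>. claim n \<theta>" if "good n" for n
  proof -
    have n: "n \<ge> 3" "r n dvd k n * n" "(r n - 1) dvd n" "256 * k n ^ 2 * r n ^ 4 \<le> n"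
      using that unfolding good_def admissible_def by auto
    have n0: "0 < n" using n(1) by simp
    show ?thesis
      by (rule expectation_explicit[OF assms(1)[OF n(1)] assms(2)[OF n(1)] n(2,3) n0 n(4)])
        (unfold claim_def Let_def, rule exI, rule conjI)
  qed
  \<comment> \<open>The values of \<open>\<epsilon>\<close> at other \<open>n\<close> are arbitrary,
    since both conclusions are claimed only eventually along the filter; the constant 500 is common
    to all good \<open>n\<close>.\<close>
  then obtain \<epsilon> where \<epsilon>: "\<And>n. good n \<Longrightarrow> claim n (\<epsilon> n)" by metis
  have "\<epsilon> \<in> O[along_admissible r k](\<lambda>n. real (r n) ^ 4 * real (k n) ^ 2 / real n)"
  proof (rule bigoI[of _ 500])
    show "\<forall>\<^sub>F n in along_admissible r k. norm (\<epsilon> n) \<le> 500 * norm (real (r n) ^ 4 * real (k n) ^ 2 / real n)"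
      using ev by eventually_elim (use \<epsilon> in \<open>simp add: claim_def\<close>)
  qed
  moreover have "\<forall>\<^sub>F n in along_admissible r k. claim n (\<epsilon> n)"
    using ev by eventually_elim (rule \<epsilon>)
  then have "\<forall>\<^sub>F n in along_admissible r k.
      expected_loose_Hamilton_cycles (r n) (k n) n =
        (let R = real (r n); K = real (k n) in
          sqrt (pi / (2 * real n)) * (R - 1) *
          ((K - 1) * (R - 1) *
             ((R * K - K - R) / (R * K - K)) powr ((R - 1) * (R * K - R - K) / R))
            powr (real n / (R - 1)) *
          exp ((R - 1) * (R * K - R - 2) / (2 * (R * K - R - K)) + \<epsilon> n))"
    by eventually_elim (simp only: claim_def)
  ultimately show ?thesis by blast
qed

end
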